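(* Let $M\ge1$ be an integer, $\eta\in[0,1)$, $N_B\ge0$. Let $|\psi\rangle_{IS}=\sum_{\mathbf n\ge\mathbf 0}\sqrt{p_{\mathbf n}}\,|\chi_{\mathbf n}\rangle_I|\mathbf n\rangle_S$ be a pure state with $M$ signal modes $S$ and an arbitrary idler system $I$, where $|\mathbf n\rangle_S$ are $M$-mode number states, $\{|\chi_{\mathbf n}\rangle_I\}$ are normalized (not necessarily orthogonal), $\{p_{\mathbf n}\}$ is a probability distribution, $p_n=\sum_{\mathbf n:\,n_1+\cdots+n_M=n}p_{\mathbf n}$, and the total signal energy $\mathcal N_S=\sum_{n\ge0}np_n$ is finite. Put $\Psi=|\psi\rangle\langle\psi|_{IS}$, $$\rho_0=(\mathrm{Tr}_S\Psi)\otimes\rho_{\rm th}(N_B)^{\otimes M},\qquad \rho_1=\bigl(\mathrm{id}_I\otimes\mathcal L_{\eta,N_B}^{\otimes M}\bigr)(\Psi),$$ and let $P_e^A=\frac12-\frac14\|\rho_0-\rho_1\|_1$. With $$\nu=\Bigl(\sqrt{(N_B+1)\,((1-\eta)N_B+1)}-N_B\sqrt{1-\eta}\Bigr)^{-1},$$ one has $$P_e^A\;\ge\;\frac12\left\{1-\sqrt{1-\nu^{2M}\Bigl[\sum_{n=0}^\infty p_n\Bigl(1-\frac{\eta}{(1-\eta)N_B+1}\Bigr)^{n/2}\Bigr]^2}\right\}\;\ge\;\frac12\left[1-\sqrt{1-\nu^{2M}\Bigl(1-\frac{\eta}{(1-\eta)N_B+1}\Bigr)^{\mathcal N_S}}\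,\right].$$
   Context: $\rho_{\rm th}(N)=\sum_{n\ge0}\frac{N^n}{(N+1)^{n+1}}|n\rangle\langle n|$ is the single-mode thermal state of mean photon number $N$. $\mathcal L_{\kappa,N}$ is the single-mode thermal loss channel: the input mode $\hat a_{in}$ is mixed on a beam splitter with an environment mode $\hat a_{th}$ in state $\rho_{\rm th}(N)$, giving output $\hat a_{out}=\sqrt{\kappa}\,\hat a_{in}+\sqrt{1-\kappa}\,\hat a_{th}$, the other output being traced out. $\|X\|_1=\mathrm{Tr}\sqrt{X^\dagger X}$. $P_e^A$ is the minimum (Helstrom) error probability for discriminating $\rho_0$ from $\rho_1$ with equal priors. *)

theory Defs
  imports "HOL-Analysis.Analysis"
begin

text \<open>
  A Hilbert space with an orthonormal basis indexed by a type 'a is taken to be the space of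
  square-summable functions on 'a (every nonzero Hilbert space is of this form, up to the choice
  of an orthonormal basis), and operators on it are given by their matrix elements
  A i j = <i|A|j>.  The space of one bosonic mode has the number states as basis, so its index
  type is nat; for modes indexed by a finite type 'm the index type is 'm => nat.  The basis of a
  tensor product is indexed by pairs.
\<close>

type_synonym 'a op = "'a \<Rightarrow> 'a \<Rightarrow> complex"

definition op_adj :: "'a op \<Rightarrow> 'a op" where
  "op_adj A = (\<lambda>i j. cnj (A j i))"

definition op_mult :: "'a op \<Rightarrow> 'a op \<Rightarrow> 'a op" where
  "op_mult A B = (\<lambda>i k. \<Sum>\<^sub>\<infinity>j. A i j * B j k)"

definition op_trace :: "'a op \<Rightarrow> complex" where
  "op_trace A = (\<Sum>\<^sub>\<infinity>i. A i i)"

definition op_tensor :: "'a op \<Rightarrow> 'b op \<Rightarrow> ('a \<times> 'b) op" where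
  "op_tensor A B = (\<lambda>(i, j) (k, l). A i k * B j l)"

definition op_tensor_power :: "'a op \<Rightarrow> ('m::finite \<Rightarrow> 'a) op" where
  "op_tensor_power A = (\<lambda>m n. \<Prod>k\<in>UNIV. A (m k) (n k))"

definition trace_snd :: "('a \<times> 'b) op \<Rightarrow> 'a op" where
  "trace_snd A = (\<lambda>i j. \<Sum>\<^sub>\<infinity>s. A (i, s) (j, s))"

definition pure_op :: "('a \<Rightarrow> complex) \<Rightarrow> 'a op" where
  "pure_op \<psi> = (\<lambda>i j. \<psi> i * cnj (\<psi> j))"

definition matrix_unit :: "'a \<Rightarrow> 'a \<Rightarrow> 'a op" where
  "matrix_unit m n = (\<lambda>i j. if i = m \<and> j = n then 1 else 0)"

text \<open>
  A matrix is the matrix of a bounded (positive) operator iff its sesquilinear form is bounded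
  (and its quadratic form is nonnegative) on the dense subspace of finitely supported vectors.
\<close>

definition op_form :: "'a op \<Rightarrow> 'a set \<Rightarrow> ('a \<Rightarrow> complex) \<Rightarrow> ('a \<Rightarrow> complex) \<Rightarrow> complex" where
  "op_form A F x y = (\<Sum>i\<in>F. \<Sum>j\<in>F. cnj (x i) * A i j * y j)"

definition bounded_op :: "'a op \<Rightarrow> bool" where
  "bounded_op A \<longleftrightarrow> (\<exists>C. \<forall>F x y. finite F \<longrightarrow>
     cmod (op_form A F x y) \<le> C * L2_set (\<lambda>i. cmod (x i)) F * L2_set (\<lambda>i. cmod (y i)) F)"

definition positive_op :: "'a op \<Rightarrow> bool" where
  "positive_op A \<longleftrightarrow> bounded_op A \<and>
     (\<forall>F x. finite F \<longrightarrow> op_form A F x x \<in> \<real> \<and> 0 \<le> Re (op_form A F x x))"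

text \<open>
  A positive bounded operator has exactly one positive bounded square root, so the choice is
  immaterial.
\<close>

definition op_sqrt :: "'a op \<Rightarrow> 'a op" where
  "op_sqrt A = (SOME B. positive_op B \<and> op_mult B B = A)"

text \<open>Meaningful for trace-class X only, since infinite sums default to 0.\<close>

definition trace_norm :: "'a op \<Rightarrow> real" where
  "trace_norm X = Re (op_trace (op_sqrt (op_mult (op_adj X) X)))"

definition helstrom_error :: "'a op \<Rightarrow> 'a op \<Rightarrow> real" where
  "helstrom_error \<rho>0 \<rho>1 = 1/2 - 1/4 * trace_norm (\<rho>0 - \<rho>1)"

definition thermal_state :: "real \<Rightarrow> nat op" where
  "thermal_state N = (\<lambda>m n. if m = n then of_real (N ^ n / (N + 1) ^ (n + 1)) else 0)"

definition create_fst :: "(nat \<times> nat \<Rightarrow> complex) \<Rightarrow> nat \<times> nat \<Rightarrow> complex" where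
  "create_fst \<psi> = (\<lambda>(k, l). if k = 0 then 0 else of_real (sqrt (real k)) * \<psi> (k - 1, l))"

definition create_snd :: "(nat \<times> nat \<Rightarrow> complex) \<Rightarrow> nat \<times> nat \<Rightarrow> complex" where
  "create_snd \<psi> = (\<lambda>(k, l). if l = 0 then 0 else of_real (sqrt (real l)) * \<psi> (k, l - 1))"

definition vacuum :: "nat \<times> nat \<Rightarrow> complex" where
  "vacuum = (\<lambda>i. if i = (0, 0) then 1 else 0)"

text \<open>
  With a, b the annihilation operators of the two modes, the beam splitter is the unitary U that
  fixes the vacuum and satisfies (adj U) a U = sqrt k a + sqrt (1-k) b and
  (adj U) b U = - sqrt (1-k) a + sqrt k b.  Inverting this gives the images of the creation
  operators under conjugation X |-> U X (adj U), which are the two maps below, and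
  U|n,m> is obtained by applying them n and m times to the vacuum and normalizing.
  The sign convention of the second output does not matter once that output is traced out.
\<close>

definition bs_create_fst ::
    "real \<Rightarrow> (nat \<times> nat \<Rightarrow> complex) \<Rightarrow> nat \<times> nat \<Rightarrow> complex" where
  "bs_create_fst \<kappa> \<psi> =
     (\<lambda>i. of_real (sqrt \<kappa>) * create_fst \<psi> i - of_real (sqrt (1 - \<kappa>)) * create_snd \<psi> i)"

definition bs_create_snd ::
    "real \<Rightarrow> (nat \<times> nat \<Rightarrow> complex) \<Rightarrow> nat \<times> nat \<Rightarrow> complex" where
  "bs_create_snd \<kappa> \<psi> =
     (\<lambda>i. of_real (sqrt (1 - \<kappa>)) * create_fst \<psi> i + of_real (sqrt \<kappa>) * create_snd \<psi> i)"

definition beam_splitter :: "real \<Rightarrow> (nat \<times> nat) op" where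
  "beam_splitter \<kappa> = (\<lambda>i (n, m).
     (bs_create_fst \<kappa> ^^ n) ((bs_create_snd \<kappa> ^^ m) vacuum) i / of_real (sqrt (fact n * fact m)))"

definition thermal_loss :: "real \<Rightarrow> real \<Rightarrow> nat op \<Rightarrow> nat op" where
  "thermal_loss \<kappa> N X =
     (let U = beam_splitter \<kappa>
      in trace_snd (op_mult (op_mult U (op_tensor X (thermal_state N))) (op_adj U)))"

text \<open>
  The map id (x) L^(x)M, by linear extension of its action on the matrix units
  |i><j| (x) |m><n| of the idler and the modes.
\<close>

definition id_tensor_channel_power ::
    "(nat op \<Rightarrow> nat op) \<Rightarrow> ('i \<times> ('m::finite \<Rightarrow> nat)) op \<Rightarrow> ('i \<times> ('m \<Rightarrow> nat)) op" where
  "id_tensor_channel_power L X = (\<lambda>(i, k) (j, l).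
     \<Sum>\<^sub>\<infinity>(m, n). X (i, m) (j, n) * (\<Prod>r\<in>UNIV. L (matrix_unit (m r) (n r)) (k r) (l r)))"

definition transmitter_state ::
    "(('m \<Rightarrow> nat) \<Rightarrow> real) \<Rightarrow> (('m \<Rightarrow> nat) \<Rightarrow> 'i \<Rightarrow> complex) \<Rightarrow> 'i \<times> ('m \<Rightarrow> nat) \<Rightarrow> complex" where
  "transmitter_state p chi = (\<lambda>(i, n). of_real (sqrt (p n)) * chi n i)"

definition target_absent ::
    "real \<Rightarrow> ('i \<times> ('m::finite \<Rightarrow> nat)) op \<Rightarrow> ('i \<times> ('m \<Rightarrow> nat)) op" where
  "target_absent N \<Psi> = op_tensor (trace_snd \<Psi>) (op_tensor_power (thermal_state N))"

definition target_present ::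
    "real \<Rightarrow> real \<Rightarrow> ('i \<times> ('m::finite \<Rightarrow> nat)) op \<Rightarrow> ('i \<times> ('m \<Rightarrow> nat)) op" where
  "target_present \<eta> N \<Psi> = id_tensor_channel_power (thermal_loss \<eta> N) \<Psi>"

definition total_photon_dist :: "(('m::finite \<Rightarrow> nat) \<Rightarrow> real) \<Rightarrow> nat \<Rightarrow> real" where
  "total_photon_dist p n = (\<Sum>k | (\<Sum>r\<in>UNIV. k r) = n. p k)"

definition nu :: "real \<Rightarrow> real \<Rightarrow> real" where
  "nu \<eta> N = inverse (sqrt ((N + 1) * ((1 - \<eta>) * N + 1)) - N * sqrt (1 - \<eta>))"

text \<open>The index set of the sum in total_photon_dist is finite.\<close>

lemma finite_total_photon: "finite {k :: 'm::finite \<Rightarrow> nat. (\<Sum>r\<in>UNIV. k r) = n}"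
proof (rule finite_subset)
  show "{k :: 'm \<Rightarrow> nat. (\<Sum>r\<in>UNIV. k r) = n} \<subseteq> PiE UNIV (\<lambda>_. {..n})"
    by (auto intro: member_le_sum)
qed (simp add: finite_PiE)

definition annihilate_fst :: "(nat \<times> nat \<Rightarrow> complex) \<Rightarrow> nat \<times> nat \<Rightarrow> complex" where
  "annihilate_fst \<psi> = (\<lambda>(k, l). of_real (sqrt (real (Suc k))) * \<psi> (Suc k, l))"

lemma annihilate_bs_create_fst:
  "annihilate_fst (bs_create_fst \<kappa> \<psi>) =
     (\<lambda>i. of_real (sqrt \<kappa>) * \<psi> i + bs_create_fst \<kappa> (annihilate_fst \<psi>) i)"
proof (rule ext, clarify)
  fix k l
  have *: "complex_of_real (sqrt (1 + real k)) * (of_real (sqrt (1 + real k)) * z) = (1 + of_nat k) * z"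
    "complex_of_real (sqrt (real k)) * (of_real (sqrt (real k)) * z) = of_nat k * z" for z
    by (simp_all flip: of_real_mult mult.assoc)
  show "annihilate_fst (bs_create_fst \<kappa> \<psi>) (k, l) =
      of_real (sqrt \<kappa>) * \<psi> (k, l) + bs_create_fst \<kappa> (annihilate_fst \<psi>) (k, l)"
    using * by (cases k) (simp_all add: annihilate_fst_def bs_create_fst_def create_fst_def
        create_snd_def algebra_simps)
qed

lemma annihilate_bs_create_snd:
  "annihilate_fst (bs_create_snd \<kappa> \<psi>) =
     (\<lambda>i. of_real (sqrt (1 - \<kappa>)) * \<psi> i + bs_create_snd \<kappa> (annihilate_fst \<psi>) i)"
proof (rule ext, clarify)
  fix k l
  have *: "complex_of_real (sqrt (1 + real k)) * (of_real (sqrt (1 + real k)) * z) = (1 + of_nat k) * z"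
    "complex_of_real (sqrt (real k)) * (of_real (sqrt (real k)) * z) = of_nat k * z" for z
    by (simp_all flip: of_real_mult mult.assoc)
  show "annihilate_fst (bs_create_snd \<kappa> \<psi>) (k, l) =
      of_real (sqrt (1 - \<kappa>)) * \<psi> (k, l) + bs_create_snd \<kappa> (annihilate_fst \<psi>) (k, l)"
    using * by (cases k) (simp_all add: annihilate_fst_def bs_create_snd_def create_fst_def
        create_snd_def algebra_simps)
qed

lemma bs_create_linear:
  "bs_create_fst \<kappa> (\<lambda>i. a * f i + b * g i) =
     (\<lambda>i. a * bs_create_fst \<kappa> f i + b * bs_create_fst \<kappa> g i)"
  "bs_create_snd \<kappa> (\<lambda>i. a * f i) = (\<lambda>i. a * bs_create_snd \<kappa> f i)"
  by (auto simp: bs_create_fst_def bs_create_snd_def create_fst_def create_snd_def fun_eq_iff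
      algebra_simps)

lemma annihilate_bs_create_snd_power:
  "annihilate_fst ((bs_create_snd \<kappa> ^^ m) vacuum) =
     (\<lambda>i. of_nat m * of_real (sqrt (1 - \<kappa>)) * (bs_create_snd \<kappa> ^^ (m - 1)) vacuum i)"
proof (induction m)
  case 0
  show ?case by (auto simp: annihilate_fst_def vacuum_def)
next
  case (Suc m)
  show ?case
    unfolding funpow.simps o_apply annihilate_bs_create_snd Suc.IH bs_create_linear
    by (cases m) (auto simp: algebra_simps)
qed

lemma annihilate_bs_create_power:
  "annihilate_fst ((bs_create_fst \<kappa> ^^ n) ((bs_create_snd \<kappa> ^^ m) vacuum)) =
     (\<lambda>i. of_nat n * of_real (sqrt \<kappa>) *
            (bs_create_fst \<kappa> ^^ (n - 1)) ((bs_create_snd \<kappa> ^^ m) vacuum) i +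
          of_nat m * of_real (sqrt (1 - \<kappa>)) *
            (bs_create_fst \<kappa> ^^ n) ((bs_create_snd \<kappa> ^^ (m - 1)) vacuum) i)"
proof (induction n)
  case 0
  show ?case by (simp add: annihilate_bs_create_snd_power)
next
  case (Suc n)
  show ?case
    unfolding funpow.simps o_apply annihilate_bs_create_fst Suc.IH bs_create_linear
    by (cases n) (auto simp: algebra_simps)
qed

text \<open>
  The defining relation a_out = sqrt k a_in + sqrt (1-k) a_th of the beam splitter, in the form
  a U = U (sqrt k a + sqrt (1-k) b), between <k,l| and |n,m>.
\<close>

lemma beam_splitter_output_mode:
  "of_real (sqrt (real (Suc k))) * beam_splitter \<kappa> (Suc k, l) (n, m) =
     of_real (sqrt \<kappa> * sqrt (real n)) * beam_splitter \<kappa> (k, l) (n - 1, m) +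
     of_real (sqrt (1 - \<kappa>) * sqrt (real m)) * beam_splitter \<kappa> (k, l) (n, m - 1)"
proof -
  define V where "V n m = (bs_create_fst \<kappa> ^^ n) ((bs_create_snd \<kappa> ^^ m) vacuum) (k, l)" for n m
  have f: "of_nat j * z / complex_of_real (sqrt (fact j * r)) =
      of_real (sqrt (real j)) * (z / of_real (sqrt (fact (j - 1) * r)))" for j z and r :: real
  proof (cases j)
    case (Suc i)
    have "complex_of_nat (Suc i) = of_real (sqrt (real (Suc i))) * of_real (sqrt (real (Suc i)))"
      by (simp flip: of_real_mult)
    moreover have "complex_of_real (sqrt (fact (Suc i) * r)) =
        of_real (sqrt (real (Suc i))) * of_real (sqrt (fact i * r))"
      by (simp add: real_sqrt_mult mult.assoc del: of_nat_Suc)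
    ultimately show ?thesis
      using Suc by (simp add: field_simps del: of_nat_Suc)
  qed simp
  have "of_real (sqrt (real (Suc k))) * beam_splitter \<kappa> (Suc k, l) (n, m) =
      annihilate_fst ((bs_create_fst \<kappa> ^^ n) ((bs_create_snd \<kappa> ^^ m) vacuum)) (k, l) /
        of_real (sqrt (fact n * fact m))"
    by (simp add: annihilate_fst_def beam_splitter_def)
  also have "\<dots> = of_real (sqrt \<kappa>) * (of_nat n * V (n - 1) m / of_real (sqrt (fact n * fact m))) +
      of_real (sqrt (1 - \<kappa>)) * (of_nat m * V n (m - 1) / of_real (sqrt (fact m * fact n)))"
    by (simp add: annihilate_bs_create_power V_def add_divide_distrib mult_ac)
  finally show ?thesis
    unfolding f by (simp add: beam_splitter_def V_def mult_ac)
qed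

end

(*
  The thermal loss channel is a pure loss channel followed by a quantum-limited amplifier, and the
  state for an absent target is of the same form with transmissivity zero.  The resulting Kraus
  representations give purifications of both hypotheses with the same environment (the lost photons
  and the photons of the amplifier's idler mode), whose overlap is nu^M * sum_n p_n x^(n/2).  The
  trace norm cannot increase under the partial trace over the environment, so it is at most
  2 * sqrt (1 - overlap^2); the second bound is Jensen's inequality.

  That the channel has this decomposition follows from a recursion which determines its matrix
  elements and which both sides satisfy.  The trace norm is estimated by an approximate polar
  decomposition, built from a resolvent of the square root, so that no spectral theorem is needed.
*)
theory Submission
  imports Defs
begin

subsection \<open>Square-summable families\<close>

text \<open>Put G = (1 - \<eta>) N_B + 1. The loss has transmissivity h = \<eta> / G and the
  amplifier gain G = 1 / (1 - t): their product is \<eta>, and the noise G - 1 added by the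
  amplifier is (1 - \<eta>) N_B. So x = 1 - h is the probability that the loss takes a given photon.
  If the target is absent, the environment receives every signal photon, and the output number k
  equals the number b in the amplifier's idler. Only the branch in which the present target also
  loses all m photons of a mode overlaps with this; it contributes x^(m/2) times a geometric series
  in b with initial term 1 / sqrt((N_B + 1) G) and ratio N_B sqrt(1 - \<eta>) / sqrt((N_B + 1) G),
  whose sum is \<nu>. All amplitudes of the two dilations are nonnegative square roots, so nothing
  cancels. The trace norm bound rests on |f><f| - |g><g| = (|u><v| + |v><u|) / 2 with u = f - g, v =
  f + g. The obstacle is that \<open>op_sqrt\<close> is a bare choice and divergent sums are 0:
  square roots have to be constructed, and convergence proved before sums are exchanged, from matrix
  elements alone.\<close>

definition l2 :: "('a \<Rightarrow> complex) \<Rightarrow> bool" where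
  "l2 x \<longleftrightarrow> (\<lambda>i. (cmod (x i))\<^sup>2) summable_on UNIV"

definition l2_norm :: "('a \<Rightarrow> complex) \<Rightarrow> real" where
  "l2_norm x = sqrt (\<Sum>\<^sub>\<infinity>i. (cmod (x i))\<^sup>2)"

definition l2_inner :: "('a \<Rightarrow> complex) \<Rightarrow> ('a \<Rightarrow> complex) \<Rightarrow> complex" where
  "l2_inner x y = (\<Sum>\<^sub>\<infinity>i. cnj (x i) * y i)"

text \<open>\<open>op_form\<close> sees a finitely supported vector as a function together with a
  finite set; this is its norm in that picture.\<close>

abbreviation fin_norm :: "('a \<Rightarrow> complex) \<Rightarrow> 'a set \<Rightarrow> real" where
  "fin_norm x F \<equiv> L2_set (\<lambda>i. cmod (x i)) F"

lemma l2_norm_nonneg [simp]: "0 \<le> l2_norm x"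
  by (simp add: l2_norm_def infsum_nonneg)

lemma l2_norm_power2: "(l2_norm x)\<^sup>2 = (\<Sum>\<^sub>\<infinity>i. (cmod (x i))\<^sup>2)"
  by (simp add: l2_norm_def infsum_nonneg)

lemma has_sum_l2_norm: "l2 x \<Longrightarrow> ((\<lambda>i. (cmod (x i))\<^sup>2) has_sum (l2_norm x)\<^sup>2) UNIV"
  by (simp add: l2_def l2_norm_power2)

lemma fin_norm_le_l2_norm:
  assumes "l2 x"
  shows "fin_norm x F \<le> l2_norm x"
proof (cases "finite F")
  case True
  then show ?thesis
    using assms unfolding L2_set_def l2_norm_def l2_def
    by (intro real_sqrt_le_mono finite_sum_le_infsum) auto
qed simp

text \<open>Bounded partial sums of squares give convergence and the bound on the limit at once, so
  membership in l2 and norm estimates are both reduced to finite sets.\<close>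

lemma
  assumes "\<And>F. finite F \<Longrightarrow> fin_norm x F \<le> C"
  shows l2I: "l2 x" and l2_norm_leI: "l2_norm x \<le> C"
proof -
  have *: "(\<Sum>i\<in>F. (cmod (x i))\<^sup>2) \<le> C\<^sup>2" if "finite F" for F
    using assms[OF that] unfolding L2_set_def
    by (metis real_sqrt_ge_zero real_sqrt_pow2_iff sum_nonneg power_mono zero_le_power2)
  have "0 \<le> C"
    using assms[of "{}"] by simp
  show "l2 x"
    unfolding l2_def using *
    by (intro nonneg_bdd_above_summable_on bdd_aboveI[of _ "C\<^sup>2"]) auto
  then have "(l2_norm x)\<^sup>2 \<le> C\<^sup>2"
    unfolding l2_norm_power2 l2_def using * by (intro infsum_le_finite_sums) auto
  then show "l2_norm x \<le> C"
    using \<open>0 \<le> C\<close> by (simp add: power2_le_iff_abs_le)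
qed

lemma l2_zero [simp]: "l2 (\<lambda>_. 0)"
  by (simp add: l2_def)

lemma l2_add:
  assumes "l2 x" "l2 y"
  shows "l2 (\<lambda>i. x i + y i)"
proof (rule l2I)
  fix F
  have "fin_norm (\<lambda>i. x i + y i) F \<le> L2_set (\<lambda>i. cmod (x i) + cmod (y i)) F"
    by (intro L2_set_mono norm_triangle_ineq) simp
  also have "\<dots> \<le> fin_norm x F + fin_norm y F"
    by (rule L2_set_triangle_ineq)
  also have "\<dots> \<le> l2_norm x + l2_norm y"
    by (intro add_mono fin_norm_le_l2_norm assms)
  finally show "fin_norm (\<lambda>i. x i + y i) F \<le> l2_norm x + l2_norm y" .
qed

lemma l2_scale:
  assumes "l2 x"
  shows "l2 (\<lambda>i. c * x i)"
  using summable_on_cmult_right[of _ _ "(cmod c)\<^sup>2"] assms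
  by (simp add: l2_def norm_mult power_mult_distrib)

lemma l2_diff: "l2 x \<Longrightarrow> l2 y \<Longrightarrow> l2 (\<lambda>i. x i - y i)"
  using l2_add[of x "\<lambda>i. (-1) * y i"] l2_scale[of y "-1"] by simp

lemma l2_cnj [simp]: "l2 (\<lambda>i. cnj (x i)) \<longleftrightarrow> l2 x"
  by (simp add: l2_def)

lemma l2_norm_cnj [simp]: "l2_norm (\<lambda>i. cnj (x i)) = l2_norm x"
  by (simp add: l2_norm_def)

lemma l2_sum: "(\<And>k. k \<in> K \<Longrightarrow> l2 (x k)) \<Longrightarrow> l2 (\<lambda>i. \<Sum>k\<in>K. x k i)"
  by (induction K rule: infinite_finite_induct) (auto intro: l2_add)

lemma
  assumes "finite F" "\<And>i. i \<notin> F \<Longrightarrow> x i = 0"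
  shows l2_finite_support: "l2 x" and l2_norm_finite_support: "l2_norm x = fin_norm x F"
proof -
  have "((\<lambda>i. (cmod (x i))\<^sup>2) has_sum (\<Sum>i\<in>F. (cmod (x i))\<^sup>2)) UNIV"
    using assms by (intro has_sum_finite_neutralI) auto
  then show "l2 x" "l2_norm x = fin_norm x F"
    by (auto simp: l2_def l2_norm_def L2_set_def infsumI intro: has_sum_imp_summable)
qed

lemma
  assumes "l2 x" "l2 y"
  shows abs_summable_l2_mult: "(\<lambda>i. cmod (x i * y i)) summable_on UNIV"
    and infsum_cmod_mult_le: "(\<Sum>\<^sub>\<infinity>i. cmod (x i) * cmod (y i)) \<le> l2_norm x * l2_norm y"
proof -
  have *: "(\<Sum>i\<in>F. cmod (x i) * cmod (y i)) \<le> l2_norm x * l2_norm y" for F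
  proof -
    have "(\<Sum>i\<in>F. cmod (x i) * cmod (y i)) \<le> fin_norm x F * fin_norm y F"
      using L2_set_mult_ineq[of "\<lambda>i. cmod (x i)" "\<lambda>i. cmod (y i)" F] by simp
    also have "\<dots> \<le> l2_norm x * l2_norm y"
      by (intro mult_mono fin_norm_le_l2_norm assms) auto
    finally show ?thesis .
  qed
  have s: "(\<lambda>i. cmod (x i) * cmod (y i)) summable_on UNIV"
    using * by (intro nonneg_bdd_above_summable_on bdd_aboveI[of _ "l2_norm x * l2_norm y"]) auto
  then show "(\<lambda>i. cmod (x i * y i)) summable_on UNIV"
    by (simp add: norm_mult)
  show "(\<Sum>\<^sub>\<infinity>i. cmod (x i) * cmod (y i)) \<le> l2_norm x * l2_norm y"
    by (rule infsum_le_finite_sums[OF s *])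
qed

lemma summable_l2_mult: "l2 x \<Longrightarrow> l2 y \<Longrightarrow> (\<lambda>i. x i * y i) summable_on UNIV"
  by (rule abs_summable_summable[OF abs_summable_l2_mult])

lemma cmod_infsum_mult_le:
  assumes "l2 x" "l2 y"
  shows "cmod (\<Sum>\<^sub>\<infinity>i. x i * y i) \<le> l2_norm x * l2_norm y"
  using norm_infsum_bound[OF abs_summable_l2_mult[OF assms]] infsum_cmod_mult_le[OF assms]
  by (simp add: norm_mult)

lemma cmod_l2_inner_le: "l2 x \<Longrightarrow> l2 y \<Longrightarrow> cmod (l2_inner x y) \<le> l2_norm x * l2_norm y"
  using cmod_infsum_mult_le[of "\<lambda>i. cnj (x i)" y] by (simp add: l2_inner_def)

lemma l2_inner_commute: "l2_inner y x = cnj (l2_inner x y)"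
  by (simp add: l2_inner_def mult.commute flip: infsum_cnj)

lemma cnj_mult_self: "cnj z * z = (of_real (cmod z))\<^sup>2"
  by (metis complex_norm_square mult.commute of_real_power)

lemma l2_inner_self: "l2 x \<Longrightarrow> l2_inner x x = (of_real (l2_norm x))\<^sup>2"
  unfolding l2_inner_def cnj_mult_self using has_sum_of_real[OF has_sum_l2_norm, of x, where ?'a = complex]
  by (simp add: infsumI)

lemma l2_inner_add_right:
  "l2 x \<Longrightarrow> l2 y \<Longrightarrow> l2 z \<Longrightarrow> l2_inner x (\<lambda>i. y i + z i) = l2_inner x y + l2_inner x z"
  unfolding l2_inner_def distrib_left by (intro infsum_add summable_l2_mult) simp_all

lemma l2_inner_scale_right: "l2_inner x (\<lambda>i. c * y i) = c * l2_inner x y"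
  by (simp add: l2_inner_def mult.left_commute infsum_cmult_right')

lemma l2_inner_diff_right:
  assumes "l2 x" "l2 y" "l2 z"
  shows "l2_inner x (\<lambda>i. y i - z i) = l2_inner x y - l2_inner x z"
  using l2_inner_add_right[of x y "\<lambda>i. (-1) * z i"] l2_inner_scale_right[of x "-1" z] assms
    l2_scale[of z "-1"] by simp

lemma l2_inner_sum_right:
  "l2 x \<Longrightarrow> (\<And>k. k \<in> K \<Longrightarrow> l2 (y k)) \<Longrightarrow> l2_inner x (\<lambda>i. \<Sum>k\<in>K. y k i) = (\<Sum>k\<in>K. l2_inner x (y k))"
proof (induction K rule: infinite_finite_induct)
  case (insert k K)
  then show ?case
    by (simp add: l2_inner_add_right l2_sum)
qed (simp_all add: l2_inner_def)

text \<open>Turns the pair of function and finite set used by \<open>op_form\<close> into a vector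
  of l2.\<close>

definition restr :: "'a set \<Rightarrow> ('a \<Rightarrow> complex) \<Rightarrow> 'a \<Rightarrow> complex" where
  "restr F x = (\<lambda>i. if i \<in> F then x i else 0)"

lemma
  assumes "finite F"
  shows l2_restr: "l2 (restr F x)" and l2_norm_restr: "l2_norm (restr F x) = fin_norm x F"
proof -
  show "l2 (restr F x)"
    by (rule l2_finite_support[OF assms]) (simp add: restr_def)
  have "l2_norm (restr F x) = fin_norm (restr F x) F"
    by (rule l2_norm_finite_support[OF assms]) (simp add: restr_def)
  then show "l2_norm (restr F x) = fin_norm x F"
    by (simp add: restr_def L2_set_def)
qed

text \<open>The squared norm of the tail is the total minus a partial sum. This density of finitely
  supported vectors extends identities between finite sums to all of l2.\<close>

lemma tendsto_restr:
  assumes "l2 x"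
  shows "((\<lambda>F. l2_norm (\<lambda>i. x i - restr F x i)) \<longlongrightarrow> 0) (finite_subsets_at_top UNIV)"
proof -
  have eq: "l2_norm (\<lambda>i. x i - restr F x i) = sqrt ((l2_norm x)\<^sup>2 - (\<Sum>i\<in>F. (cmod (x i))\<^sup>2))"
    if F: "finite F" for F
  proof -
    have "((\<lambda>i. (cmod (x i))\<^sup>2) has_sum
        ((l2_norm x)\<^sup>2 - (\<Sum>i\<in>F. (cmod (x i))\<^sup>2))) (UNIV - F)"
      using F by (intro has_sum_Diff has_sum_l2_norm[OF assms]) auto
    moreover have "(\<Sum>\<^sub>\<infinity>i. (cmod (x i - restr F x i))\<^sup>2) = (\<Sum>\<^sub>\<infinity>i\<in>UNIV - F. (cmod (x i))\<^sup>2)"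
      by (rule infsum_cong_neutral) (auto simp: restr_def)
    ultimately show ?thesis
      by (simp add: l2_norm_def infsumI)
  qed
  have "((\<lambda>F. sqrt ((l2_norm x)\<^sup>2 - (\<Sum>i\<in>F. (cmod (x i))\<^sup>2))) \<longlongrightarrow> sqrt ((l2_norm x)\<^sup>2 - (l2_norm x)\<^sup>2))
      (finite_subsets_at_top UNIV)"
    using has_sum_l2_norm[OF assms] unfolding has_sum_def by (intro tendsto_intros)
  then have "((\<lambda>F. sqrt ((l2_norm x)\<^sup>2 - (\<Sum>i\<in>F. (cmod (x i))\<^sup>2))) \<longlongrightarrow> 0)
      (finite_subsets_at_top UNIV)"
    by simp
  then show ?thesis
    by (intro Lim_transform_eventually[where g = "\<lambda>F. l2_norm (\<lambda>i. x i - restr F x i)"])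
      (auto intro!: eventually_finite_subsets_at_top_weakI simp: eq)
qed

subsection \<open>Matrices of bounded operators\<close>

text \<open>The constant of \<open>bounded_op\<close> is made explicit because the iterations below
  compare the sizes of operators with a scalar sequence.\<close>

definition op_bound :: "'a op \<Rightarrow> real \<Rightarrow> bool" where
  "op_bound A C \<longleftrightarrow> 0 \<le> C \<and>
     (\<forall>F x y. finite F \<longrightarrow> cmod (op_form A F x y) \<le> C * fin_norm x F * fin_norm y F)"

definition op_apply :: "'a op \<Rightarrow> ('a \<Rightarrow> complex) \<Rightarrow> 'a \<Rightarrow> complex" where
  "op_apply A x = (\<lambda>i. \<Sum>\<^sub>\<infinity>j. A i j * x j)"

definition op_hermitian :: "'a op \<Rightarrow> bool" where
  "op_hermitian A \<longleftrightarrow> op_adj A = A"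

definition op_one :: "'a op" where
  "op_one = (\<lambda>i j. if i = j then 1 else 0)"

lemma bounded_op_iff: "bounded_op A \<longleftrightarrow> (\<exists>C. op_bound A C)"
proof
  assume "bounded_op A"
  then obtain C where C: "\<And>F x y. finite F \<Longrightarrow>
      cmod (op_form A F x y) \<le> C * fin_norm x F * fin_norm y F"
    unfolding bounded_op_def by blast
  have "cmod (op_form A F x y) \<le> max C 0 * fin_norm x F * fin_norm y F" if "finite F" for F x y
    using C[OF that, of x y] by (rule order_trans) (intro mult_right_mono; simp)
  then show "\<exists>C. op_bound A C"
    unfolding op_bound_def by (intro exI[of _ "max C 0"]) auto
qed (auto simp: op_bound_def bounded_op_def)

lemma op_bound_nonneg: "op_bound A C \<Longrightarrow> 0 \<le> C"
  by (simp add: op_bound_def)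

lemma op_boundD:
  "op_bound A C \<Longrightarrow> finite F \<Longrightarrow> cmod (op_form A F x y) \<le> C * fin_norm x F * fin_norm y F"
  by (simp add: op_bound_def)

lemma op_bound_mono:
  assumes "op_bound A C" "C \<le> D"
  shows "op_bound A D"
  unfolding op_bound_def
proof safe
  show "0 \<le> D"
    using assms op_bound_nonneg by fastforce
  fix F x y assume "finite (F :: 'a set)"
  from op_boundD[OF assms(1) this, of x y]
  show "cmod (op_form A F x y) \<le> D * fin_norm x F * fin_norm y F"
    by (rule order_trans) (use assms in \<open>intro mult_right_mono; simp\<close>)
qed

lemma op_form_add: "op_form (\<lambda>i j. A i j + B i j) F x y = op_form A F x y + op_form B F x y"
  by (simp add: op_form_def algebra_simps sum.distrib)

lemma op_form_diff: "op_form (\<lambda>i j. A i j - B i j) F x y = op_form A F x y - op_form B F x y"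
  by (simp add: op_form_def algebra_simps sum_subtractf)

lemma op_form_scale: "op_form (\<lambda>i j. c * A i j) F x y = c * op_form A F x y"
  by (simp add: op_form_def sum_distrib_left mult_ac)

lemma op_form_adj: "op_form (op_adj A) F x y = cnj (op_form A F y x)"
  by (simp add: op_form_def op_adj_def mult_ac) (rule sum.swap)

lemma op_form_restr: "finite F \<Longrightarrow> op_form A F x y = l2_inner (restr F x) (op_apply A (restr F y))"
proof -
  assume F: "finite F"
  have "op_apply A (restr F y) i = (\<Sum>j\<in>F. A i j * y j)" for i
    unfolding op_apply_def
    by (rule infsumI, rule has_sum_finite_neutralI[OF F]) (auto simp: restr_def)
  moreover have "l2_inner (restr F x) z = (\<Sum>i\<in>F. cnj (x i) * z i)" for z
    unfolding l2_inner_def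
    by (rule infsumI, rule has_sum_finite_neutralI[OF F]) (auto simp: restr_def)
  ultimately show ?thesis
    by (simp add: op_form_def sum_distrib_left mult.assoc)
qed

lemma op_bound_add:
  assumes "op_bound A C" "op_bound B D"
  shows "op_bound (\<lambda>i j. A i j + B i j) (C + D)"
  unfolding op_bound_def
proof safe
  show "0 \<le> C + D"
    using assms[THEN op_bound_nonneg] by simp
  fix F x y assume F: "finite (F :: 'a set)"
  have "cmod (op_form A F x y + op_form B F x y) \<le>
      C * fin_norm x F * fin_norm y F + D * fin_norm x F * fin_norm y F"
    by (intro norm_triangle_le add_mono op_boundD assms F)
  then show "cmod (op_form (\<lambda>i j. A i j + B i j) F x y) \<le> (C + D) * fin_norm x F * fin_norm y F"
    by (simp add: op_form_add algebra_simps)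
qed

lemma op_bound_scale:
  assumes "op_bound A C"
  shows "op_bound (\<lambda>i j. c * A i j) (cmod c * C)"
  unfolding op_bound_def
proof safe
  show "0 \<le> cmod c * C"
    using op_bound_nonneg[OF assms] by simp
  fix F x y assume F: "finite (F :: 'a set)"
  show "cmod (op_form (\<lambda>i j. c * A i j) F x y) \<le> cmod c * C * fin_norm x F * fin_norm y F"
    using mult_left_mono[OF op_boundD[OF assms F, of x y], of "cmod c"]
    by (simp add: op_form_scale norm_mult mult_ac)
qed

lemma op_bound_diff:
  "op_bound A C \<Longrightarrow> op_bound B D \<Longrightarrow> op_bound (\<lambda>i j. A i j - B i j) (C + D)"
  using op_bound_add[of A C "\<lambda>i j. (-1) * B i j" D] op_bound_scale[of B D "-1"] by simp

lemma op_bound_zero: "op_bound (\<lambda>_ _. 0) 0"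
  by (simp add: op_bound_def op_form_def)

lemma op_bound_adj: "op_bound A C \<Longrightarrow> op_bound (op_adj A) C"
  unfolding op_bound_def op_form_adj by (metis complex_mod_cnj mult.commute mult.left_commute)

lemma fin_norm_basis: "finite F \<Longrightarrow> i \<in> F \<Longrightarrow> fin_norm (\<lambda>j. if j = i then 1 else 0) F = 1"
  by (simp add: L2_set_def if_distrib[of "\<lambda>z. (cmod z)\<^sup>2"] cong: if_cong)

text \<open>The form is tested on e_i and the conjugate of row i cut off to a finite set: if s is
  the norm of that piece, the value is s^2 and the bound C s. Square-summable rows are what makes
  \<open>op_apply\<close> converge.\<close>

lemma
  assumes "op_bound A C"
  shows op_bound_row: "l2 (\<lambda>j. A i j)" and op_bound_row_norm: "l2_norm (\<lambda>j. A i j) \<le> C"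
proof -
  have "fin_norm (\<lambda>j. A i j) F \<le> C" if F: "finite F" for F
  proof -
    define G where "G = insert i F"
    have G: "finite G" "i \<in> G" "F \<subseteq> G"
      using F by (auto simp: G_def)
    define s where "s = fin_norm (\<lambda>j. A i j) F"
    define y where "y = restr F (\<lambda>j. cnj (A i j))"
    have y: "fin_norm y G = s"
    proof -
      have "(\<Sum>j\<in>G. (cmod (y j))\<^sup>2) = (\<Sum>j\<in>F. (cmod (A i j))\<^sup>2)"
        using G by (intro sum.mono_neutral_cong_right) (auto simp: y_def restr_def)
      then show ?thesis
        by (simp add: L2_set_def s_def)
    qed
    have "op_form A G (\<lambda>j. if j = i then 1 else 0) y = (\<Sum>j\<in>G. A i j * y j)"
    proof -
      have "op_form A G (\<lambda>j. if j = i then 1 else 0) y =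
          (\<Sum>k\<in>G. if k = i then \<Sum>j\<in>G. A i j * y j else 0)"
        unfolding op_form_def by (intro sum.cong) auto
      then show ?thesis
        using G by simp
    qed
    also have "\<dots> = (\<Sum>j\<in>F. of_real ((cmod (A i j))\<^sup>2))"
      using G by (intro sum.mono_neutral_cong_right)
        (auto simp: y_def restr_def mult.commute simp flip: cnj_mult_self)
    also have "\<dots> = of_real (s\<^sup>2)"
      by (simp add: s_def L2_set_def sum_nonneg)
    finally have "s\<^sup>2 \<le> C * s"
      using op_boundD[OF assms G(1), of "\<lambda>j. if j = i then 1 else 0" y] G
      by (simp add: fin_norm_basis y norm_power)
    then show "s \<le> C"
      using op_bound_nonneg[OF assms]
      by (cases "s = 0") (auto simp: power2_eq_square s_def dest: mult_right_le_imp_le)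
  qed
  then show "l2 (\<lambda>j. A i j)" "l2_norm (\<lambda>j. A i j) \<le> C"
    by (auto intro: l2I l2_norm_leI)
qed

lemma op_bound_entry:
  assumes "op_bound A C"
  shows "cmod (A i j) \<le> C"
  using fin_norm_le_l2_norm[OF op_bound_row[OF assms], of i "{j}"] op_bound_row_norm[OF assms, of i]
  by simp

lemma op_apply_summable: "op_bound A C \<Longrightarrow> l2 x \<Longrightarrow> (\<lambda>j. A i j * x j) summable_on UNIV"
  by (intro summable_l2_mult op_bound_row[of A C])

text \<open>The image, cut off to F, is tested against itself: its squared norm s^2 is a limit of
  finite forms, each at most C s norm(y).\<close>

lemma
  assumes A: "op_bound A C" and y: "l2 y"
  shows l2_op_apply: "l2 (op_apply A y)"
    and l2_norm_op_apply: "l2_norm (op_apply A y) \<le> C * l2_norm y"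
proof -
  have "fin_norm (op_apply A y) F \<le> C * l2_norm y" if F: "finite F" for F
  proof -
    define z where "z = op_apply A y"
    define s where "s = fin_norm z F"
    have s: "fin_norm (restr F z) G = s" if "finite G" "F \<subseteq> G" for G
      unfolding s_def L2_set_def
      by (intro arg_cong[of _ _ sqrt] sum.mono_neutral_cong_right) (use that in \<open>auto simp: restr_def\<close>)
    define S where "S G = (\<Sum>i\<in>F. cnj (z i) * (\<Sum>j\<in>G. A i j * y j))" for G
    have "(S \<longlongrightarrow> (\<Sum>i\<in>F. cnj (z i) * z i)) (finite_subsets_at_top UNIV)"
      unfolding S_def z_def op_apply_def using op_apply_summable[OF A y]
      by (intro tendsto_sum tendsto_mult tendsto_const infsum_tendsto)
    then have "((\<lambda>G. cmod (S G)) \<longlongrightarrow> cmod (\<Sum>i\<in>F. cnj (z i) * z i)) (finite_subsets_at_top UNIV)"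
      by (rule tendsto_norm)
    moreover have "(\<Sum>i\<in>F. cnj (z i) * z i) = of_real (s\<^sup>2)"
      by (simp add: s_def L2_set_def sum_nonneg cnj_mult_self)
    moreover have "cmod (S G) \<le> C * s * l2_norm y" if G: "finite G" "F \<subseteq> G" for G
    proof -
      have "S G = op_form A G (restr F z) y"
        unfolding S_def op_form_def using G
        by (intro sum.mono_neutral_cong_left) (auto simp: restr_def sum_distrib_left mult.assoc)
      also have "cmod \<dots> \<le> C * s * fin_norm y G"
        using op_boundD[OF A G(1), of "restr F z" y] s[OF G] by simp
      also have "\<dots> \<le> C * s * l2_norm y"
        using op_bound_nonneg[OF A] by (intro mult_left_mono fin_norm_le_l2_norm y) (auto simp: s_def)
      finally show ?thesis .
    qed
    then have "\<forall>\<^sub>F G in finite_subsets_at_top UNIV. cmod (S G) \<le> C * s * l2_norm y"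
      using F unfolding eventually_finite_subsets_at_top by blast
    ultimately have "s\<^sup>2 \<le> C * s * l2_norm y"
      by (auto dest: tendsto_upperbound simp: norm_power)
    then have "s * s \<le> s * (C * l2_norm y)"
      by (simp add: power2_eq_square mult_ac)
    then show "s \<le> C * l2_norm y"
      using op_bound_nonneg[OF A] L2_set_nonneg[of "\<lambda>i. cmod (z i)" F]
      by (cases "s = 0") (simp_all add: s_def mult_le_cancel_left less_le)
  qed
  then show "l2 (op_apply A y)" "l2_norm (op_apply A y) \<le> C * l2_norm y"
    by (auto intro: l2I l2_norm_leI)
qed

lemma op_boundI:
  assumes "0 \<le> C" "\<And>y. l2 y \<Longrightarrow> l2 (op_apply A y)"
    and "\<And>y. l2 y \<Longrightarrow> l2_norm (op_apply A y) \<le> C * l2_norm y"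
  shows "op_bound A C"
  unfolding op_bound_def
proof safe
  fix F x y assume F: "finite (F :: 'a set)"
  have "cmod (op_form A F x y) \<le> l2_norm (restr F x) * l2_norm (op_apply A (restr F y))"
    unfolding op_form_restr[OF F] by (intro cmod_l2_inner_le assms l2_restr F)
  also have "\<dots> \<le> l2_norm (restr F x) * (C * l2_norm (restr F y))"
    by (intro mult_left_mono assms l2_restr F) auto
  finally show "cmod (op_form A F x y) \<le> C * fin_norm x F * fin_norm y F"
    by (simp add: l2_norm_restr F mult_ac)
qed (use assms in auto)

lemma op_apply_add:
  "op_bound A C \<Longrightarrow> l2 x \<Longrightarrow> l2 y \<Longrightarrow>
    op_apply A (\<lambda>i. x i + y i) = (\<lambda>i. op_apply A x i + op_apply A y i)"
  unfolding op_apply_def distrib_left by (intro ext infsum_add op_apply_summable)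

lemma op_apply_scale: "op_apply A (\<lambda>i. c * x i) = (\<lambda>i. c * op_apply A x i)"
  by (simp add: op_apply_def mult.left_commute infsum_cmult_right')

lemma op_apply_diff:
  assumes "op_bound A C" "l2 x" "l2 y"
  shows "op_apply A (\<lambda>i. x i - y i) = (\<lambda>i. op_apply A x i - op_apply A y i)"
  using op_apply_add[of A C x "\<lambda>i. (-1) * y i"] op_apply_scale[of A "-1" y] l2_scale[of y "-1"] assms
  by simp

lemma op_apply_sum:
  assumes "op_bound A C" "\<And>k. k \<in> K \<Longrightarrow> l2 (x k)"
  shows "op_apply A (\<lambda>i. \<Sum>k\<in>K. x k i) = (\<lambda>i. \<Sum>k\<in>K. op_apply A (x k) i)"
  using assms(2)
proof (induction K rule: infinite_finite_induct)
  case (insert k K)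
  then show ?case
    by (simp add: op_apply_add[OF assms(1)] l2_sum)
qed (simp_all add: op_apply_def)

lemma op_apply_one [simp]: "op_apply op_one x = x"
proof
  fix i
  show "op_apply op_one x i = x i"
    unfolding op_apply_def op_one_def
    by (rule infsumI, rule has_sum_finite_neutralI[of "{i}"]) auto
qed

lemma op_bound_one: "op_bound op_one 1"
  by (rule op_boundI) auto

text \<open>For a bounded matrix the double series over i and j need not converge absolutely, so the
  sums cannot simply be exchanged. For finitely supported y only a finite sum is exchanged with an
  infinite one; truncating a general y to G costs at most norm(x) C norm(y - y_G).\<close>

lemma op_inner_adjoint:
  assumes A: "op_bound A C" and x: "l2 x" and y: "l2 y"
  shows "l2_inner (op_apply (op_adj A) x) y = l2_inner x (op_apply A y)"
proof -
  define u where "u = op_apply (op_adj A) x"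
  have fin: "l2_inner x (op_apply A (restr G y)) = (\<Sum>j\<in>G. cnj (u j) * y j)" if G: "finite G" for G
  proof -
    have c: "l2 (\<lambda>i. cnj (A i j))" for j
      using op_bound_row[OF op_bound_adj[OF A], of j] by (simp add: op_adj_def)
    have "op_apply A (restr G y) = (\<lambda>i. \<Sum>j\<in>G. y j * A i j)"
      unfolding op_apply_def
      by (intro ext infsumI has_sum_finite_neutralI[OF G]) (auto simp: restr_def mult.commute)
    then have "l2_inner x (op_apply A (restr G y)) = (\<Sum>j\<in>G. y j * l2_inner x (\<lambda>i. A i j))"
      using c x by (simp add: l2_inner_sum_right l2_scale l2_inner_scale_right)
    moreover have "cnj (u j) = l2_inner x (\<lambda>i. A i j)" for j
      unfolding u_def op_apply_def l2_inner_def op_adj_def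
      by (simp add: mult.commute flip: infsum_cnj)
    ultimately show ?thesis
      by (simp add: mult.commute)
  qed
  have "l2 u"
    unfolding u_def by (intro l2_op_apply[OF op_bound_adj[OF A]] x)
  then have "(\<lambda>j. cnj (u j) * y j) summable_on UNIV"
    by (intro summable_l2_mult y) simp
  then have lim1: "((\<lambda>G. \<Sum>j\<in>G. cnj (u j) * y j) \<longlongrightarrow> l2_inner u y) (finite_subsets_at_top UNIV)"
    unfolding l2_inner_def by (rule infsum_tendsto)
  have "((\<lambda>G. l2_inner x (op_apply A y) - (\<Sum>j\<in>G. cnj (u j) * y j)) \<longlongrightarrow> 0)
      (finite_subsets_at_top UNIV)"
  proof (rule Lim_null_comparison)
    have "((\<lambda>G. l2_norm x * C * l2_norm (\<lambda>i. y i - restr G y i)) \<longlongrightarrow> l2_norm x * C * 0)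
        (finite_subsets_at_top UNIV)"
      by (intro tendsto_intros tendsto_restr y)
    then show "((\<lambda>G. l2_norm x * C * l2_norm (\<lambda>i. y i - restr G y i)) \<longlongrightarrow> 0)
        (finite_subsets_at_top UNIV)"
      by simp
    have "norm (l2_inner x (op_apply A y) - (\<Sum>j\<in>G. cnj (u j) * y j)) \<le>
        l2_norm x * C * l2_norm (\<lambda>i. y i - restr G y i)" if G: "finite G" for G
    proof -
      have d: "l2 (\<lambda>i. y i - restr G y i)"
        by (intro l2_diff y l2_restr G)
      have "l2_inner x (op_apply A y) - (\<Sum>j\<in>G. cnj (u j) * y j) =
          l2_inner x (op_apply A (\<lambda>i. y i - restr G y i))"
        using A x y G by (simp add: op_apply_diff l2_restr l2_inner_diff_right l2_op_apply flip: fin)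
      also have "cmod \<dots> \<le> l2_norm x * l2_norm (op_apply A (\<lambda>i. y i - restr G y i))"
        by (intro cmod_l2_inner_le x l2_op_apply[OF A] d)
      also have "\<dots> \<le> l2_norm x * (C * l2_norm (\<lambda>i. y i - restr G y i))"
        by (intro mult_left_mono l2_norm_op_apply[OF A] d) simp
      finally show ?thesis
        by (simp add: mult.assoc)
    qed
    then show "\<forall>\<^sub>F G in finite_subsets_at_top UNIV.
        norm (l2_inner x (op_apply A y) - (\<Sum>j\<in>G. cnj (u j) * y j)) \<le>
        l2_norm x * C * l2_norm (\<lambda>i. y i - restr G y i)"
      by (intro eventually_finite_subsets_at_top_weakI)
  qed
  then have "((\<lambda>G. l2_inner x (op_apply A y) - (l2_inner x (op_apply A y) - (\<Sum>j\<in>G. cnj (u j) * y j)))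
      \<longlongrightarrow> l2_inner x (op_apply A y) - 0) (finite_subsets_at_top UNIV)"
    by (intro tendsto_intros)
  then have "((\<lambda>G. \<Sum>j\<in>G. cnj (u j) * y j) \<longlongrightarrow> l2_inner x (op_apply A y)) (finite_subsets_at_top UNIV)"
    by simp
  from tendsto_unique[OF finite_subsets_at_top_neq_bot lim1 this] show ?thesis
    by (simp add: u_def)
qed

text \<open>Again an exchange of sums without absolute convergence: with a the conjugate of row i of
  A, it is the adjoint relation for B applied to a and x.\<close>

lemma op_apply_mult:
  assumes A: "op_bound A C" and B: "op_bound B D" and x: "l2 x"
  shows "op_apply (op_mult A B) x = op_apply A (op_apply B x)"
proof
  fix i
  define a where "a = (\<lambda>j. cnj (A i j))"
  have "l2 a"
    using op_bound_row[OF A] by (simp add: a_def)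
  have "op_apply (op_mult A B) x i = l2_inner (op_apply (op_adj B) a) x"
    unfolding op_apply_def op_mult_def l2_inner_def a_def op_adj_def
    by (simp add: mult.commute flip: infsum_cnj)
  also have "\<dots> = l2_inner a (op_apply B x)"
    by (rule op_inner_adjoint[OF B \<open>l2 a\<close> x])
  also have "\<dots> = op_apply A (op_apply B x) i"
    by (simp add: l2_inner_def op_apply_def a_def)
  finally show "op_apply (op_mult A B) x i = op_apply A (op_apply B x) i" .
qed

lemma op_bound_mult:
  assumes A: "op_bound A C" and B: "op_bound B D"
  shows "op_bound (op_mult A B) (C * D)"
proof (rule op_boundI)
  show "0 \<le> C * D"
    using A B by (simp add: op_bound_nonneg)
  fix y :: "'a \<Rightarrow> complex" assume y: "l2 y"
  note By = l2_op_apply[OF B y]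
  show "l2 (op_apply (op_mult A B) y)"
    unfolding op_apply_mult[OF A B y] by (intro l2_op_apply[OF A] By)
  have "l2_norm (op_apply A (op_apply B y)) \<le> C * l2_norm (op_apply B y)"
    by (intro l2_norm_op_apply[OF A] By)
  also have "\<dots> \<le> C * (D * l2_norm y)"
    by (intro mult_left_mono l2_norm_op_apply[OF B] y op_bound_nonneg[OF A])
  finally show "l2_norm (op_apply (op_mult A B) y) \<le> C * D * l2_norm y"
    by (simp add: op_apply_mult[OF A B y] mult.assoc)
qed

lemma op_mult_summable:
  assumes "op_bound A C" "op_bound B D"
  shows "(\<lambda>j. A i j * B j k) summable_on UNIV"
proof -
  have "l2 (\<lambda>j. B j k)"
    using op_bound_row[OF op_bound_adj[OF assms(2)], of k] by (simp add: op_adj_def)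
  then show ?thesis
    by (rule op_apply_summable[OF assms(1)])
qed

lemma infsum_diff:
  fixes f g :: "'a \<Rightarrow> 'b::real_normed_vector"
  assumes "f summable_on A" "g summable_on A"
  shows "(\<Sum>\<^sub>\<infinity>x\<in>A. f x - g x) = infsum f A - infsum g A"
  using infsum_add[OF assms(1), of "\<lambda>x. - g x"] assms by (simp add: summable_on_uminus infsum_uminus)

lemma op_mult_diff_left:
  assumes "op_bound A C" "op_bound B D" "op_bound E c"
  shows "op_mult (\<lambda>i j. A i j - B i j) E = (\<lambda>i j. op_mult A E i j - op_mult B E i j)"
  unfolding op_mult_def left_diff_distrib
  by (intro ext infsum_diff op_mult_summable[OF assms(1,3)] op_mult_summable[OF assms(2,3)])

lemma op_mult_diff_right:
  assumes "op_bound A C" "op_bound B D" "op_bound E c"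
  shows "op_mult E (\<lambda>i j. A i j - B i j) = (\<lambda>i j. op_mult E A i j - op_mult E B i j)"
  unfolding op_mult_def right_diff_distrib
  by (intro ext infsum_diff op_mult_summable[OF assms(3,1)] op_mult_summable[OF assms(3,2)])

lemma op_mult_add_left:
  assumes "op_bound A C" "op_bound B D" "op_bound E c"
  shows "op_mult (\<lambda>i j. A i j + B i j) E = (\<lambda>i j. op_mult A E i j + op_mult B E i j)"
  unfolding op_mult_def distrib_right
  by (intro ext infsum_add op_mult_summable[OF assms(1,3)] op_mult_summable[OF assms(2,3)])

lemma op_mult_scale:
  "op_mult (\<lambda>i j. c * A i j) B = (\<lambda>i j. c * op_mult A B i j)"
  "op_mult A (\<lambda>i j. c * B i j) = (\<lambda>i j. c * op_mult A B i j)"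
  by (simp_all add: op_mult_def mult.assoc mult.left_commute infsum_cmult_right')

lemma op_mult_one: "op_mult op_one A = A" "op_mult A op_one = A"
proof -
  have "op_mult op_one A i k = op_apply op_one (\<lambda>j. A j k) i" for i k
    by (simp only: op_mult_def op_apply_def)
  then show "op_mult op_one A = A"
    by (intro ext) simp
  have "op_mult A op_one i k = op_apply op_one (\<lambda>j. A i j) k" for i k
    by (simp add: op_mult_def op_apply_def op_one_def eq_commute mult.commute)
  then show "op_mult A op_one = A"
    by (intro ext) simp
qed

lemma op_adj_mult: "op_adj (op_mult A B) = op_mult (op_adj B) (op_adj A)"
  by (simp add: op_adj_def op_mult_def mult.commute flip: infsum_cnj)

subsection \<open>Fixed points of maps on bounded operators\<close>

lemma tendsto_op_form:
  assumes "\<And>i j. (\<lambda>n. Y n i j) \<longlonglongrightarrow> Z i j"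
  shows "(\<lambda>n. op_form (Y n) F x y) \<longlonglongrightarrow> op_form Z F x y"
  unfolding op_form_def by (intro tendsto_intros assms)

text \<open>Entrywise convergence suffices, because each inequality behind \<open>op_bound\<close>
  involves finitely many entries.\<close>

lemma op_bound_limit:
  assumes lim: "\<And>i j. (\<lambda>n. Y n i j) \<longlonglongrightarrow> Z i j" and c: "c \<longlonglongrightarrow> C"
    and bound: "\<And>n. op_bound (Y n) (c n)"
  shows "op_bound Z C"
  unfolding op_bound_def
proof safe
  show "0 \<le> C"
    using c by (rule LIMSEQ_le_const) (use bound op_bound_nonneg in blast)
  fix F x y assume F: "finite (F :: 'a set)"
  have "(\<lambda>n. cmod (op_form (Y n) F x y)) \<longlonglongrightarrow> cmod (op_form Z F x y)"
    by (intro tendsto_norm tendsto_op_form lim)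
  moreover have "(\<lambda>n. c n * fin_norm x F * fin_norm y F) \<longlonglongrightarrow> C * fin_norm x F * fin_norm y F"
    by (intro tendsto_intros c)
  ultimately show "cmod (op_form Z F x y) \<le> C * fin_norm x F * fin_norm y F"
    by (rule LIMSEQ_le) (use op_boundD[OF bound F] in blast)
qed

text \<open>Kantorovich's majorant principle: the scalar iteration dominates the operator iteration.\<close>

lemma op_majorant_fixpoint:
  fixes \<Phi> :: "'a op \<Rightarrow> 'a op" and \<phi> :: "real \<Rightarrow> real"
  assumes start: "op_bound (\<Phi> (\<lambda>_ _. 0)) (\<phi> 0)"
    and step: "\<And>P Q s t. op_bound P s \<Longrightarrow> op_bound Q t \<Longrightarrow> op_bound (\<lambda>i j. Q i j - P i j) (t - s) \<Longrightarrow>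
        op_bound (\<lambda>i j. \<Phi> Q i j - \<Phi> P i j) (\<phi> t - \<phi> s)"
    and cont: "\<And>x. isCont \<phi> x"
    and mono: "\<And>s t. 0 \<le> s \<Longrightarrow> s \<le> t \<Longrightarrow> \<phi> s \<le> \<phi> t" and K: "0 \<le> K" "\<phi> K \<le> K"
  obtains Z where "\<Phi> Z = Z" "op_bound Z K" "\<And>i j. (\<lambda>n. (\<Phi> ^^ n) (\<lambda>_ _. 0) i j) \<longlonglongrightarrow> Z i j"
proof -
  define Y where "Y n = (\<Phi> ^^ n) (\<lambda>_ _. 0)" for n
  define s where "s n = (\<phi> ^^ n) 0" for n
  have Y_Suc: "Y (Suc n) = \<Phi> (Y n)" and s_Suc: "s (Suc n) = \<phi> (s n)" for n
    by (simp_all add: Y_def s_def)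
  have bound: "op_bound (Y n) (s n) \<and> op_bound (\<lambda>i j. Y (Suc n) i j - Y n i j) (s (Suc n) - s n)" for n
  proof (induction n)
    case 0
    then show ?case
      using start by (simp add: Y_def s_def op_bound_zero)
  next
    case (Suc n)
    then have "op_bound (\<lambda>i j. Y n i j + (Y (Suc n) i j - Y n i j)) (s n + (s (Suc n) - s n))"
      by (intro op_bound_add) auto
    then have "op_bound (Y (Suc n)) (s (Suc n))"
      by simp
    then show ?case
      using step[of "Y n" "s n" "Y (Suc n)" "s (Suc n)"] Suc by (simp add: Y_Suc s_Suc)
  qed
  have s_nonneg: "0 \<le> s n" and s_le: "s n \<le> s (Suc n)" for n
    using bound[of n] op_bound_nonneg by fastforce+
  have s_K: "s n \<le> K" for n
  proof (induction n)
    case 0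
    then show ?case
      using K by (simp add: s_def)
  next
    case (Suc n)
    then show ?case
      using mono[OF s_nonneg Suc] K by (simp add: s_Suc)
  qed
  obtain L where L: "s \<longlonglongrightarrow> L"
    using incseq_convergent[of s K] s_le s_K incseq_SucI by metis
  have L_fix: "\<phi> L = L"
  proof -
    have "(\<lambda>n. \<phi> (s n)) \<longlonglongrightarrow> \<phi> L"
      by (rule isCont_tendsto_compose[OF cont L])
    moreover have "(\<lambda>n. \<phi> (s n)) \<longlonglongrightarrow> L"
      using LIMSEQ_Suc[OF L] by (simp add: s_Suc)
    ultimately show ?thesis
      by (rule LIMSEQ_unique)
  qed
  \<comment> \<open>Telescoping turns the one-step bounds into a Cauchy estimate for the operators,
    governed by the convergent scalar sequence.\<close>
  have diff: "op_bound (\<lambda>i j. Y (n + k) i j - Y n i j) (s (n + k) - s n)" for n k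
  proof (induction k)
    case 0
    then show ?case
      by (simp add: op_bound_zero)
  next
    case (Suc k)
    have "op_bound (\<lambda>i j. (Y (Suc (n + k)) i j - Y (n + k) i j) + (Y (n + k) i j - Y n i j))
        ((s (Suc (n + k)) - s (n + k)) + (s (n + k) - s n))"
      using bound Suc by (intro op_bound_add) auto
    then show ?case
      by simp
  qed
  have "Cauchy (\<lambda>n. Y n i j)" for i j
  proof (rule metric_CauchyI)
    fix e :: real assume "0 < e"
    then obtain M where M: "\<And>m n. M \<le> m \<Longrightarrow> M \<le> n \<Longrightarrow> dist (s m) (s n) < e"
      using LIMSEQ_imp_Cauchy[OF L] unfolding Cauchy_def by blast
    have le: "dist (Y (n + k) i j) (Y n i j) < e" if "M \<le> n" for n k
      using op_bound_entry[OF diff, of n k i j] M[of "n + k" n] that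
      by (simp add: dist_norm)
    show "\<exists>M. \<forall>m\<ge>M. \<forall>n\<ge>M. dist (Y m i j) (Y n i j) < e"
      using le by (metis dist_commute le_add_diff_inverse nle_le)
  qed
  then have "\<exists>z. (\<lambda>n. Y n i j) \<longlonglongrightarrow> z" for i j
    by (simp add: Cauchy_convergent_iff convergent_def)
  then obtain Z where Z: "\<And>i j. (\<lambda>n. Y n i j) \<longlonglongrightarrow> Z i j"
    by metis
  have ZY: "op_bound (\<lambda>i j. Z i j - Y n i j) (L - s n)" for n
  proof (rule op_bound_limit)
    show "(\<lambda>k. Y (n + k) i j - Y n i j) \<longlonglongrightarrow> Z i j - Y n i j" for i j
      using LIMSEQ_ignore_initial_segment[OF Z, of n i j]
      by (intro tendsto_intros) (simp add: add.commute)
    show "(\<lambda>k. s (n + k) - s n) \<longlonglongrightarrow> L - s n"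
      using LIMSEQ_ignore_initial_segment[OF L, of n]
      by (intro tendsto_intros) (simp add: add.commute)
  qed (rule diff)
  have "op_bound Z L"
    using ZY[of 0] by (simp add: Y_def s_def)
  \<comment> \<open>Both \<open>Z\<close> and \<open>\<Phi> Z\<close> lie within
    \<open>L - s (Suc n)\<close> of \<open>Y (Suc n)\<close>; for \<open>\<Phi> Z\<close> this is
    \<open>step\<close> together with \<open>\<phi> L = L\<close>.\<close>
  have "op_bound (\<lambda>i j. \<Phi> Z i j - Z i j) (2 * (L - s (Suc n)))" for n
  proof -
    have "op_bound (\<lambda>i j. \<Phi> Z i j - Y (Suc n) i j) (L - s (Suc n))"
      using step[OF _ \<open>op_bound Z L\<close> ZY, of n] bound[of n] by (simp add: Y_Suc s_Suc L_fix)
    from op_bound_diff[OF this ZY[of "Suc n"]] show ?thesis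
      by simp
  qed
  note bound_fix = this
  have "(\<lambda>n. 2 * (L - s (Suc n))) \<longlonglongrightarrow> 2 * (L - L)"
    by (intro tendsto_intros LIMSEQ_Suc[OF L])
  then have "op_bound (\<lambda>i j. \<Phi> Z i j - Z i j) (2 * (L - L))"
    by (rule op_bound_limit[OF tendsto_const _ bound_fix])
  then have "\<Phi> Z i j = Z i j" for i j
    using op_bound_entry[of "\<lambda>i j. \<Phi> Z i j - Z i j" _ i j] by fastforce
  then have "\<Phi> Z = Z"
    by blast
  moreover have "op_bound Z K"
    using \<open>op_bound Z L\<close> by (rule op_bound_mono) (use LIMSEQ_le_const2[OF L] s_K in blast)
  ultimately show ?thesis
    using that Z by (simp add: Y_def)
qed

subsection \<open>Positive operators and their square roots\<close>

lemma op_hermitianD: "op_hermitian A \<Longrightarrow> cnj (A j i) = A i j"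
  unfolding op_hermitian_def op_adj_def by metis

text \<open>Reality of the quadratic form on e_i and e_j makes the diagonal real; on e_i + e_j it
  relates the imaginary parts of the two off-diagonal entries, and on e_i + \<i> e_j their real
  parts.\<close>

lemma positive_op_hermitian:
  assumes "positive_op A"
  shows "op_hermitian A"
proof -
  have real: "Im (op_form A F x x) = 0" if "finite F" for F x
    using assms that by (simp add: positive_op_def complex_is_Real_iff)
  have "A i j = cnj (A j i)" for i j
  proof (cases "i = j")
    case True
    then show ?thesis
      using real[of "{i}" "\<lambda>_. 1"] by (simp add: op_form_def complex_eq_iff)
  next
    case False
    then show ?thesis
      using real[of "{i}" "\<lambda>_. 1"] real[of "{j}" "\<lambda>_. 1"] real[of "{i, j}" "\<lambda>_. 1"]
        real[of "{i, j}" "\<lambda>k. if k = i then 1 else \<i>"]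
      by (simp add: op_form_def complex_eq_iff)
  qed
  then show ?thesis
    unfolding op_hermitian_def op_adj_def by (intro ext) metis
qed

lemma op_form_hermitian:
  assumes "op_hermitian A"
  shows "cnj (op_form A F x y) = op_form A F y x"
  using op_form_adj[of A F y x] assms by (simp add: op_hermitian_def)

lemma op_form_one: "finite F \<Longrightarrow> op_form op_one F x y = (\<Sum>i\<in>F. cnj (x i) * y i)"
proof -
  assume F: "finite F"
  have "(\<Sum>j\<in>F. cnj (x i) * op_one i j * y j) = cnj (x i) * y i" if "i \<in> F" for i
    using F that by (subst sum.remove[of F i]) (auto simp: op_one_def intro!: sum.neutral split: if_splits)
  then show ?thesis
    by (simp add: op_form_def)
qed

lemma op_form_one_self: "finite F \<Longrightarrow> op_form op_one F x x = of_real ((fin_norm x F)\<^sup>2)"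
  by (simp add: op_form_one L2_set_def sum_nonneg cnj_mult_self)

lemma op_form_add_vec:
  "op_form A F (\<lambda>i. x i + y i) z = op_form A F x z + op_form A F y z"
  "op_form A F z (\<lambda>i. x i + y i) = op_form A F z x + op_form A F z y"
  by (simp_all add: op_form_def algebra_simps sum.distrib)

lemma op_form_scale_vec:
  "op_form A F (\<lambda>i. c * x i) z = cnj c * op_form A F x z"
  "op_form A F z (\<lambda>i. c * x i) = c * op_form A F z x"
  by (simp_all add: op_form_def sum_distrib_left mult_ac)

text \<open>For a hermitian matrix the quadratic form q controls the norm: 4 Re (x, A y) = q(x + y)
  - q(x - y), and the parallelogram law bounds the right side by 2 C (norm(x)^2 + norm(y)^2).
  Rescaling improves the sum of squares to a product, and a phase on y replaces the real part by the
  modulus.\<close>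

lemma op_bound_hermitian:
  assumes herm: "op_hermitian A" and C: "0 \<le> C"
    and form: "\<And>F x. finite F \<Longrightarrow> \<bar>Re (op_form A F x x)\<bar> \<le> C * (fin_norm x F)\<^sup>2"
  shows "op_bound A C"
proof -
  have polar: "4 * Re (op_form A F x y) \<le> 2 * C * ((fin_norm x F)\<^sup>2 + (fin_norm y F)\<^sup>2)"
    if F: "finite F" for F x y
  proof -
    define y' where "y' = (\<lambda>i. (-1) * y i)"
    have par: "(fin_norm (\<lambda>i. x i + y i) F)\<^sup>2 + (fin_norm (\<lambda>i. x i + y' i) F)\<^sup>2 =
        2 * ((fin_norm x F)\<^sup>2 + (fin_norm y F)\<^sup>2)"
    proof -
      have "(cmod (x i + y i))\<^sup>2 + (cmod (x i + y' i))\<^sup>2 = 2 * ((cmod (x i))\<^sup>2 + (cmod (y i))\<^sup>2)" for i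
        unfolding cmod_power2 y'_def by (simp add: power2_eq_square algebra_simps)
      then show ?thesis
        by (simp add: L2_set_def sum_nonneg sum_distrib_left flip: sum.distrib)
    qed
    have "Re (op_form A F y x) = Re (op_form A F x y)"
      using arg_cong[OF op_form_hermitian[OF herm, of F x y], of Re] by simp
    then have "4 * Re (op_form A F x y) =
        Re (op_form A F (\<lambda>i. x i + y i) (\<lambda>i. x i + y i)) - Re (op_form A F (\<lambda>i. x i + y' i) (\<lambda>i. x i + y' i))"
      unfolding y'_def op_form_add_vec op_form_scale_vec by simp
    also have "\<dots> \<le> C * (fin_norm (\<lambda>i. x i + y i) F)\<^sup>2 + C * (fin_norm (\<lambda>i. x i + y' i) F)\<^sup>2"
      using form[OF F, of "\<lambda>i. x i + y i"] form[OF F, of "\<lambda>i. x i + y' i"] by linarith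
    finally show ?thesis
      using arg_cong[OF par, of "(*) C"] by (simp add: algebra_simps)
  qed
  have re: "Re (op_form A F x y) \<le> C * fin_norm x F * fin_norm y F" if F: "finite F" for F x y
  proof (cases "fin_norm x F = 0 \<or> fin_norm y F = 0")
    case True
    then have "op_form A F x y = 0"
      using F by (auto simp: L2_set_eq_0_iff op_form_def)
    then show ?thesis
      using C by simp
  next
    case False
    define a b where "a = fin_norm x F" and "b = fin_norm y F"
    have ab: "0 < a" "0 < b"
      using False by (auto simp: a_def b_def less_le)
    have sc: "fin_norm (\<lambda>i. of_real c * z i) F = c * fin_norm z F" if "0 \<le> c" for c z
      using that by (simp add: norm_mult L2_set_right_distrib)
    \<comment> \<open>Each vector is scaled by the norm of the other; both then have norm a b, where
      the arithmetic mean in \<open>polar\<close> equals the geometric mean.\<close>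
    have "4 * (b * a * Re (op_form A F x y)) \<le> 2 * C * ((b * a)\<^sup>2 + (a * b)\<^sup>2)"
      using polar[OF F, of "\<lambda>i. of_real b * x i" "\<lambda>i. of_real a * y i"] ab
      unfolding op_form_scale_vec by (simp add: sc a_def b_def mult.assoc)
    then have "(a * b) * Re (op_form A F x y) \<le> (a * b) * (C * a * b)"
      by (simp add: power2_eq_square algebra_simps)
    then show ?thesis
      using ab by (simp add: mult_le_cancel_left_pos flip: a_def b_def)
  qed
  have "cmod (op_form A F x y) \<le> C * fin_norm x F * fin_norm y F" if F: "finite F" for F x y
  proof -
    define z where "z = op_form A F x y"
    obtain u where u: "cmod u = 1" "u * z = of_real (cmod z)"
    proof (cases "z = 0")
      case False
      show ?thesis
        by (rule that[of "cnj z / cmod z"])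
          (use False in \<open>simp_all add: norm_divide cnj_mult_self power2_eq_square\<close>)
    qed (auto intro: that[of 1])
    have "cmod z = Re (op_form A F x (\<lambda>i. u * y i))"
      unfolding op_form_scale_vec by (simp add: u flip: z_def)
    also have "\<dots> \<le> C * fin_norm x F * fin_norm y F"
      using re[OF F, of x "\<lambda>i. u * y i"] by (simp add: norm_mult u)
    finally show ?thesis
      by (simp add: z_def)
  qed
  with C show ?thesis
    by (simp add: op_bound_def)
qed

text \<open>From 0 <= A <= C follows 0 <= C - A <= C. The triangle inequality would give 2 C only;
  the sharp constant is what lets the iterations for the square root and for the resolvent stay
  bounded.\<close>

lemma op_bound_one_diff_positive:
  assumes "positive_op A" "op_bound A C"
  shows "op_bound (\<lambda>i j. of_real C * op_one i j - A i j) C"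
proof (rule op_bound_hermitian)
  show "op_hermitian (\<lambda>i j. of_real C * op_one i j - A i j)"
    using op_hermitianD[OF positive_op_hermitian[OF assms(1)]]
    by (auto simp: op_hermitian_def op_adj_def op_one_def fun_eq_iff)
  show "0 \<le> C"
    by (rule op_bound_nonneg[OF assms(2)])
  fix F x assume F: "finite (F :: 'a set)"
  define r where "r = Re (op_form A F x x)"
  have "0 \<le> r"
    using assms(1) F by (simp add: positive_op_def r_def)
  moreover have "r \<le> C * (fin_norm x F)\<^sup>2"
    using op_boundD[OF assms(2) F, of x x] complex_Re_le_cmod[of "op_form A F x x"]
    by (simp add: r_def power2_eq_square mult.assoc)
  moreover have "Re (op_form (\<lambda>i j. of_real C * op_one i j - A i j) F x x) = C * (fin_norm x F)\<^sup>2 - r"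
    unfolding op_form_diff op_form_scale op_form_one_self[OF F] r_def by simp
  ultimately show "\<bar>Re (op_form (\<lambda>i j. of_real C * op_one i j - A i j) F x x)\<bar> \<le> C * (fin_norm x F)\<^sup>2"
    by simp
qed

lemma op_hermitian_limit:
  assumes "\<And>i j. (\<lambda>n. Y n i j) \<longlonglongrightarrow> Z i j" "\<And>n. op_hermitian (Y n)"
  shows "op_hermitian Z"
proof -
  have "cnj (Z j i) = Z i j" for i j
  proof -
    have "(\<lambda>n. cnj (Y n j i)) \<longlonglongrightarrow> cnj (Z j i)"
      by (intro tendsto_intros assms)
    moreover have "(\<lambda>n. cnj (Y n j i)) = (\<lambda>n. Y n i j)"
      by (simp add: op_hermitianD[OF assms(2)])
    ultimately show ?thesis
      using assms(1)[of i j] LIMSEQ_unique by metis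
  qed
  then show ?thesis
    by (simp add: op_hermitian_def op_adj_def fun_eq_iff)
qed

lemma positive_op_one_diff:
  assumes "op_hermitian Z" "op_bound Z 1"
  shows "positive_op (\<lambda>i j. op_one i j - Z i j)"
  unfolding positive_op_def
proof safe
  show "bounded_op (\<lambda>i j. op_one i j - Z i j)"
    using op_bound_diff[OF op_bound_one assms(2)] bounded_op_iff by blast
  fix F x assume F: "finite (F :: 'a set)"
  have "cnj (op_form Z F x x) = op_form Z F x x"
    by (rule op_form_hermitian[OF assms(1)])
  then show "op_form (\<lambda>i j. op_one i j - Z i j) F x x \<in> \<real>"
    unfolding op_form_diff op_form_one_self[OF F] by (intro Reals_diff) (simp_all add: Reals_cnj_iff)
  show "0 \<le> Re (op_form (\<lambda>i j. op_one i j - Z i j) F x x)"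
    using op_boundD[OF assms(2) F, of x x] complex_Re_le_cmod[of "op_form Z F x x"]
    unfolding op_form_diff op_form_one_self[OF F] by (simp add: power2_eq_square)
qed

text \<open>The iteration \<open>Z \<mapsto> (A + Z\<^sup>2) / 2\<close> solves \<open>(1 - Z)\<^sup>2 = 1 - A\<close>.\<close>

lemma sqrt_one_minus_exists:
  assumes herm: "op_hermitian A" and A: "op_bound A 1"
  obtains B where "positive_op B" "op_mult B B = (\<lambda>i j. op_one i j - A i j)"
proof -
  define \<Phi> where "\<Phi> P = (\<lambda>i j. (1/2) * (A i j + op_mult P P i j))" for P :: "'a op"
  have step: "op_bound (\<lambda>i j. \<Phi> Q i j - \<Phi> P i j) ((1 + t\<^sup>2) / 2 - (1 + s\<^sup>2) / 2)"
    if P: "op_bound P s" and Q: "op_bound Q t" and QP: "op_bound (\<lambda>i j. Q i j - P i j) (t - s)" for P Q s t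
  proof -
    \<comment> \<open>Q^2 - P^2 = Q (Q - P) + (Q - P) P holds without commutation, and its norm
      bound t (t - s) + (t - s) s is exactly t^2 - s^2.\<close>
    have "op_bound (\<lambda>i j. (1/2) * (op_mult Q (\<lambda>i j. Q i j - P i j) i j + op_mult (\<lambda>i j. Q i j - P i j) P i j))
        (cmod (1/2) * (t * (t - s) + (t - s) * s))"
      by (intro op_bound_scale op_bound_add op_bound_mult P Q QP)
    moreover have "(\<lambda>i j. (1/2) * (op_mult Q (\<lambda>i j. Q i j - P i j) i j + op_mult (\<lambda>i j. Q i j - P i j) P i j)) =
        (\<lambda>i j. \<Phi> Q i j - \<Phi> P i j)"
      unfolding \<Phi>_def op_mult_diff_left[OF Q P P] op_mult_diff_right[OF Q P Q] by (simp add: algebra_simps)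
    moreover have "cmod (1/2) * (t * (t - s) + (t - s) * s) = (1 + t\<^sup>2) / 2 - (1 + s\<^sup>2) / 2"
      by (simp add: norm_divide power2_eq_square field_simps)
    ultimately show ?thesis
      by (simp only:)
  qed
  have start: "op_bound (\<Phi> (\<lambda>_ _. 0)) ((1 + 0\<^sup>2) / 2)"
    using op_bound_scale[OF A, of "1/2"] by (simp add: \<Phi>_def op_mult_def)
  \<comment> \<open>The scalar map touches the diagonal at s = 1 with slope 1, so it is no strict
    contraction on the interval from 0 to 1. Its increasing orbit from 0 still stays below the fixed
    point 1, which is what the majorant principle asks for.\<close>
  obtain Z where Z: "\<Phi> Z = Z" "op_bound Z 1" "\<And>i j. (\<lambda>n. (\<Phi> ^^ n) (\<lambda>_ _. 0) i j) \<longlonglongrightarrow> Z i j"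
  proof (rule op_majorant_fixpoint[where \<Phi> = \<Phi> and \<phi> = "\<lambda>s. (1 + s\<^sup>2) / 2" and K = 1])
    show "isCont (\<lambda>s. (1 + s\<^sup>2) / 2) x" for x :: real
      by (intro continuous_intros) simp
    show "(1 + s\<^sup>2) / 2 \<le> (1 + t\<^sup>2) / 2" if "0 \<le> s" "s \<le> t" for s t :: real
      using power_mono[OF that(2,1), of 2] by simp
  qed (use start step in auto)
  have herm_iter: "op_hermitian ((\<Phi> ^^ n) (\<lambda>_ _. 0))" for n
  proof (induction n)
    case (Suc n)
    define P where "P = (\<Phi> ^^ n) (\<lambda>_ _. 0)"
    have "op_adj P = P"
      using Suc by (simp add: op_hermitian_def P_def)
    then have "op_hermitian (op_mult P P)"
      by (simp add: op_hermitian_def op_adj_mult)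
    then have "cnj (op_mult P P j i) = op_mult P P i j" for i j
      by (rule op_hermitianD)
    moreover have "(\<Phi> ^^ Suc n) (\<lambda>_ _. 0) = (\<lambda>i j. (1/2) * (A i j + op_mult P P i j))"
      by (simp add: \<Phi>_def P_def)
    ultimately show ?case
      unfolding op_hermitian_def op_adj_def by (simp add: op_hermitianD[OF herm])
  qed (simp add: op_hermitian_def op_adj_def)
  have "op_hermitian Z"
    by (rule op_hermitian_limit[OF Z(3) herm_iter])
  have "op_mult (\<lambda>i j. op_one i j - Z i j) (\<lambda>i j. op_one i j - Z i j) = (\<lambda>i j. op_one i j - A i j)"
  proof -
    have "A i j + op_mult Z Z i j = 2 * Z i j" for i j
      using fun_cong[OF fun_cong[OF Z(1)], of i j] by (simp add: \<Phi>_def field_simps)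
    then have "op_mult Z Z i j = 2 * Z i j - A i j" for i j
      by (metis add_diff_cancel_left')
    then show ?thesis
      unfolding op_mult_diff_left[OF op_bound_one Z(2) op_bound_diff[OF op_bound_one Z(2)]]
        op_mult_diff_right[OF op_bound_one Z(2) op_bound_one]
        op_mult_diff_right[OF op_bound_one Z(2) Z(2)] op_mult_one
      by (simp add: fun_eq_iff)
  qed
  then show ?thesis
    using that[OF positive_op_one_diff[OF \<open>op_hermitian Z\<close> Z(2)]] by blast
qed

lemma positive_op_scale:
  assumes "positive_op A" "0 \<le> c"
  shows "positive_op (\<lambda>i j. of_real c * A i j)"
  using assms op_bound_scale[of A _ "of_real c"] unfolding positive_op_def op_form_scale bounded_op_iff
  by (auto intro!: Reals_mult)

lemma positive_op_sqrt_exists: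
  assumes "positive_op T"
  obtains B where "positive_op B" "op_mult B B = T"
proof -
  obtain C where "op_bound T C"
    using assms positive_op_def bounded_op_iff by blast
  \<comment> \<open>A positive constant c even if T = 0, so that dividing by it can be undone; 1 - T
    / c has norm at most 1.\<close>
  then have T: "op_bound T (max C 1)"
    by (rule op_bound_mono) simp
  define c where "c = max C 1"
  have c: "0 < c" "op_bound T c"
    using T by (auto simp: c_def)
  define A where "A = (\<lambda>i j. op_one i j - of_real (1 / c) * T i j)"
  have "op_bound (\<lambda>i j. of_real (1 / c) * (of_real c * op_one i j - T i j)) (cmod (of_real (1 / c)) * c)"
    by (intro op_bound_scale op_bound_one_diff_positive assms c)
  moreover have "cmod (of_real (1 / c)) * c = 1"
    using c(1) unfolding norm_of_real by simp
  ultimately have "op_bound (\<lambda>i j. of_real (1 / c) * (of_real c * op_one i j - T i j)) 1"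
    by (simp only:)
  then have "op_bound A 1"
    using c(1) by (simp add: A_def algebra_simps)
  moreover have "op_hermitian A"
    using op_hermitianD[OF positive_op_hermitian[OF assms]]
    by (auto simp: op_hermitian_def op_adj_def op_one_def fun_eq_iff A_def)
  ultimately obtain B where B: "positive_op B" "op_mult B B = (\<lambda>i j. op_one i j - A i j)"
    using sqrt_one_minus_exists by blast
  show ?thesis
  proof
    show "positive_op (\<lambda>i j. of_real (sqrt c) * B i j)"
      using B(1) c by (intro positive_op_scale) auto
    have "complex_of_real (sqrt c) * of_real (sqrt c) = of_real c"
      using c by (simp flip: of_real_mult)
    then have "of_real (sqrt c) * (of_real (sqrt c) * (op_one i j - A i j)) = of_real c * (op_one i j - A i j)"
      for i j by (simp only: flip: mult.assoc)
    then show "op_mult (\<lambda>i j. of_real (sqrt c) * B i j) (\<lambda>i j. of_real (sqrt c) * B i j) = T"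
      using c unfolding op_mult_scale B by (simp add: A_def)
  qed
qed

text \<open>(\<epsilon> + B) R = 1 is the fixed point equation R = (1 + (c - B) R) / (c +
  \<epsilon>). As 0 <= B <= c, the norm of c - B is at most c, so the scalar majorant is s -> (1 + c
  s) / (c + \<epsilon>), with fixed point 1 / \<epsilon>.\<close>

lemma positive_op_resolvent_exists:
  assumes "positive_op B" "0 < \<epsilon>"
  obtains R where "bounded_op R" "op_mult (\<lambda>i j. of_real \<epsilon> * op_one i j + B i j) R = op_one"
proof -
  obtain c where B: "op_bound B c"
    using assms positive_op_def bounded_op_iff by blast
  have c: "0 \<le> c"
    by (rule op_bound_nonneg[OF B])
  define D where "D = (\<lambda>i j. of_real c * op_one i j - B i j)"
  have D: "op_bound D c"
    unfolding D_def by (rule op_bound_one_diff_positive[OF assms(1) B])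
  define \<Phi> where "\<Phi> P = (\<lambda>i j. of_real (1 / (c + \<epsilon>)) * (op_one i j + op_mult D P i j))" for P :: "'a op"
  have norm: "cmod (of_real (1 / (c + \<epsilon>))) = 1 / (c + \<epsilon>)"
    using c assms(2) unfolding norm_of_real by simp
  have start: "op_bound (\<Phi> (\<lambda>_ _. 0)) ((1 + c * 0) / (c + \<epsilon>))"
    using op_bound_scale[OF op_bound_one, of "of_real (1 / (c + \<epsilon>))"] norm
    by (simp add: \<Phi>_def op_mult_def)
  have step: "op_bound (\<lambda>i j. \<Phi> Q i j - \<Phi> P i j) ((1 + c * t) / (c + \<epsilon>) - (1 + c * s) / (c + \<epsilon>))"
    if P: "op_bound P s" and Q: "op_bound Q t" and QP: "op_bound (\<lambda>i j. Q i j - P i j) (t - s)" for P Q s t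
  proof -
    have "op_bound (\<lambda>i j. of_real (1 / (c + \<epsilon>)) * op_mult D (\<lambda>i j. Q i j - P i j) i j)
        (cmod (of_real (1 / (c + \<epsilon>))) * (c * (t - s)))"
      by (intro op_bound_scale op_bound_mult D QP)
    moreover have "(\<lambda>i j. of_real (1 / (c + \<epsilon>)) * op_mult D (\<lambda>i j. Q i j - P i j) i j) =
        (\<lambda>i j. \<Phi> Q i j - \<Phi> P i j)"
      unfolding \<Phi>_def op_mult_diff_right[OF Q P D] by (simp add: algebra_simps)
    moreover have "1 / (c + \<epsilon>) * (c * (t - s)) = (1 + c * t) / (c + \<epsilon>) - (1 + c * s) / (c + \<epsilon>)"
      by (simp add: algebra_simps diff_divide_distrib add_divide_distrib)
    ultimately show ?thesis
      unfolding norm by (simp only:)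
  qed
  obtain R where R: "\<Phi> R = R" "op_bound R (1 / \<epsilon>)"
  proof (rule op_majorant_fixpoint[where \<Phi> = \<Phi> and \<phi> = "\<lambda>s. (1 + c * s) / (c + \<epsilon>)" and K = "1 / \<epsilon>"])
    show "isCont (\<lambda>s. (1 + c * s) / (c + \<epsilon>)) x" for x
      using c assms(2) by (intro continuous_intros) auto
    show "(1 + c * s) / (c + \<epsilon>) \<le> (1 + c * t) / (c + \<epsilon>)" if "0 \<le> s" "s \<le> t" for s t
      using that c assms(2) by (intro divide_right_mono) (auto intro: mult_left_mono)
    show "(1 + c * (1 / \<epsilon>)) / (c + \<epsilon>) \<le> 1 / \<epsilon>"
      using c assms(2) by (simp add: field_simps)
  qed (use start step assms(2) in auto)
  have eps: "op_bound (\<lambda>i j. of_real \<epsilon> * op_one i j) (cmod (of_real \<epsilon>) * 1)"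
    and cone: "op_bound (\<lambda>i j. of_real c * op_one i j) (cmod (of_real c) * 1)"
    by (intro op_bound_scale op_bound_one)+
  have "of_real (c + \<epsilon>) * R i j = op_one i j + op_mult D R i j" for i j
  proof -
    have "complex_of_real (c + \<epsilon>) \<noteq> 0"
      using c assms(2) by (simp del: of_real_add)
    moreover have "of_real (1 / (c + \<epsilon>)) * (op_one i j + op_mult D R i j) = R i j"
      using fun_cong[OF fun_cong[OF R(1)], of i j] by (simp only: \<Phi>_def)
    ultimately show ?thesis
      by (simp add: of_real_divide nonzero_divide_eq_eq mult.commute del: of_real_add)
  qed
  then have "op_one i j = of_real (c + \<epsilon>) * R i j - op_mult D R i j" for i j
    by simp
  then have "op_mult (\<lambda>i j. of_real \<epsilon> * op_one i j + B i j) R = op_one"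
    unfolding op_mult_add_left[OF eps B R(2)] D_def op_mult_diff_left[OF cone B R(2)]
      op_mult_scale op_mult_one by (simp add: fun_eq_iff algebra_simps)
  with R(2) show ?thesis
    using that bounded_op_iff by blast
qed

text \<open>Positivity is postulated on finitely supported vectors only. With a positive square root
  S of B the form becomes norm(S y)^2, which makes sense for every y in l2.\<close>

lemma positive_op_inner_nonneg:
  assumes "positive_op B" "l2 y"
  shows "0 \<le> Re (l2_inner y (op_apply B y))"
proof -
  obtain S where S: "positive_op S" "op_mult S S = B"
    using positive_op_sqrt_exists assms(1) by blast
  then obtain c where c: "op_bound S c"
    using positive_op_def bounded_op_iff by blast
  have "op_adj S = S"
    using positive_op_hermitian[OF S(1)] by (simp add: op_hermitian_def)
  then have "l2_inner y (op_apply B y) = l2_inner (op_apply S y) (op_apply S y)"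
    using op_inner_adjoint[OF c assms(2) l2_op_apply[OF c assms(2)]]
      op_apply_mult[OF c c assms(2)] S(2) by simp
  then show ?thesis
    by (simp add: l2_inner_self l2_op_apply[OF c assms(2)] flip: of_real_power)
qed

lemma positive_op_adj_mult:
  assumes X: "op_bound X C"
  shows "positive_op (op_mult (op_adj X) X)"
  unfolding positive_op_def
proof safe
  show "bounded_op (op_mult (op_adj X) X)"
    using op_bound_mult[OF op_bound_adj[OF X] X] bounded_op_iff by blast
  fix F x assume F: "finite (F :: 'a set)"
  have r: "l2 (restr F x)"
    by (rule l2_restr[OF F])
  have Xr: "l2 (op_apply X (restr F x))"
    by (rule l2_op_apply[OF X r])
  have "op_adj (op_adj X) = X"
    by (simp add: op_adj_def)
  then have "op_form (op_mult (op_adj X) X) F x x =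
      l2_inner (op_apply X (restr F x)) (op_apply X (restr F x))"
    using op_inner_adjoint[OF op_bound_adj[OF X] r Xr] op_apply_mult[OF op_bound_adj[OF X] X r]
    by (simp add: op_form_restr[OF F])
  then have "op_form (op_mult (op_adj X) X) F x x = of_real ((l2_norm (op_apply X (restr F x)))\<^sup>2)"
    using l2_inner_self[OF Xr] by simp
  then show "op_form (op_mult (op_adj X) X) F x x \<in> \<real>" "0 \<le> Re (op_form (op_mult (op_adj X) X) F x x)"
    by simp_all
qed

lemma op_sqrt_positive:
  assumes "positive_op T"
  shows "positive_op (op_sqrt T)" and "op_mult (op_sqrt T) (op_sqrt T) = T"
proof -
  have "\<exists>B. positive_op B \<and> op_mult B B = T"
    using positive_op_sqrt_exists[OF assms] by blast
  from someI_ex[OF this] show "positive_op (op_sqrt T)" "op_mult (op_sqrt T) (op_sqrt T) = T"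
    by (simp_all add: op_sqrt_def)
qed

section \<open>Polar decomposition up to an error \<epsilon>\<close>

definition unit_vec :: "'a \<Rightarrow> 'a \<Rightarrow> complex" where
  "unit_vec i = (\<lambda>j. if j = i then 1 else 0)"

lemma l2_unit_vec: "l2 (unit_vec i)"
  by (rule l2_finite_support[of "{i}"]) (auto simp: unit_vec_def)

lemma l2_norm_unit_vec: "l2_norm (unit_vec i) = 1"
  by (subst l2_norm_finite_support[of "{i}"]) (auto simp: unit_vec_def)

lemma op_apply_unit_vec: "op_apply A (unit_vec i) = (\<lambda>j. A j i)"
  unfolding op_apply_def
  by (intro ext infsumI has_sum_finite_neutralI[of "{i}"]) (auto simp: unit_vec_def)

lemma l2_inner_unit_vec: "l2_inner (unit_vec i) y = y i"
  unfolding l2_inner_def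
  by (intro infsumI has_sum_finite_neutralI[of "{i}"]) (auto simp: unit_vec_def)

text \<open>
  The vectors \<open>X (B + \<epsilon>)\<^sup>-\<^sup>1 e\<^sub>i\<close> are the rows of an approximate polar part \<open>W\<close> of \<open>X\<close>, with
  \<open>W X \<approx> B\<close>; being a contraction, \<open>W\<close> satisfies a Bessel inequality.
\<close>

lemma approximate_polar:
  assumes X: "op_bound X C" and B: "positive_op B" "op_mult B B = op_mult (op_adj X) X" and \<epsilon>: "0 < \<epsilon>"
  obtains w where "\<And>i. l2 (w i)"
    and "\<And>i. Re (B i i) \<le> Re (l2_inner (w i) (\<lambda>j. X j i)) + \<epsilon>"
    and "\<And>F z. finite F \<Longrightarrow> l2 z \<Longrightarrow> fin_norm (\<lambda>i. l2_inner (w i) z) F \<le> l2_norm z"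
proof -
  obtain b where b: "op_bound B b"
    using B positive_op_def bounded_op_iff by blast
  have B_adj: "op_adj B = B"
    using positive_op_hermitian[OF B(1)] by (simp add: op_hermitian_def)
  define D where "D = (\<lambda>i j. of_real \<epsilon> * op_one i j + B i j)"
  obtain d where D: "op_bound D d"
    using op_bound_add[OF op_bound_scale[OF op_bound_one, of "of_real \<epsilon>"] b] by (simp add: D_def)
  obtain R \<rho> where R: "op_bound R \<rho>" "op_mult D R = op_one"
    using positive_op_resolvent_exists[OF B(1) \<epsilon>] bounded_op_iff unfolding D_def by metis
  have D_apply: "op_apply D y = (\<lambda>i. of_real \<epsilon> * y i + op_apply B y i)" if y: "l2 y" for y
  proof
    fix i
    have "(\<lambda>j. of_real \<epsilon> * op_one i j * y j) summable_on UNIV"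
      by (rule op_apply_summable[OF op_bound_scale[OF op_bound_one] y])
    then have "op_apply D y i = (\<Sum>\<^sub>\<infinity>j. of_real \<epsilon> * op_one i j * y j) + op_apply B y i"
      unfolding D_def op_apply_def distrib_right by (intro infsum_add op_apply_summable[OF b y])
    also have "(\<Sum>\<^sub>\<infinity>j. of_real \<epsilon> * op_one i j * y j) = of_real \<epsilon> * op_apply op_one y i"
      by (simp only: op_apply_def mult.assoc infsum_cmult_right')
    finally show "op_apply D y i = of_real \<epsilon> * y i + op_apply B y i"
      by simp
  qed
  \<comment> \<open>In (B y, (\<epsilon> + B) y) the part \<epsilon> (B y, y) is nonnegative, so
    norm(B y)^2 is at most that inner product, and Cauchy-Schwarz cancels one factor norm(B
    y).\<close>
  have B_le_D: "l2_norm (op_apply B y) \<le> l2_norm (op_apply D y)" if y: "l2 y" for y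
  proof -
    have By: "l2 (op_apply B y)" and ey: "l2 (\<lambda>i. of_real \<epsilon> * y i)"
      by (rule l2_op_apply[OF b y], rule l2_scale[OF y])
    have Dy: "l2 (op_apply D y)"
      by (rule l2_op_apply[OF D y])
    have 1: "l2_inner (op_apply B y) (op_apply D y) =
        of_real \<epsilon> * l2_inner (op_apply B y) y + l2_inner (op_apply B y) (op_apply B y)"
      unfolding D_apply[OF y] l2_inner_add_right[OF By ey By] l2_inner_scale_right ..
    have "Re (l2_inner (op_apply B y) y) = Re (l2_inner y (op_apply B y))"
      by (simp add: l2_inner_commute[of y "op_apply B y"])
    then have "0 \<le> Re (l2_inner (op_apply B y) y)"
      using positive_op_inner_nonneg[OF B(1) y] by simp
    then have "(l2_norm (op_apply B y))\<^sup>2 \<le> Re (l2_inner (op_apply B y) (op_apply D y))"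
      unfolding 1 l2_inner_self[OF By] using \<epsilon> by (simp flip: of_real_power)
    also have "\<dots> \<le> l2_norm (op_apply B y) * l2_norm (op_apply D y)"
      using complex_Re_le_cmod cmod_l2_inner_le[OF By Dy] order_trans by blast
    finally have "l2_norm (op_apply B y) * l2_norm (op_apply B y) \<le>
        l2_norm (op_apply B y) * l2_norm (op_apply D y)"
      by (simp add: power2_eq_square)
    then show ?thesis
      using l2_norm_nonneg[of "op_apply B y"] l2_norm_nonneg[of "op_apply D y"]
      by (cases "l2_norm (op_apply B y) = 0") (simp_all add: mult_le_cancel_left less_le)
  qed
  define r where "r i = op_apply R (unit_vec i)" for i
  have r: "l2 (r i)" for i
    unfolding r_def by (rule l2_op_apply[OF R(1) l2_unit_vec])
  have Dr: "op_apply D (r i) = unit_vec i" for i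
    unfolding r_def op_apply_mult[OF D R(1) l2_unit_vec, symmetric] R(2) by simp
  define w where "w i = op_apply X (r i)" for i
  have w: "l2 (w i)" for i
    unfolding w_def by (rule l2_op_apply[OF X r])
  \<comment> \<open>Since adj(X) X = B^2, the images under X and under B have the same inner
    products; estimates for B carry over to X.\<close>
  have XX: "l2_inner (op_apply X y) (op_apply X z) = l2_inner (op_apply B y) (op_apply B z)"
    if y: "l2 y" and z: "l2 z" for y z
  proof -
    have "op_adj (op_adj X) = X"
      by (simp add: op_adj_def)
    then have "l2_inner (op_apply X y) (op_apply X z) = l2_inner y (op_apply (op_mult (op_adj X) X) z)"
      using op_inner_adjoint[OF op_bound_adj[OF X] y l2_op_apply[OF X z]]
        op_apply_mult[OF op_bound_adj[OF X] X z] by simp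
    also have "\<dots> = l2_inner (op_apply B y) (op_apply B z)"
      using op_inner_adjoint[OF b y l2_op_apply[OF b z]] op_apply_mult[OF b b z] B(2) B_adj by simp
    finally show ?thesis .
  qed
  have diag: "Re (B i i) \<le> Re (l2_inner (w i) (\<lambda>j. X j i)) + \<epsilon>" for i
  proof -
    have Bi: "l2 (op_apply B (unit_vec i))" and Br: "l2 (op_apply B (r i))"
      by (rule l2_op_apply[OF b l2_unit_vec], rule l2_op_apply[OF b r])
    \<comment> \<open>This is (\<epsilon> + B) r_i = e_i. Replacing B r_i by e_i costs \<epsilon>
      (e_i, B r_i), whose real part is at most \<epsilon> because norm(B r_i) <= norm(e_i).\<close>
    have "op_apply B (r i) = (\<lambda>j. unit_vec i j - of_real \<epsilon> * r i j)"
      using D_apply[OF r, of i] by (simp add: Dr)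
    then have "l2_inner (op_apply B (unit_vec i)) (op_apply B (r i)) =
        l2_inner (op_apply B (unit_vec i)) (unit_vec i) - of_real \<epsilon> * l2_inner (op_apply B (unit_vec i)) (r i)"
      using Bi by (simp add: l2_inner_diff_right l2_unit_vec l2_scale r l2_inner_scale_right)
    also have "l2_inner (op_apply B (unit_vec i)) (unit_vec i) = cnj (B i i)"
      by (subst l2_inner_commute) (simp add: l2_inner_unit_vec op_apply_unit_vec)
    also have "l2_inner (op_apply B (unit_vec i)) (r i) = l2_inner (unit_vec i) (op_apply B (r i))"
      using op_inner_adjoint[OF b l2_unit_vec r] by (simp add: B_adj)
    finally have "Re (l2_inner (op_apply X (unit_vec i)) (w i)) =
        Re (B i i) - \<epsilon> * Re (l2_inner (unit_vec i) (op_apply B (r i)))"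
      by (simp add: w_def XX l2_unit_vec r)
    moreover have "Re (l2_inner (op_apply X (unit_vec i)) (w i)) = Re (l2_inner (w i) (\<lambda>j. X j i))"
      by (subst l2_inner_commute) (simp add: op_apply_unit_vec)
    moreover have "Re (l2_inner (unit_vec i) (op_apply B (r i))) \<le> 1"
    proof -
      have "Re (l2_inner (unit_vec i) (op_apply B (r i))) \<le> l2_norm (unit_vec i) * l2_norm (op_apply B (r i))"
        using complex_Re_le_cmod cmod_l2_inner_le[OF l2_unit_vec Br] order_trans by blast
      also have "\<dots> \<le> 1"
        using B_le_D[OF r, of i] by (simp add: Dr l2_norm_unit_vec)
      finally show ?thesis .
    qed
    ultimately show ?thesis
      using \<epsilon> mult_left_mono[of "Re (l2_inner (unit_vec i) (op_apply B (r i)))" 1 \<epsilon>] by simp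
  qed
  \<comment> \<open>Duality: for y = sum of c_i r_i with c_i = (w_i, z), D y is c cut off to F and X
    y is the sum of c_i w_i. Hence norm(X y) <= norm(c), while norm(c)^2 = (z, X y).\<close>
  have bessel: "fin_norm (\<lambda>i. l2_inner (w i) z) F \<le> l2_norm z" if F: "finite F" and z: "l2 z" for F z
  proof -
    define c where "c i = l2_inner (w i) z" for i
    define y where "y = (\<lambda>j. \<Sum>i\<in>F. c i * r i j)"
    have y: "l2 y"
      unfolding y_def by (intro l2_sum l2_scale r)
    have Xy: "op_apply X y = (\<lambda>j. \<Sum>i\<in>F. c i * w i j)"
      unfolding y_def w_def by (simp add: op_apply_sum[OF X] l2_scale r op_apply_scale)
    have Dy: "op_apply D y = restr F c"
    proof -
      have "op_apply D y = (\<lambda>j. \<Sum>i\<in>F. c i * unit_vec i j)"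
        unfolding y_def by (simp add: op_apply_sum[OF D] l2_scale r op_apply_scale Dr)
      then show ?thesis
        using F by (simp add: restr_def unit_vec_def fun_eq_iff if_distrib[of "(*) _"] cong: if_cong)
    qed
    have "(l2_norm (op_apply X y))\<^sup>2 = (l2_norm (op_apply B y))\<^sup>2"
    proof -
      have "complex_of_real ((l2_norm (op_apply X y))\<^sup>2) = of_real ((l2_norm (op_apply B y))\<^sup>2)"
        using XX[OF y y] l2_inner_self[OF l2_op_apply[OF X y]] l2_inner_self[OF l2_op_apply[OF b y]] by simp
      then show ?thesis
        using of_real_eq_iff by blast
    qed
    then have "l2_norm (op_apply X y) = l2_norm (op_apply B y)"
      by simp
    also have "\<dots> \<le> fin_norm c F"
      using B_le_D[OF y] by (simp add: Dy l2_norm_restr F)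
    finally have le: "l2_norm (op_apply X y) \<le> fin_norm c F" .
    have "l2_inner z (op_apply X y) = (\<Sum>i\<in>F. c i * cnj (c i))"
    proof -
      have "l2_inner z (w i) = cnj (c i)" for i
        unfolding c_def by (rule l2_inner_commute)
      then show ?thesis
        unfolding Xy using z w by (simp add: l2_inner_sum_right l2_scale l2_inner_scale_right)
    qed
    also have "\<dots> = of_real ((fin_norm c F)\<^sup>2)"
      by (simp add: L2_set_def sum_nonneg cnj_mult_self mult.commute[of _ "cnj _"])
    finally have "(fin_norm c F)\<^sup>2 \<le> l2_norm z * l2_norm (op_apply X y)"
      using cmod_l2_inner_le[OF z l2_op_apply[OF X y]] by (simp add: norm_power)
    also have "\<dots> \<le> l2_norm z * fin_norm c F"
      using le by (intro mult_left_mono) auto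
    finally have "fin_norm c F * fin_norm c F \<le> fin_norm c F * l2_norm z"
      by (simp add: power2_eq_square mult.commute)
    then show ?thesis
      unfolding c_def[symmetric] using L2_set_nonneg[of "\<lambda>i. cmod (c i)" F] l2_norm_nonneg[of z]
      by (cases "fin_norm c F = 0") (simp_all add: mult_le_cancel_left less_le)
  qed
  show ?thesis
    by (rule that[OF w diag bessel])
qed

subsection \<open>The trace norm of a partial trace\<close>

text \<open>A vector of the tensor product is read as a matrix with rows indexed by the system and
  columns by the environment; its norm may be taken row by row.\<close>

lemma
  assumes "l2 u"
  shows l2_row: "l2 (\<lambda>e. u (a, e))"
    and l2_row_norms: "l2 (\<lambda>a. of_real (l2_norm (\<lambda>e. u (a, e))))"
    and l2_norm_row_norms: "l2_norm (\<lambda>a. of_real (l2_norm (\<lambda>e. u (a, e)))) = l2_norm u"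
proof -
  have s: "(\<lambda>(a, e). (cmod (u (a, e)))\<^sup>2) summable_on UNIV \<times> UNIV"
    using assms by (simp add: l2_def case_prod_unfold)
  show row: "l2 (\<lambda>e. u (a, e))" for a
    using summable_on_SigmaD1[of "\<lambda>a e. (cmod (u (a, e)))\<^sup>2" UNIV "\<lambda>_. UNIV"] s by (simp add: l2_def)
  have eq: "(cmod (of_real (l2_norm (\<lambda>e. u (a, e)))))\<^sup>2 = (\<Sum>\<^sub>\<infinity>e. (cmod (u (a, e)))\<^sup>2)" for a
    by (simp add: l2_norm_power2)
  show "l2 (\<lambda>a. of_real (l2_norm (\<lambda>e. u (a, e))))"
    unfolding l2_def eq using summable_on_Sigma_banach[OF s] by simp
  show "l2_norm (\<lambda>a. of_real (l2_norm (\<lambda>e. u (a, e)))) = l2_norm u"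
    unfolding l2_norm_def[of "\<lambda>a. of_real (l2_norm (\<lambda>e. u (a, e)))"] l2_norm_def[of u] eq
    using infsum_Sigma'_banach[OF s] by (simp add: case_prod_unfold)
qed

lemma
  assumes "l2 u"
  shows l2_swap: "l2 (u \<circ> prod.swap)" and l2_norm_swap: "l2_norm (u \<circ> prod.swap) = l2_norm u"
proof -
  have b: "bij_betw prod.swap UNIV UNIV"
    by simp
  show "l2 (u \<circ> prod.swap)"
    using assms summable_on_reindex_bij_betw[OF b, of "\<lambda>i. (cmod (u i))\<^sup>2"] by (simp add: l2_def)
  show "l2_norm (u \<circ> prod.swap) = l2_norm u"
    using infsum_reindex_bij_betw[OF b, of "\<lambda>i. (cmod (u i))\<^sup>2"] by (simp add: l2_norm_def)
qed

lemma
  assumes "l2 u"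
  shows l2_col: "l2 (\<lambda>a. u (a, e))"
    and l2_col_norms: "l2 (\<lambda>e. of_real (l2_norm (\<lambda>a. u (a, e))))"
    and l2_norm_col_norms: "l2_norm (\<lambda>e. of_real (l2_norm (\<lambda>a. u (a, e)))) = l2_norm u"
  using l2_row[OF l2_swap[OF assms], of e] l2_row_norms[OF l2_swap[OF assms]]
    l2_norm_row_norms[OF l2_swap[OF assms]] by (simp_all add: l2_norm_swap[OF assms])

lemma l2_tensor:
  assumes "l2 x" "l2 y"
  shows "l2 (\<lambda>(a, e). x a * y e)"
proof -
  have "(\<lambda>(a, e). (cmod (x a))\<^sup>2 * (cmod (y e))\<^sup>2) summable_on UNIV \<times> UNIV"
  proof (rule summable_on_SigmaI)
    show "((\<lambda>e. case (a, e) of (a, e) \<Rightarrow> (cmod (x a))\<^sup>2 * (cmod (y e))\<^sup>2) has_sum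
        (cmod (x a))\<^sup>2 * (l2_norm y)\<^sup>2) UNIV" for a
      unfolding prod.case by (intro has_sum_cmult_right has_sum_l2_norm assms)
    show "(\<lambda>a. (cmod (x a))\<^sup>2 * (l2_norm y)\<^sup>2) summable_on UNIV"
      using assms(1) unfolding l2_def by (rule summable_on_cmult_left)
  qed auto
  then show ?thesis
    by (simp add: l2_def case_prod_unfold norm_mult power_mult_distrib)
qed

lemma op_bound_rank_one:
  assumes "\<And>i j. cmod (A i j) \<le> f i * g j"
    and f: "l2 (\<lambda>i. of_real (f i))" "\<And>i. 0 \<le> f i" and g: "l2 (\<lambda>i. of_real (g i))" "\<And>i. 0 \<le> g i"
  shows "op_bound A (l2_norm (\<lambda>i. of_real (f i)) * l2_norm (\<lambda>i. of_real (g i)))"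
  unfolding op_bound_def
proof safe
  fix F x y assume F: "finite (F :: 'a set)"
  have "cmod (op_form A F x y) \<le> (\<Sum>i\<in>F. \<Sum>j\<in>F. cmod (cnj (x i) * A i j * y j))"
    unfolding op_form_def by (intro order_trans[OF norm_sum] sum_mono norm_sum)
  also have "\<dots> \<le> (\<Sum>i\<in>F. \<Sum>j\<in>F. (cmod (x i) * f i) * (g j * cmod (y j)))"
  proof (intro sum_mono)
    fix i j
    show "cmod (cnj (x i) * A i j * y j) \<le> (cmod (x i) * f i) * (g j * cmod (y j))"
      using mult_right_mono[OF mult_left_mono[OF assms(1)[of i j], of "cmod (x i)"], of "cmod (y j)"]
      by (simp add: norm_mult mult_ac)
  qed
  also have "\<dots> = (\<Sum>i\<in>F. cmod (x i) * f i) * (\<Sum>j\<in>F. g j * cmod (y j))"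
    by (simp add: sum_product)
  also have "\<dots> \<le> (fin_norm x F * l2_norm (\<lambda>i. of_real (f i))) * (l2_norm (\<lambda>i. of_real (g i)) * fin_norm y F)"
  proof (intro mult_mono)
    have "(\<Sum>i\<in>F. cmod (x i) * f i) \<le> fin_norm x F * fin_norm (\<lambda>i. of_real (f i)) F"
      using L2_set_mult_ineq[of "\<lambda>i. cmod (x i)" f F] f(2) by simp
    also have "\<dots> \<le> fin_norm x F * l2_norm (\<lambda>i. of_real (f i))"
      by (intro mult_left_mono fin_norm_le_l2_norm f) simp
    finally show "(\<Sum>i\<in>F. cmod (x i) * f i) \<le> fin_norm x F * l2_norm (\<lambda>i. of_real (f i))" .
    have "(\<Sum>i\<in>F. g i * cmod (y i)) \<le> fin_norm (\<lambda>i. of_real (g i)) F * fin_norm y F"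
      using L2_set_mult_ineq[of g "\<lambda>i. cmod (y i)" F] g(2) by simp
    also have "\<dots> \<le> l2_norm (\<lambda>i. of_real (g i)) * fin_norm y F"
      by (intro mult_right_mono fin_norm_le_l2_norm g) simp
    finally show "(\<Sum>i\<in>F. g i * cmod (y i)) \<le> l2_norm (\<lambda>i. of_real (g i)) * fin_norm y F" .
  qed (auto intro!: sum_nonneg mult_nonneg_nonneg simp: g(2))
  finally show "cmod (op_form A F x y) \<le>
      l2_norm (\<lambda>i. of_real (f i)) * l2_norm (\<lambda>i. of_real (g i)) * fin_norm x F * fin_norm y F"
    by (simp add: mult_ac)
qed simp

lemma has_sum_sum:
  fixes f :: "'k \<Rightarrow> 'a \<Rightarrow> 'b::topological_comm_monoid_add"
  assumes "\<And>k. k \<in> K \<Longrightarrow> (f k has_sum s k) A"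
  shows "((\<lambda>x. \<Sum>k\<in>K. f k x) has_sum (\<Sum>k\<in>K. s k)) A"
  using assms by (induction K rule: infinite_finite_induct) (auto intro: has_sum_add)

lemma row_product_summable:
  assumes "l2 u" "l2 v"
  shows "(\<lambda>e. u (a, e) * cnj (v (b, e))) summable_on UNIV"
  using assms by (intro summable_l2_mult) (simp_all add: l2_row)

lemma op_bound_partial_trace:
  assumes u: "l2 u" and v: "l2 v"
  shows "op_bound (\<lambda>a b. \<Sum>\<^sub>\<infinity>e. u (a, e) * cnj (v (b, e))) (l2_norm u * l2_norm v)"
proof -
  have "cmod (\<Sum>\<^sub>\<infinity>e. u (a, e) * cnj (v (b, e))) \<le> l2_norm (\<lambda>e. u (a, e)) * l2_norm (\<lambda>e. v (b, e))" for a b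
    using cmod_infsum_mult_le[of "\<lambda>e. u (a, e)" "\<lambda>e. cnj (v (b, e))"] l2_row[OF u] l2_row[OF v] by simp
  from op_bound_rank_one[OF this l2_row_norms[OF u] l2_norm_nonneg l2_row_norms[OF v] l2_norm_nonneg]
  show ?thesis
    by (simp add: l2_norm_row_norms u v)
qed

text \<open>This is |Tr(W Tr_E |u><v|)| = |<v| W (x) 1 |u>| for the contraction W with rows w_i: W
  does not increase the norm of any column of u, and Cauchy-Schwarz over the columns finishes. It is
  the dual form of the monotonicity of the trace norm under a partial trace.\<close>

lemma contraction_trace_bound:
  assumes F: "finite F" and w: "\<And>i. i \<in> F \<Longrightarrow> l2 (w i)"
    and bessel: "\<And>z. l2 z \<Longrightarrow> fin_norm (\<lambda>i. l2_inner (w i) z) F \<le> l2_norm z"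
    and u: "l2 u" and v: "l2 v"
  shows "cmod (\<Sum>i\<in>F. l2_inner (w i) (\<lambda>a. \<Sum>\<^sub>\<infinity>e. u (a, e) * cnj (v (i, e)))) \<le> l2_norm u * l2_norm v"
proof -
  define d where "d i e = l2_inner (w i) (\<lambda>a. u (a, e))" for i e
  define S where "S i = l2_inner (w i) (\<lambda>a. \<Sum>\<^sub>\<infinity>e. u (a, e) * cnj (v (i, e)))" for i
  have S: "((\<lambda>e. cnj (v (i, e)) * d i e) has_sum S i) UNIV" if i: "i \<in> F" for i
  proof -
    \<comment> \<open>A product of two l2 vectors on the pairs (a, e), hence absolutely summable;
      this licenses the exchange of the two sums.\<close>
    define h where "h = (\<lambda>(a, e). (cnj (w i a) * cnj (v (i, e))) * u (a, e))"
    have "l2 (\<lambda>(a, e). cnj (w i a) * cnj (v (i, e)))"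
      using w[OF i] l2_row[OF v] by (intro l2_tensor) simp_all
    from summable_l2_mult[OF this u] have "h summable_on UNIV \<times> UNIV"
      by (simp add: h_def case_prod_unfold)
    then have h: "(h has_sum infsum h UNIV) (UNIV \<times> UNIV)"
      by simp
    have "(\<Sum>\<^sub>\<infinity>e. h (a, e)) = cnj (w i a) * (\<Sum>\<^sub>\<infinity>e. u (a, e) * cnj (v (i, e)))" for a
      unfolding h_def by (simp add: mult_ac flip: infsum_cmult_right')
    then have "infsum h UNIV = S i"
      using infsum_Sigma_banach[OF \<open>h summable_on UNIV \<times> UNIV\<close>] by (simp add: S_def l2_inner_def)
    moreover have "((\<lambda>(e, a). h (a, e)) has_sum infsum h UNIV) (UNIV \<times> UNIV)"
      using h by (subst (asm) has_sum_swap) (simp add: case_prod_beta)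
    moreover have "((\<lambda>a. h (a, e)) has_sum cnj (v (i, e)) * d i e) UNIV" for e
    proof -
      have "((\<lambda>a. cnj (v (i, e)) * (cnj (w i a) * u (a, e))) has_sum cnj (v (i, e)) * d i e) UNIV"
        unfolding d_def l2_inner_def
        using w[OF i] l2_col[OF u] by (intro has_sum_cmult_right has_sum_infsum summable_l2_mult) simp_all
      then show ?thesis
        by (simp add: h_def mult_ac)
    qed
    ultimately show ?thesis
      by (intro has_sum_SigmaD[where f = "\<lambda>(e, a). h (a, e)" and A = UNIV and B = "\<lambda>_. UNIV"]) simp_all
  qed
  have "((\<lambda>e. \<Sum>i\<in>F. cnj (v (i, e)) * d i e) has_sum (\<Sum>i\<in>F. S i)) UNIV"
    by (intro has_sum_sum S)
  moreover have "((\<lambda>e. l2_norm (\<lambda>a. v (a, e)) * l2_norm (\<lambda>a. u (a, e))) has_sum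
      (\<Sum>\<^sub>\<infinity>e. l2_norm (\<lambda>a. v (a, e)) * l2_norm (\<lambda>a. u (a, e)))) UNIV"
    using abs_summable_l2_mult[OF l2_col_norms[OF v] l2_col_norms[OF u]] by (simp add: norm_mult)
  moreover have "cmod (\<Sum>i\<in>F. cnj (v (i, e)) * d i e) \<le> l2_norm (\<lambda>a. v (a, e)) * l2_norm (\<lambda>a. u (a, e))" for e
  proof -
    have "cmod (\<Sum>i\<in>F. cnj (v (i, e)) * d i e) \<le> (\<Sum>i\<in>F. cmod (v (i, e)) * cmod (d i e))"
      by (rule order_trans[OF norm_sum]) (simp add: norm_mult)
    also have "\<dots> \<le> fin_norm (\<lambda>a. v (a, e)) F * fin_norm (\<lambda>i. d i e) F"
      using L2_set_mult_ineq[of "\<lambda>i. cmod (v (i, e))" "\<lambda>i. cmod (d i e)" F] by simp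
    also have "\<dots> \<le> l2_norm (\<lambda>a. v (a, e)) * l2_norm (\<lambda>a. u (a, e))"
      unfolding d_def by (intro mult_mono fin_norm_le_l2_norm bessel l2_col u v) auto
    finally show ?thesis .
  qed
  ultimately have "cmod (\<Sum>i\<in>F. S i) \<le> (\<Sum>\<^sub>\<infinity>e. l2_norm (\<lambda>a. v (a, e)) * l2_norm (\<lambda>a. u (a, e)))"
    by (rule norm_infsum_le)
  also have "\<dots> \<le> l2_norm v * l2_norm u"
    using infsum_cmod_mult_le[OF l2_col_norms[OF v] l2_col_norms[OF u]]
    by (simp add: l2_norm_col_norms u v)
  finally show ?thesis
    by (simp add: S_def mult.commute)
qed

text \<open>The diagonal of the square root of adj(X) X is replaced by (w_i, X e_i) from the
  approximate polar decomposition, and each half of X is bounded by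
  \<open>contraction_trace_bound\<close>.\<close>

lemma trace_norm_le:
  assumes u: "l2 u" and v: "l2 v"
    and X_def: "X = (\<lambda>a b. (1/2) * ((\<Sum>\<^sub>\<infinity>e. u (a, e) * cnj (v (b, e))) + (\<Sum>\<^sub>\<infinity>e. v (a, e) * cnj (u (b, e)))))"
  shows "trace_norm X \<le> l2_norm u * l2_norm v"
proof -
  define P where "P = (\<lambda>a b. \<Sum>\<^sub>\<infinity>e. u (a, e) * cnj (v (b, e)))"
  define Q where "Q = (\<lambda>a b. \<Sum>\<^sub>\<infinity>e. v (a, e) * cnj (u (b, e)))"
  have X_eq: "X = (\<lambda>a b. (1/2) * (P a b + Q a b))"
    by (simp add: X_def P_def Q_def)
  have PQ: "op_bound P (l2_norm u * l2_norm v)" "op_bound Q (l2_norm v * l2_norm u)"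
    unfolding P_def Q_def by (intro op_bound_partial_trace u v)+
  obtain C where X: "op_bound X C"
    using op_bound_scale[OF op_bound_add[OF PQ], of "1/2"] by (simp add: X_eq)
  define B where "B = op_sqrt (op_mult (op_adj X) X)"
  have B: "positive_op B" "op_mult B B = op_mult (op_adj X) X"
    unfolding B_def by (intro op_sqrt_positive positive_op_adj_mult[OF X])+
  have Pc: "l2 (\<lambda>a. P a i)" and Qc: "l2 (\<lambda>a. Q a i)" for i
    using op_bound_row[OF op_bound_adj[OF PQ(1)], of i] op_bound_row[OF op_bound_adj[OF PQ(2)], of i]
    by (simp_all add: op_adj_def)
  have approx: "(\<Sum>i\<in>F. Re (B i i)) \<le> l2_norm u * l2_norm v + real (card F) * \<epsilon>"
    if F: "finite F" and \<epsilon>: "0 < \<epsilon>" for F \<epsilon>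
  proof -
    obtain w where w: "\<And>i. l2 (w i)" and diag: "\<And>i. Re (B i i) \<le> Re (l2_inner (w i) (\<lambda>j. X j i)) + \<epsilon>"
      and bessel: "\<And>F z. finite F \<Longrightarrow> l2 z \<Longrightarrow> fin_norm (\<lambda>i. l2_inner (w i) z) F \<le> l2_norm z"
      using approximate_polar[OF X B \<epsilon>] by metis
    have "(\<Sum>i\<in>F. Re (B i i)) \<le> (\<Sum>i\<in>F. Re (l2_inner (w i) (\<lambda>j. X j i)) + \<epsilon>)"
      by (intro sum_mono diag)
    also have "\<dots> = Re (\<Sum>i\<in>F. l2_inner (w i) (\<lambda>j. X j i)) + real (card F) * \<epsilon>"
      by (simp add: sum.distrib)
    also have "(\<Sum>i\<in>F. l2_inner (w i) (\<lambda>j. X j i)) =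
        (1/2) * ((\<Sum>i\<in>F. l2_inner (w i) (\<lambda>a. P a i)) + (\<Sum>i\<in>F. l2_inner (w i) (\<lambda>a. Q a i)))"
    proof -
      have "l2_inner (w i) (\<lambda>j. X j i) = (1/2) * (l2_inner (w i) (\<lambda>a. P a i) + l2_inner (w i) (\<lambda>a. Q a i))" for i
        unfolding X_eq l2_inner_scale_right l2_inner_add_right[OF w Pc Qc] ..
      then show ?thesis
        by (simp only: sum.distrib flip: sum_distrib_left)
    qed
    also have "Re \<dots> \<le> l2_norm u * l2_norm v"
    proof -
      have "Re (\<Sum>i\<in>F. l2_inner (w i) (\<lambda>a. P a i)) \<le> l2_norm u * l2_norm v"
        using complex_Re_le_cmod contraction_trace_bound[OF F w bessel[OF F] u v] order_trans
        unfolding P_def by blast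
      moreover have "Re (\<Sum>i\<in>F. l2_inner (w i) (\<lambda>a. Q a i)) \<le> l2_norm v * l2_norm u"
        using complex_Re_le_cmod contraction_trace_bound[OF F w bessel[OF F] v u] order_trans
        unfolding Q_def by blast
      ultimately show ?thesis
        by (simp add: mult.commute)
    qed
    finally show ?thesis
      by simp
  qed
  have le: "(\<Sum>i\<in>F. Re (B i i)) \<le> l2_norm u * l2_norm v" if F: "finite F" for F
  proof (rule field_le_epsilon)
    fix e :: real assume e: "0 < e"
    \<comment> \<open>The polar error is \<epsilon> per diagonal entry, so it is chosen after F; the
      added 1 covers the empty set.\<close>
    have "real (card F) * (e / (real (card F) + 1)) \<le> e"
      using e by (simp add: field_simps)
    then show "(\<Sum>i\<in>F. Re (B i i)) \<le> l2_norm u * l2_norm v + e"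
      using approx[OF F, of "e / (real (card F) + 1)"] e by (simp add: add_pos_nonneg)
  qed
  show ?thesis
  \<comment> \<open>In the divergent case \<open>op_trace\<close> has the default value 0 and the
    bound is trivial.\<close>
  proof (cases "(\<lambda>i. B i i) summable_on UNIV")
    case True
    have "trace_norm X = (\<Sum>\<^sub>\<infinity>i. Re (B i i))"
      using True by (simp add: trace_norm_def op_trace_def B_def infsum_Re)
    also have "\<dots> \<le> l2_norm u * l2_norm v"
      using True by (intro infsum_le_finite_sums summable_on_Re le)
    finally show ?thesis .
  next
    case False
    then show ?thesis
      by (simp add: trace_norm_def op_trace_def B_def infsum_not_exists)
  qed
qed

text \<open>With f the real part of the overlap, the difference and the sum of the two vectors have
  squared norms at most 2 - 2 f and 2 + 2 f, whose product is 4 (1 - f^2). The overlap computed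
  below is real, so f is all of it.\<close>

lemma trace_norm_purifications:
  assumes \<phi>: "l2 \<phi>0" "l2 \<phi>1" "l2_norm \<phi>0 \<le> 1" "l2_norm \<phi>1 \<le> 1"
  shows "trace_norm (\<lambda>a b. (\<Sum>\<^sub>\<infinity>e. \<phi>0 (a, e) * cnj (\<phi>0 (b, e))) - (\<Sum>\<^sub>\<infinity>e. \<phi>1 (a, e) * cnj (\<phi>1 (b, e))))
    \<le> 2 * sqrt (1 - (Re (l2_inner \<phi>0 \<phi>1))\<^sup>2)"
proof -
  define f where "f = Re (l2_inner \<phi>0 \<phi>1)"
  define u where "u = (\<lambda>i. \<phi>0 i - \<phi>1 i)"
  define v where "v = (\<lambda>i. \<phi>0 i + \<phi>1 i)"
  have u: "l2 u" and v: "l2 v"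
    unfolding u_def v_def by (intro l2_diff l2_add \<phi>)+
  have nu: "(l2_norm u)\<^sup>2 \<le> 2 - 2 * f" and nv: "(l2_norm v)\<^sup>2 \<le> 2 + 2 * f"
  proof -
    have comm: "l2_inner \<phi>1 \<phi>0 = cnj (l2_inner \<phi>0 \<phi>1)"
      by (rule l2_inner_commute)
    have sq: "Re (l2_inner z z) = (l2_norm z)\<^sup>2" if "l2 z" for z :: "'a \<times> 'b \<Rightarrow> complex"
      unfolding l2_inner_self[OF that] by (simp flip: of_real_power)
    have "l2_inner u u = l2_inner u \<phi>0 - l2_inner u \<phi>1"
      unfolding u_def by (intro l2_inner_diff_right l2_diff \<phi>)
    moreover have "l2_inner u z = cnj (l2_inner z \<phi>0 - l2_inner z \<phi>1)" if "l2 z" for z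
      unfolding l2_inner_diff_right[OF that \<phi>(1,2), symmetric] u_def by (rule l2_inner_commute)
    ultimately have "l2_inner u u = cnj (l2_inner \<phi>0 \<phi>0 - l2_inner \<phi>0 \<phi>1) - cnj (l2_inner \<phi>1 \<phi>0 - l2_inner \<phi>1 \<phi>1)"
      by (simp only: \<phi>)
    then have nu: "(l2_norm u)\<^sup>2 = (l2_norm \<phi>0)\<^sup>2 - 2 * f + (l2_norm \<phi>1)\<^sup>2"
      using sq[OF u] sq[OF \<phi>(1)] sq[OF \<phi>(2)] comm by (simp add: f_def)
    have "l2_inner v v = l2_inner v \<phi>0 + l2_inner v \<phi>1"
      unfolding v_def by (intro l2_inner_add_right l2_add \<phi>)
    moreover have "l2_inner v z = cnj (l2_inner z \<phi>0 + l2_inner z \<phi>1)" if "l2 z" for z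
      unfolding l2_inner_add_right[OF that \<phi>(1,2), symmetric] v_def by (rule l2_inner_commute)
    ultimately have "l2_inner v v = cnj (l2_inner \<phi>0 \<phi>0 + l2_inner \<phi>0 \<phi>1) + cnj (l2_inner \<phi>1 \<phi>0 + l2_inner \<phi>1 \<phi>1)"
      by (simp only: \<phi>)
    then have nv: "(l2_norm v)\<^sup>2 = (l2_norm \<phi>0)\<^sup>2 + 2 * f + (l2_norm \<phi>1)\<^sup>2"
      using sq[OF v] sq[OF \<phi>(1)] sq[OF \<phi>(2)] comm by (simp add: f_def)
    have "(l2_norm \<phi>0)\<^sup>2 \<le> 1" "(l2_norm \<phi>1)\<^sup>2 \<le> 1"
      using \<phi> by (simp_all add: power_le_one)
    then show "(l2_norm u)\<^sup>2 \<le> 2 - 2 * f" "(l2_norm v)\<^sup>2 \<le> 2 + 2 * f"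
      using nu nv by simp_all
  qed
  define X where "X = (\<lambda>a b. (\<Sum>\<^sub>\<infinity>e. \<phi>0 (a, e) * cnj (\<phi>0 (b, e))) - (\<Sum>\<^sub>\<infinity>e. \<phi>1 (a, e) * cnj (\<phi>1 (b, e))))"
  have "X = (\<lambda>a b. (1/2) * ((\<Sum>\<^sub>\<infinity>e. u (a, e) * cnj (v (b, e))) + (\<Sum>\<^sub>\<infinity>e. v (a, e) * cnj (u (b, e)))))"
  proof (intro ext)
    fix a b
    have s: "(\<lambda>e. x (a, e) * cnj (y (b, e))) summable_on UNIV" if "l2 x" "l2 y" for x y :: "'a \<times> 'b \<Rightarrow> complex"
      by (rule row_product_summable[OF that])
    have "(\<Sum>\<^sub>\<infinity>e. u (a, e) * cnj (v (b, e))) + (\<Sum>\<^sub>\<infinity>e. v (a, e) * cnj (u (b, e))) =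
        (\<Sum>\<^sub>\<infinity>e. u (a, e) * cnj (v (b, e)) + v (a, e) * cnj (u (b, e)))"
      by (intro infsum_add[symmetric] s u v)
    also have "\<dots> = (\<Sum>\<^sub>\<infinity>e. 2 * (\<phi>0 (a, e) * cnj (\<phi>0 (b, e)) - \<phi>1 (a, e) * cnj (\<phi>1 (b, e))))"
      by (intro infsum_cong) (simp add: u_def v_def algebra_simps)
    also have "\<dots> = 2 * X a b"
      unfolding infsum_cmult_right' X_def by (simp add: infsum_diff s \<phi>)
    finally show "X a b = (1/2) * ((\<Sum>\<^sub>\<infinity>e. u (a, e) * cnj (v (b, e))) + (\<Sum>\<^sub>\<infinity>e. v (a, e) * cnj (u (b, e))))"
      by simp
  qed
  from trace_norm_le[OF u v this] have "trace_norm X \<le> sqrt ((l2_norm u)\<^sup>2 * (l2_norm v)\<^sup>2)"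
    by (simp add: real_sqrt_mult)
  also have "\<dots> \<le> sqrt ((2 - 2 * f) * (2 + 2 * f))"
    by (intro real_sqrt_le_mono mult_mono nu nv) (use nu zero_le_power2 order_trans in blast)+
  also have "(2 - 2 * f) * (2 + 2 * f) = 2\<^sup>2 * (1 - f\<^sup>2)"
    by (simp add: power2_eq_square algebra_simps)
  also have "sqrt (2\<^sup>2 * (1 - f\<^sup>2)) = 2 * sqrt (1 - f\<^sup>2)"
    by (subst real_sqrt_mult) simp
  finally show ?thesis
    by (simp only: X_def f_def)
qed

subsection \<open>Matrix elements of the beam splitter\<close>

definition annihilate_snd :: "(nat \<times> nat \<Rightarrow> complex) \<Rightarrow> nat \<times> nat \<Rightarrow> complex" where
  "annihilate_snd \<psi> = (\<lambda>(k, l). of_real (sqrt (real (Suc l))) * \<psi> (k, Suc l))"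

lemma annihilate_snd_create_fst:
  "annihilate_snd (create_fst \<psi>) = create_fst (annihilate_snd \<psi>)"
  by (auto simp: annihilate_snd_def create_fst_def fun_eq_iff)

lemma annihilate_snd_create_snd:
  "annihilate_snd (create_snd \<psi>) = (\<lambda>i. \<psi> i + create_snd (annihilate_snd \<psi>) i)"
proof (rule ext, clarify)
  fix k l
  have *: "complex_of_real (sqrt (1 + real k)) * (of_real (sqrt (1 + real k)) * z) = (1 + of_nat k) * z"
    "complex_of_real (sqrt (real k)) * (of_real (sqrt (real k)) * z) = of_nat k * z" for k z
    by (simp_all flip: of_real_mult mult.assoc)
  show "annihilate_snd (create_snd \<psi>) (k, l) = \<psi> (k, l) + create_snd (annihilate_snd \<psi>) (k, l)"
    using * by (cases l) (simp_all add: annihilate_snd_def create_snd_def algebra_simps)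
qed

lemma annihilate_snd_linear:
  "annihilate_snd (\<lambda>i. a * f i + b * g i) = (\<lambda>i. a * annihilate_snd f i + b * annihilate_snd g i)"
  by (auto simp: annihilate_snd_def fun_eq_iff algebra_simps)

lemma annihilate_snd_bs_create_fst:
  "annihilate_snd (bs_create_fst \<kappa> \<psi>) =
     (\<lambda>i. - of_real (sqrt (1 - \<kappa>)) * \<psi> i + bs_create_fst \<kappa> (annihilate_snd \<psi>) i)"
  using annihilate_snd_linear[of "of_real (sqrt \<kappa>)" "create_fst \<psi>" "- of_real (sqrt (1 - \<kappa>))" "create_snd \<psi>"]
  by (simp add: bs_create_fst_def annihilate_snd_create_fst annihilate_snd_create_snd algebra_simps)

lemma annihilate_snd_bs_create_snd:
  "annihilate_snd (bs_create_snd \<kappa> \<psi>) =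
     (\<lambda>i. of_real (sqrt \<kappa>) * \<psi> i + bs_create_snd \<kappa> (annihilate_snd \<psi>) i)"
  using annihilate_snd_linear[of "of_real (sqrt (1 - \<kappa>))" "create_fst \<psi>" "of_real (sqrt \<kappa>)" "create_snd \<psi>"]
  by (simp add: bs_create_snd_def annihilate_snd_create_fst annihilate_snd_create_snd algebra_simps)

lemma annihilate_snd_bs_create_snd_power:
  "annihilate_snd ((bs_create_snd \<kappa> ^^ m) vacuum) =
     (\<lambda>i. of_nat m * of_real (sqrt \<kappa>) * (bs_create_snd \<kappa> ^^ (m - 1)) vacuum i)"
proof (induction m)
  case 0
  show ?case by (auto simp: annihilate_snd_def vacuum_def)
next
  case (Suc m)
  show ?case
    unfolding funpow.simps o_apply annihilate_snd_bs_create_snd Suc.IH bs_create_linear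
    by (cases m) (auto simp: algebra_simps)
qed

lemma annihilate_snd_bs_create_power:
  "annihilate_snd ((bs_create_fst \<kappa> ^^ n) ((bs_create_snd \<kappa> ^^ m) vacuum)) =
     (\<lambda>i. - of_nat n * of_real (sqrt (1 - \<kappa>)) *
            (bs_create_fst \<kappa> ^^ (n - 1)) ((bs_create_snd \<kappa> ^^ m) vacuum) i +
          of_nat m * of_real (sqrt \<kappa>) *
            (bs_create_fst \<kappa> ^^ n) ((bs_create_snd \<kappa> ^^ (m - 1)) vacuum) i)"
proof (induction n)
  case 0
  show ?case by (simp add: annihilate_snd_bs_create_snd_power)
next
  case (Suc n)
  show ?case
    unfolding funpow.simps o_apply annihilate_snd_bs_create_fst Suc.IH bs_create_linear
    by (cases n) (auto simp: algebra_simps)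
qed

lemma of_nat_mult_divide_sqrt_fact:
  "of_nat j * z / complex_of_real (sqrt (fact j * r)) =
      of_real (sqrt (real j)) * (z / of_real (sqrt (fact (j - 1) * r)))"
proof (cases j)
  case (Suc i)
  have "complex_of_nat (Suc i) = of_real (sqrt (real (Suc i))) * of_real (sqrt (real (Suc i)))"
    by (simp flip: of_real_mult)
  moreover have "complex_of_real (sqrt (fact (Suc i) * r)) =
      of_real (sqrt (real (Suc i))) * of_real (sqrt (fact i * r))"
    by (simp add: real_sqrt_mult mult.assoc del: of_nat_Suc)
  ultimately show ?thesis
    using Suc by (simp add: field_simps del: of_nat_Suc)
qed simp

text \<open>The relation b U = U (- sqrt(1-\<kappa>) a + sqrt(\<kappa>) b) between <k,l| and |n,m>.
  At n = 0 or m = 0 the truncated subtraction is harmless, as the prefactor vanishes.\<close>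

lemma beam_splitter_second_output_mode:
  "of_real (sqrt (real (Suc l))) * beam_splitter \<kappa> (k, Suc l) (n, m) =
     - of_real (sqrt (1 - \<kappa>) * sqrt (real n)) * beam_splitter \<kappa> (k, l) (n - 1, m) +
     of_real (sqrt \<kappa> * sqrt (real m)) * beam_splitter \<kappa> (k, l) (n, m - 1)"
proof -
  define V where "V n m = (bs_create_fst \<kappa> ^^ n) ((bs_create_snd \<kappa> ^^ m) vacuum) (k, l)" for n m
  have "of_real (sqrt (real (Suc l))) * beam_splitter \<kappa> (k, Suc l) (n, m) =
      annihilate_snd ((bs_create_fst \<kappa> ^^ n) ((bs_create_snd \<kappa> ^^ m) vacuum)) (k, l) /
        of_real (sqrt (fact n * fact m))"
    by (simp add: annihilate_snd_def beam_splitter_def)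
  also have "\<dots> = - of_real (sqrt (1 - \<kappa>)) * (of_nat n * V (n - 1) m / of_real (sqrt (fact n * fact m))) +
      of_real (sqrt \<kappa>) * (of_nat m * V n (m - 1) / of_real (sqrt (fact m * fact n)))"
    unfolding annihilate_snd_bs_create_power V_def by (simp add: diff_divide_distrib mult_ac)
  finally show ?thesis
    unfolding of_nat_mult_divide_sqrt_fact by (simp add: beam_splitter_def V_def mult_ac)
qed

lemma bs_create_commute: "bs_create_fst \<kappa> (bs_create_snd \<kappa> \<psi>) = bs_create_snd \<kappa> (bs_create_fst \<kappa> \<psi>)"
proof (rule ext, clarify)
  fix k l
  show "bs_create_fst \<kappa> (bs_create_snd \<kappa> \<psi>) (k, l) = bs_create_snd \<kappa> (bs_create_fst \<kappa> \<psi>) (k, l)"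
    by (cases k; cases l)
      (simp_all add: bs_create_fst_def bs_create_snd_def create_fst_def create_snd_def algebra_simps
        del: of_nat_Suc)
qed

lemma bs_create_power_commute:
  "(bs_create_fst \<kappa> ^^ n) (bs_create_snd \<kappa> \<psi>) = bs_create_snd \<kappa> ((bs_create_fst \<kappa> ^^ n) \<psi>)"
  by (induction n) (simp_all add: bs_create_commute)

text \<open>The relation U adj(b) = (sqrt(1-\<kappa>) adj(a) + sqrt(\<kappa>) adj(b)) U between
  <l,s| and |n,a>. Its adjoint moves b from the inputs back to the outputs in the recursion for the
  channel.\<close>

lemma beam_splitter_second_input_creation:
  "of_real (sqrt (real (Suc a))) * beam_splitter \<kappa> (l, s) (n, Suc a) =
     of_real (sqrt (1 - \<kappa>) * sqrt (real l)) * beam_splitter \<kappa> (l - 1, s) (n, a) +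
     of_real (sqrt \<kappa> * sqrt (real s)) * beam_splitter \<kappa> (l, s - 1) (n, a)"
proof -
  define V where "V = (bs_create_fst \<kappa> ^^ n) ((bs_create_snd \<kappa> ^^ a) vacuum)"
  define c where "c = complex_of_real (sqrt (fact n * fact a))"
  have bs: "beam_splitter \<kappa> i (n, a) = V i / c" for i
    by (simp add: beam_splitter_def V_def c_def)
  have "complex_of_real (sqrt (fact n * fact (Suc a))) = of_real (sqrt (real (Suc a))) * c"
    by (simp add: c_def mult_ac flip: of_real_mult real_sqrt_mult)
  then have "of_real (sqrt (real (Suc a))) * beam_splitter \<kappa> (l, s) (n, Suc a) = bs_create_snd \<kappa> V (l, s) / c"
    by (simp add: beam_splitter_def V_def bs_create_power_commute del: of_nat_Suc fact_Suc)
  also have "\<dots> = of_real (sqrt (1 - \<kappa>) * sqrt (real l)) * (V (l - 1, s) / c) +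
     of_real (sqrt \<kappa> * sqrt (real s)) * (V (l, s - 1) / c)"
    by (simp add: bs_create_snd_def create_fst_def create_snd_def add_divide_distrib mult.assoc)
  finally show ?thesis
    by (simp add: bs)
qed

section \<open>Photon number conservation and the size of the matrix elements\<close>

lemma bs_create_support:
  "bs_create_fst \<kappa> \<psi> (k, s) \<noteq> 0 \<Longrightarrow> k > 0 \<and> \<psi> (k - 1, s) \<noteq> 0 \<or> s > 0 \<and> \<psi> (k, s - 1) \<noteq> 0"
  "bs_create_snd \<kappa> \<psi> (k, s) \<noteq> 0 \<Longrightarrow> k > 0 \<and> \<psi> (k - 1, s) \<noteq> 0 \<or> s > 0 \<and> \<psi> (k, s - 1) \<noteq> 0"
  by (auto simp: bs_create_fst_def bs_create_snd_def create_fst_def create_snd_def split: if_splits)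

text \<open>Both maps raise the total photon number by exactly one, starting from the
  vacuum.\<close>

lemma bs_create_power_support:
  assumes "(bs_create_fst \<kappa> ^^ n) ((bs_create_snd \<kappa> ^^ a) vacuum) (k, s) \<noteq> 0"
  shows "k + s = n + a"
proof -
  have 0: "(bs_create_snd \<kappa> ^^ a) vacuum (k, s) \<noteq> 0 \<Longrightarrow> k + s = a" for k s
  proof (induction a arbitrary: k s)
    case (Suc a)
    from Suc.prems have "bs_create_snd \<kappa> ((bs_create_snd \<kappa> ^^ a) vacuum) (k, s) \<noteq> 0"
      by simp
    from bs_create_support(2)[OF this] show ?case
      using Suc.IH[of "k - 1" s] Suc.IH[of k "s - 1"] by auto
  qed (simp add: vacuum_def split: if_splits)
  show ?thesis
    using assms
  proof (induction n arbitrary: k s)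
    case (Suc n)
    from Suc.prems have "bs_create_fst \<kappa> ((bs_create_fst \<kappa> ^^ n) ((bs_create_snd \<kappa> ^^ a) vacuum)) (k, s) \<noteq> 0"
      by simp
    from bs_create_support(1)[OF this] show ?case
      using Suc.IH[of "k - 1" s] Suc.IH[of k "s - 1"] by auto
  qed (simp add: 0)
qed

lemma beam_splitter_support: "k + s \<noteq> n + a \<Longrightarrow> beam_splitter \<kappa> (k, s) (n, a) = 0"
  using bs_create_power_support[where k = k and s = s and n = n and a = a and \<kappa> = \<kappa>] by (auto simp: beam_splitter_def)

text \<open>With no photon in the first output every factor has to act through its
  \<open>create_snd\<close> part, so a single path contributes; its squared modulus is a binomial
  probability.\<close>

lemma beam_splitter_vacuum_output:
  "beam_splitter \<kappa> (0, n + a) (n, a) =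
     (- of_real (sqrt (1 - \<kappa>))) ^ n * of_real (sqrt \<kappa>) ^ a * of_real (sqrt (real ((n + a) choose a)))"
proof -
  have 0: "(bs_create_snd \<kappa> ^^ a) vacuum (0, a) = of_real (sqrt \<kappa>) ^ a * of_real (sqrt (fact a))"
  proof (induction a)
    case (Suc a)
    then show ?case
      by (simp add: bs_create_snd_def create_fst_def create_snd_def real_sqrt_mult)
  qed (simp add: vacuum_def)
  have "(bs_create_fst \<kappa> ^^ n) ((bs_create_snd \<kappa> ^^ a) vacuum) (0, n + a) =
      (- of_real (sqrt (1 - \<kappa>))) ^ n * of_real (sqrt \<kappa>) ^ a * of_real (sqrt (fact (n + a)))"
  proof (induction n)
    case (Suc n)
    then show ?case
      by (simp add: bs_create_fst_def create_fst_def create_snd_def real_sqrt_mult)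
  qed (simp add: 0)
  moreover have "real ((n + a) choose a) = fact (n + a) / (fact n * fact a)"
    by (simp add: binomial_fact mult.commute)
  ultimately show ?thesis
    by (simp add: beam_splitter_def real_sqrt_divide of_real_divide)
qed

lemma binomial_term_le_one:
  assumes "0 \<le> p" "p \<le> (1::real)" "e \<le> m"
  shows "real (m choose e) * p ^ e * (1 - p) ^ (m - e) \<le> 1"
proof -
  have "real (m choose e) * p ^ e * (1 - p) ^ (m - e) \<le> (\<Sum>k\<le>m. real (m choose k) * p ^ k * (1 - p) ^ (m - k))"
    using assms by (intro member_le_sum[of e "{..m}"]) auto
  also have "\<dots> = 1"
    by (simp flip: binomial_ring)
  finally show ?thesis .
qed

text \<open>For fixed output number k this is polynomial in the number a of thermal photons, which
  is enough to lose against the geometric thermal weight. The base case is a binomial probability,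
  the step is the relation for the first output mode.\<close>

lemma cmod_beam_splitter_le:
  assumes "0 \<le> \<kappa>" "\<kappa> \<le> 1"
  shows "cmod (beam_splitter \<kappa> (k, s) (n, a)) \<le> (real n + real a) ^ k"
proof (induction k arbitrary: s n a)
  case 0
  have "cmod (beam_splitter \<kappa> (0, s) (n, a)) \<le> 1"
  proof (cases "s = n + a")
    case True
    have "cmod (beam_splitter \<kappa> (0, n + a) (n, a)) =
        sqrt (real ((n + a) choose a) * \<kappa> ^ a * (1 - \<kappa>) ^ ((n + a) - a))"
      using assms by (simp add: beam_splitter_vacuum_output norm_mult norm_power real_sqrt_mult real_sqrt_power)
    also have "\<dots> \<le> 1"
      using binomial_term_le_one[OF assms, of a "n + a"] by simp
    finally show ?thesis
      using True by simp
  qed (simp add: beam_splitter_support)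
  then show ?case
    by simp
next
  case (Suc k)
  have sqrt_le: "sqrt (real j) \<le> real j" for j
    by (cases j) (auto intro!: real_le_lsqrt simp: power2_eq_square)
  have "cmod (beam_splitter \<kappa> (Suc k, s) (n, a)) \<le> sqrt (real (Suc k)) * cmod (beam_splitter \<kappa> (Suc k, s) (n, a))"
    using mult_right_mono[of 1 "sqrt (real (Suc k))" "cmod (beam_splitter \<kappa> (Suc k, s) (n, a))"] by simp
  also have "\<dots> = cmod (of_real (sqrt \<kappa> * sqrt (real n)) * beam_splitter \<kappa> (k, s) (n - 1, a) +
     of_real (sqrt (1 - \<kappa>) * sqrt (real a)) * beam_splitter \<kappa> (k, s) (n, a - 1))"
    unfolding beam_splitter_output_mode[symmetric] by (simp add: norm_mult)
  also have "\<dots> \<le> real n * (real n + real a) ^ k + real a * (real n + real a) ^ k"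
  proof (rule norm_triangle_mono)
    have "sqrt \<kappa> * sqrt (real n) \<le> 1 * real n"
      using assms by (intro mult_mono sqrt_le) auto
    moreover have "cmod (beam_splitter \<kappa> (k, s) (n - 1, a)) \<le> (real n + real a) ^ k"
      by (rule order_trans[OF Suc.IH]) (intro power_mono; simp)
    ultimately show "cmod (of_real (sqrt \<kappa> * sqrt (real n)) * beam_splitter \<kappa> (k, s) (n - 1, a)) \<le>
        real n * (real n + real a) ^ k"
      using assms unfolding norm_mult norm_of_real by (intro mult_mono) auto
    have "sqrt (1 - \<kappa>) * sqrt (real a) \<le> 1 * real a"
      using assms by (intro mult_mono sqrt_le) auto
    moreover have "cmod (beam_splitter \<kappa> (k, s) (n, a - 1)) \<le> (real n + real a) ^ k"
      by (rule order_trans[OF Suc.IH]) (intro power_mono; simp)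
    ultimately show "cmod (of_real (sqrt (1 - \<kappa>) * sqrt (real a)) * beam_splitter \<kappa> (k, s) (n, a - 1)) \<le>
        real a * (real n + real a) ^ k"
      using assms unfolding norm_mult norm_of_real by (intro mult_mono) auto
  qed
  finally show ?case
    by (simp add: algebra_simps)
qed

lemma negative_binomial_sums:
  assumes "0 \<le> x" "x < (1::real)"
  shows "(\<lambda>a. real ((m + a) choose a) * x ^ a) sums (1 / (1 - x) ^ Suc m)"
proof -
  have "(\<lambda>a. (- real (Suc m) gchoose a) * (- x) ^ a) sums (1 + - x) powr (- real (Suc m))"
    using assms by (intro gen_binomial_real) simp
  moreover have "(- real (Suc m) gchoose a) * (- x) ^ a = real ((m + a) choose a) * x ^ a" for a
  proof -
    have "- real (Suc m) gchoose a = (-1) ^ a * (real (m + a) gchoose a)"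
      by (subst gbinomial_minus) (simp add: add.commute)
    moreover have "(-1) ^ a * (- x) ^ a = x ^ a"
      by (simp flip: power_mult_distrib)
    ultimately show ?thesis
      by (simp add: binomial_gbinomial mult_ac)
  qed
  moreover have "(1 + - x) powr (- real (Suc m)) = 1 / (1 - x) ^ Suc m"
    using assms by (simp add: powr_minus powr_realpow[symmetric] divide_inverse del: of_nat_Suc power_Suc)
  ultimately show ?thesis
    by simp
qed

subsection \<open>Matrix elements of the thermal loss channel\<close>

lemma has_sum_diff:
  fixes f g :: "'a \<Rightarrow> 'b::real_normed_vector"
  assumes "(f has_sum a) A" "(g has_sum b) A"
  shows "((\<lambda>x. f x - g x) has_sum (a - b)) A"
  using has_sum_add[OF assms(1), of "\<lambda>x. - g x" "- b"] assms(2) by (simp add: has_sum_uminus)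

text \<open>The right side is (a + 1) (a + 2) ... (a + K). Polynomial times geometric weights are
  thereby dominated by the negative binomial series.\<close>

lemma power_le_fact_binomial: "(real a + 1) ^ K \<le> fact K * real ((K + a) choose a)"
proof (induction K)
  case (Suc K)
  have "Suc K * ((Suc K + a) choose Suc K) = (Suc K + a) * ((K + a) choose K)"
    using Suc_times_binomial_eq[of "K + a" K] by (simp add: mult.commute)
  moreover have "(K + a) choose K = (K + a) choose a" "(Suc K + a) choose Suc K = (Suc K + a) choose a"
    using binomial_symmetric[of K "K + a"] binomial_symmetric[of "Suc K" "Suc K + a"] by simp_all
  ultimately have "real (Suc K) * real ((Suc K + a) choose a) = real (Suc K + a) * real ((K + a) choose a)"
    by (metis of_nat_mult)
  then have "fact (Suc K) * real ((Suc K + a) choose a) = real (Suc K + a) * (fact K * real ((K + a) choose a))"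
    by (simp add: mult_ac del: of_nat_Suc of_nat_add binomial_Suc_Suc add_Suc)
  also have "\<dots> \<ge> (real a + 1) * (real a + 1) ^ K"
    using Suc by (intro mult_mono) auto
  finally show ?case
    by simp
qed simp

lemma summable_power_geometric:
  assumes "0 \<le> q" "q < (1::real)"
  shows "summable (\<lambda>a. (real a + 1) ^ K * q ^ a)"
proof (rule summable_comparison_test')
  show "summable (\<lambda>a. fact K * (real ((K + a) choose a) * q ^ a))"
    using negative_binomial_sums[OF assms] by (intro summable_mult) (rule sums_summable)
  show "norm ((real a + 1) ^ K * q ^ a) \<le> fact K * (real ((K + a) choose a) * q ^ a)" if "0 \<le> a" for a
    using mult_right_mono[OF power_le_fact_binomial, of "q ^ a" a K] assms by (simp add: mult.assoc)
qed

text \<open>\<open>a\<close> counts the thermal photons, with weight (1 - q) q^a for q = N / (N +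
  1), and \<open>s\<close> the photons in the discarded output.\<close>

definition loss_term :: "real \<Rightarrow> real \<Rightarrow> nat \<Rightarrow> nat \<Rightarrow> nat \<Rightarrow> nat \<Rightarrow> nat \<times> nat \<Rightarrow> complex" where
  "loss_term \<kappa> q k l m n = (\<lambda>(s, a). of_real ((1 - q) * q ^ a) *
     (beam_splitter \<kappa> (k, s) (m, a) * cnj (beam_splitter \<kappa> (l, s) (n, a))))"

text \<open>Photon conservation leaves at most one s for each a, and the two amplitudes together
  grow at most like a polynomial in a of degree k + l, against q^a.\<close>

lemma loss_term_summable:
  assumes "0 \<le> \<kappa>" "\<kappa> \<le> 1" "0 \<le> q" "q < 1"
  shows "loss_term \<kappa> q k l m n summable_on UNIV"
proof -
  define c where "c = real m + real n + 1"
  have c: "1 \<le> c"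
    by (simp add: c_def)
  define b where "b a = (c * (real a + 1)) ^ (k + l) * q ^ a" for a
  have "(\<lambda>a. c ^ (k + l) * ((real a + 1) ^ (k + l) * q ^ a)) summable_on UNIV"
    using summable_power_geometric[OF assms(3,4), of "k + l"] assms(3)
    by (intro summable_on_cmult_right) (simp add: summable_on_UNIV_nonneg_real_iff)
  then have b: "b summable_on UNIV"
    by (simp add: b_def[abs_def] power_mult_distrib mult_ac)
  have bound: "norm (loss_term \<kappa> q k l m n (s, a)) \<le> (if k + s = m + a then b a else 0)" for s a
  proof (cases "k + s = m + a")
    case True
    have le: "(real j + real a) \<le> c * (real a + 1)" if "real j \<le> c - 1" for j
    proof -
      have "real a * 1 \<le> real a * c"
        using c by (intro mult_left_mono) auto
      then show ?thesis
        using that by (simp add: algebra_simps)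
    qed
    have le': "cmod (beam_splitter \<kappa> (k, s) (j, a)) \<le> (c * (real a + 1)) ^ k" if "real j \<le> c - 1" for j k
      using assms le[OF that] by (intro order_trans[OF cmod_beam_splitter_le] power_mono) auto
    have h1: "cmod (beam_splitter \<kappa> (k, s) (m, a)) * cmod (beam_splitter \<kappa> (l, s) (n, a)) \<le>
        (c * (real a + 1)) ^ k * (c * (real a + 1)) ^ l"
      using c by (intro mult_mono le') (auto simp: c_def)
    have h2: "(1 - q) * q ^ a \<le> 1 * q ^ a"
      using assms by (intro mult_right_mono) auto
    have "((1 - q) * q ^ a) * (cmod (beam_splitter \<kappa> (k, s) (m, a)) * cmod (beam_splitter \<kappa> (l, s) (n, a)))
        \<le> (1 * q ^ a) * ((c * (real a + 1)) ^ k * (c * (real a + 1)) ^ l)"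
      using assms by (intro mult_mono[OF h2 h1]) auto
    moreover have "cmod (of_real ((1 - q) * q ^ a)) = (1 - q) * q ^ a"
      using assms unfolding norm_of_real by simp
    ultimately show ?thesis
      using True unfolding loss_term_def prod.case norm_mult by (simp add: norm_mult norm_power b_def power_add mult_ac)
  qed (simp add: loss_term_def beam_splitter_support)
  have "(\<lambda>(a, s). if k + s = m + a then b a else 0) summable_on UNIV \<times> UNIV"
  proof (rule summable_on_SigmaI)
    fix a
    have "((\<lambda>s. if k + s = m + a then b a else 0) has_sum (if k \<le> m + a then b a else 0)) UNIV"
      by (rule has_sum_finite_neutralI[of "{m + a - k}"]) auto
    then show "((\<lambda>s. case (a, s) of (a, s) \<Rightarrow> if k + s = m + a then b a else 0) has_sum
        (if k \<le> m + a then b a else 0)) UNIV"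
      by simp
  next
    show "(\<lambda>a. if k \<le> m + a then b a else 0) summable_on UNIV"
      using b by (rule summable_on_comparison_test) (use c assms in \<open>auto simp: b_def\<close>)
  qed (use c assms in \<open>auto simp: b_def\<close>)
  then have "(\<lambda>(s, a). if k + s = m + a then b a else 0) summable_on UNIV"
    by (subst (asm) summable_on_swap) simp
  then have "(\<lambda>i. norm (loss_term \<kappa> q k l m n i)) summable_on UNIV"
    by (rule summable_on_comparison_test) (use bound in \<open>auto split: prod.splits\<close>)
  then show ?thesis
    by (rule abs_summable_summable)
qed

lemma has_sum_loss_term:
  assumes "0 \<le> \<kappa>" "\<kappa> \<le> 1" "0 \<le> N"
  shows "(loss_term \<kappa> (N / (N + 1)) k l m n has_sum thermal_loss \<kappa> N (matrix_unit m n) k l) UNIV"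
proof -
  define q where "q = N / (N + 1)"
  have q: "0 \<le> q" "q < 1"
    using assms by (simp_all add: q_def)
  define T where "T a = complex_of_real ((1 - q) * q ^ a)" for a
  have th: "thermal_state N b a = (if b = a then T a else 0)" for a b
  proof -
    have "1 - q = 1 / (N + 1)"
      using assms by (simp add: q_def field_simps)
    then have "(1 - q) * q ^ a = N ^ a / (N + 1) ^ (a + 1)"
      by (simp add: q_def power_divide)
    then show ?thesis
      by (simp add: thermal_state_def T_def)
  qed
  define U where "U = beam_splitter \<kappa>"
  define V where "V = op_mult U (op_tensor (matrix_unit m n) (thermal_state N))"
  have V: "V i (n', a) = (if n' = n then U i (m, a) * T a else 0)" for i n' a
    unfolding V_def op_mult_def
    by (intro infsumI has_sum_finite_neutralI[of "{(m, a)}"])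
      (auto simp: op_tensor_def matrix_unit_def th split: if_splits)
  have W: "op_mult V (op_adj U) (k, s) (l, s) = (\<Sum>\<^sub>\<infinity>a. loss_term \<kappa> q k l m n (s, a))" for s
  proof -
    \<comment> \<open>The matrix unit admits only n photons in the signal input, which collapses the
      sum over intermediate pairs to one over a.\<close>
    have "op_mult V (op_adj U) (k, s) (l, s) = (\<Sum>\<^sub>\<infinity>j\<in>range (Pair n). V (k, s) j * op_adj U j (l, s))"
      unfolding op_mult_def by (rule infsum_cong_neutral) (auto simp: V)
    also have "\<dots> = (\<Sum>\<^sub>\<infinity>a. V (k, s) (n, a) * op_adj U (n, a) (l, s))"
      by (subst infsum_reindex) (auto simp: inj_on_def o_def)
    finally show ?thesis
      by (simp add: V loss_term_def op_adj_def U_def T_def mult_ac)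
  qed
  have "thermal_loss \<kappa> N (matrix_unit m n) k l = (\<Sum>\<^sub>\<infinity>s. \<Sum>\<^sub>\<infinity>a. loss_term \<kappa> q k l m n (s, a))"
    by (simp add: thermal_loss_def trace_snd_def Let_def W flip: U_def V_def)
  also have "\<dots> = infsum (loss_term \<kappa> q k l m n) UNIV"
    using infsum_Sigma_banach[of "loss_term \<kappa> q k l m n" UNIV "\<lambda>_. UNIV"]
      loss_term_summable[OF assms(1,2) q] by simp
  finally show ?thesis
    using loss_term_summable[OF assms(1,2) q, of k l m n] by (simp add: q_def)
qed

lemma thermal_loss_hermitian:
  assumes "0 \<le> \<kappa>" "\<kappa> \<le> 1" "0 \<le> N"
  shows "thermal_loss \<kappa> N (matrix_unit n m) l k = cnj (thermal_loss \<kappa> N (matrix_unit m n) k l)"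
proof -
  have "loss_term \<kappa> q l k n m = (\<lambda>i. cnj (loss_term \<kappa> q k l m n i))" for q
    by (auto simp: loss_term_def fun_eq_iff mult_ac)
  then show ?thesis
    using has_sum_loss_term[OF assms, of l k n m] has_sum_loss_term[OF assms, of k l m n]
    by (metis has_sum_cnj_iff has_sum_unique)
qed

text \<open>
  In operator form, \<open>a \<Lambda>(\<rho>) = t \<Lambda>(\<rho>) a + \<surd>\<kappa> (1 - t) \<Lambda>(a \<rho>)\<close> for the channel \<open>\<Lambda>\<close>: express \<open>a\<close>
  through the input modes, commute the environment mode \<open>b\<close> past the thermal state, which
  produces the factor \<open>q\<close>, and then return to the output modes.
\<close>

lemma thermal_loss_recursion:
  assumes "0 \<le> \<kappa>" "\<kappa> < 1" "0 \<le> N"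
  defines "f \<equiv> \<lambda>k l m n. thermal_loss \<kappa> N (matrix_unit m n) k l"
  shows "of_real (sqrt (real (Suc k))) * f (Suc k) l m n =
    of_real ((1 - \<kappa>) * N / ((1 - \<kappa>) * N + 1) * sqrt (real l)) * f k (l - 1) m n +
    of_real (sqrt \<kappa> / ((1 - \<kappa>) * N + 1) * sqrt (real m)) * f k l (m - 1) n"
proof -
  define q where "q = N / (N + 1)"
  define U where "U k s m a = beam_splitter \<kappa> (k, s) (m, a)" for k s m a
  define th where "th a = complex_of_real ((1 - q) * q ^ a)" for a
  define r where "r = complex_of_real (sqrt \<kappa>)"
  define r' where "r' = complex_of_real (sqrt (1 - \<kappa>))"
  define rt where "rt j = complex_of_real (sqrt (real j))" for j
  define T where "T k l m n = (\<lambda>(s, a). th a * (U k s m a * cnj (U l s n a)))" for k l m n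
  have T: "(T k l m n has_sum f k l m n) UNIV" for k l m n
    using has_sum_loss_term[of \<kappa> N k l m n] assms
    by (simp add: T_def f_def loss_term_def U_def th_def q_def)
  have r'_nz: "r' \<noteq> 0"
    using assms by (simp add: r'_def)
  have real: "cnj r = r" "cnj r' = r'" "cnj (rt j) = rt j" for j
    by (simp_all add: r_def r'_def rt_def)
  have U1: "rt (Suc k) * U (Suc k) s m a = r * rt m * U k s (m - 1) a + r' * rt a * U k s m (a - 1)" for k s m a
    using beam_splitter_output_mode[of k \<kappa> s m a] by (simp add: U_def r_def r'_def rt_def)
  have U2: "rt (Suc s) * U k (Suc s) m a = - r' * rt m * U k s (m - 1) a + r * rt a * U k s m (a - 1)" for k s m a
    using beam_splitter_second_output_mode[of s \<kappa> k m a] by (simp add: U_def r_def r'_def rt_def)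
  have U3: "rt (Suc a) * U l s n (Suc a) = r' * rt l * U (l - 1) s n a + r * rt s * U l (s - 1) n a" for a l s n
    using beam_splitter_second_input_creation[of a \<kappa> l s n] by (simp add: U_def r_def r'_def rt_def)
  \<comment> \<open>\<open>Z\<close> is the (k, l) entry of U b (|m><n| (x) th) U^-1 after tracing
    out the second output; it is isolated from \<open>U1\<close> by dividing by r', which \<kappa> <
    1 makes possible.\<close>
  define z where "z = (\<lambda>(s, a). th a * rt a * U k s m (a - 1) * cnj (U l s n a))"
  define Z where "Z = (rt (Suc k) * f (Suc k) l m n - r * rt m * f k l (m - 1) n) / r'"
  have z: "(z has_sum Z) UNIV"
  proof -
    have "((\<lambda>i. (rt (Suc k) * T (Suc k) l m n i - r * rt m * T k l (m - 1) n i) / r') has_sum Z) UNIV"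
      unfolding Z_def by (intro has_sum_divide_const has_sum_diff has_sum_cmult_right T)
    moreover have "(rt (Suc k) * T (Suc k) l m n i - r * rt m * T k l (m - 1) n i) / r' = z i" for i
    proof (cases i)
      case (Pair s a)
      have "rt (Suc k) * T (Suc k) l m n (s, a) = th a * cnj (U l s n a) * (rt (Suc k) * U (Suc k) s m a)"
        by (simp add: T_def mult_ac)
      then show ?thesis
        unfolding U1 using r'_nz by (simp add: Pair T_def z_def field_simps)
    qed
    ultimately show ?thesis
      by simp
  qed
  \<comment> \<open>\<open>Y\<close> has the second output mode acting on the right factor. The
    shift of s by one in its sum is the cyclicity of the partial trace, which moves that mode to the
    left factor, where \<open>U2\<close> applies.\<close>
  define y where "y = (\<lambda>(s, a). th a * rt s * U k s m a * cnj (U l (s - 1) n a))"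
  define Y where "Y = - r' * rt m * f k l (m - 1) n + r * Z"
  have y: "(y has_sum Y) UNIV"
  proof -
    have "((\<lambda>i. - r' * rt m * T k l (m - 1) n i + r * z i) has_sum Y) UNIV"
      unfolding Y_def by (intro has_sum_add has_sum_cmult_right T z)
    moreover have "- r' * rt m * T k l (m - 1) n i + r * z i = y (map_prod Suc id i)" for i
    proof (cases i)
      case (Pair s a)
      have "y (map_prod Suc id (s, a)) = th a * cnj (U l s n a) * (rt (Suc s) * U k (Suc s) m a)"
        by (simp add: y_def mult_ac)
      then show ?thesis
        unfolding U2 by (simp add: Pair T_def z_def algebra_simps)
    qed
    ultimately have "((\<lambda>i. y (map_prod Suc id i)) has_sum Y) UNIV"
      by simp
    moreover have "inj (map_prod Suc (id :: nat \<Rightarrow> nat))"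
      by (auto simp: inj_def)
    ultimately have "(y has_sum Y) (range (map_prod Suc (id :: nat \<Rightarrow> nat)))"
      by (simp add: has_sum_reindex o_def)
    moreover have "y i = 0" if "i \<notin> range (map_prod Suc (id :: nat \<Rightarrow> nat))" for i
    proof (cases i)
      case (Pair s a)
      then have "s = 0"
        using that by (cases s) (auto simp: image_iff)
      then show ?thesis
        by (simp add: Pair y_def rt_def)
    qed
    ultimately show ?thesis
      by (subst has_sum_cong_neutral[where T = "range (map_prod Suc (id :: nat \<Rightarrow> nat))" and g = y]) auto
  qed
  \<comment> \<open>The shift of a by one expresses b th = q th b; the conjugate of
    \<open>U3\<close> then returns to the output modes. This is a second equation between
    \<open>Z\<close> and \<open>Y\<close>.\<close>
  have Z: "Z = of_real q * (r' * rt l * f k (l - 1) m n + r * Y)"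
  proof -
    have "((\<lambda>i. of_real q * (r' * rt l * T k (l - 1) m n i + r * y i)) has_sum
        of_real q * (r' * rt l * f k (l - 1) m n + r * Y)) UNIV"
      by (intro has_sum_add has_sum_cmult_right T y)
    moreover have "of_real q * (r' * rt l * T k (l - 1) m n i + r * y i) = z (map_prod id Suc i)" for i
    proof (cases i)
      case (Pair s a)
      have "z (map_prod id Suc (s, a)) = of_real q * (th a * U k s m a * cnj (rt (Suc a) * U l s n (Suc a)))"
        by (simp add: z_def th_def real)
      then show ?thesis
        unfolding U3 by (simp add: Pair T_def y_def real algebra_simps)
    qed
    ultimately have "((\<lambda>i. z (map_prod id Suc i)) has_sum
        of_real q * (r' * rt l * f k (l - 1) m n + r * Y)) UNIV"
      by simp
    moreover have "inj (map_prod (id :: nat \<Rightarrow> nat) Suc)"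
      by (auto simp: inj_def)
    ultimately have "(z has_sum of_real q * (r' * rt l * f k (l - 1) m n + r * Y))
        (range (map_prod (id :: nat \<Rightarrow> nat) Suc))"
      by (simp add: has_sum_reindex o_def)
    moreover have "z i = 0" if "i \<notin> range (map_prod (id :: nat \<Rightarrow> nat) Suc)" for i
    proof (cases i)
      case (Pair s a)
      then have "a = 0"
        using that by (cases a) (auto simp: image_iff)
      then show ?thesis
        by (simp add: Pair z_def rt_def)
    qed
    ultimately have "(z has_sum of_real q * (r' * rt l * f k (l - 1) m n + r * Y)) UNIV"
      by (subst has_sum_cong_neutral[where T = "range (map_prod (id :: nat \<Rightarrow> nat) Suc)" and g = z]) auto
    with z show ?thesis
      by (rule has_sum_unique)
  qed
  have rr: "r * r = of_real \<kappa>" "r' * r' = of_real (1 - \<kappa>)"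
    using assms by (simp_all add: r_def r'_def flip: of_real_mult)
  \<comment> \<open>Elimination of \<open>Y\<close> and \<open>Z\<close>: multiplying by r' leaves
    only the squares r r = \<kappa> and r' r' = 1 - \<kappa>, so the equation for \<open>A\<close>
    has real coefficients up to one factor r.\<close>
  define A where "A = rt (Suc k) * f (Suc k) l m n"
  define B where "B = rt m * f k l (m - 1) n"
  define C where "C = rt l * f k (l - 1) m n"
  have "r' * Z = A - r * B"
    using r'_nz by (simp add: Z_def A_def B_def mult.assoc)
  have "r' * Z = r' * (of_real q * (r' * C + r * Y))"
    unfolding C_def mult.assoc[symmetric] using Z by (simp add: mult.assoc)
  also have "\<dots> = of_real q * (r' * r' * C - r * (r' * r') * B + r * r * (r' * Z))"
    by (simp add: Y_def B_def algebra_simps)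
  finally have 1: "A - r * B = of_real q * (r' * r' * C - r * (r' * r') * B + r * r * (A - r * B))"
    unfolding \<open>r' * Z = A - r * B\<close> .
  have "A = of_real ((1 - \<kappa>) * N / ((1 - \<kappa>) * N + 1)) * C + of_real (1 / ((1 - \<kappa>) * N + 1)) * r * B"
  proof -
    define G where "G = (1 - \<kappa>) * N + 1"
    have G: "0 < G"
      using assms by (simp add: G_def add_nonneg_pos)
    have qG: "1 - \<kappa> * q = G / (N + 1)" "q * (1 - \<kappa>) = (G - 1) / (N + 1)" "1 - q = 1 / (N + 1)"
      using assms by (simp_all add: q_def G_def field_simps)
    have "of_real (1 - \<kappa> * q) * A = of_real (q * (1 - \<kappa>)) * C + of_real (1 - q) * (r * B)"
      using 1 unfolding rr by (simp add: algebra_simps)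
    then have "of_real G * A = of_real (G - 1) * C + r * B"
    proof -
      have "complex_of_real (N + 1) \<noteq> 0"
        using assms unfolding of_real_eq_0_iff by simp
      moreover assume "of_real (1 - \<kappa> * q) * A = of_real (q * (1 - \<kappa>)) * C + of_real (1 - q) * (r * B)"
      ultimately show ?thesis
        unfolding qG of_real_divide by (simp add: field_simps del: of_real_add)
    qed
    then have "A = of_real ((G - 1) / G) * C + of_real (1 / G) * r * B"
      using G by (simp add: field_simps)
    then show ?thesis
      by (simp add: G_def)
  qed
  then show ?thesis
    by (simp add: A_def B_def C_def rt_def r_def mult.assoc)
qed

text \<open>An empty output forces all n + a photons into the discarded one, hence s = n + a and m =
  n; the remaining sum over a is the negative binomial series in \<kappa> q.\<close>

lemma thermal_loss_vacuum_output:
  assumes "0 \<le> \<kappa>" "\<kappa> < 1" "0 \<le> N"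
  shows "thermal_loss \<kappa> N (matrix_unit m n) 0 0 =
    (if m = n then of_real ((1 - \<kappa> / ((1 - \<kappa>) * N + 1)) ^ m / ((1 - \<kappa>) * N + 1)) else 0)"
proof -
  define q where "q = N / (N + 1)"
  have q: "0 \<le> q" "q < 1"
    using assms by (simp_all add: q_def)
  define G where "G = (1 - \<kappa>) * N + 1"
  have G: "0 < G"
    using assms by (simp add: G_def add_nonneg_pos)
  have sum: "(loss_term \<kappa> q 0 0 m n has_sum thermal_loss \<kappa> N (matrix_unit m n) 0 0) UNIV"
    using has_sum_loss_term[of \<kappa> N] assms by (simp add: q_def)
  show ?thesis
  proof (cases "m = n")
    case False
    then have "loss_term \<kappa> q 0 0 m n i = 0" for i
      using beam_splitter_support[of 0 "fst i" m "snd i" \<kappa>] beam_splitter_support[of 0 "fst i" n "snd i" \<kappa>]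
      by (cases "fst i = m + snd i") (auto simp: loss_term_def case_prod_unfold)
    then have "(loss_term \<kappa> q 0 0 m n has_sum 0) UNIV"
      by (intro has_sum_0) auto
    then show ?thesis
      using sum False has_sum_unique by fastforce
  next
    case True
    define h where "h a = (n + a, a)" for a
    have inj: "inj h"
      by (simp add: h_def inj_def)
    have 0: "loss_term \<kappa> q 0 0 n n i = 0" if "i \<notin> range h" for i
    proof (cases i)
      case (Pair s a)
      then have "s \<noteq> n + a"
        using that by (auto simp: h_def)
      then show ?thesis
        by (simp add: Pair loss_term_def beam_splitter_support)
    qed
    have "(loss_term \<kappa> q 0 0 n n has_sum thermal_loss \<kappa> N (matrix_unit m n) 0 0) (range h)"
      using sum 0 True
      by (subst has_sum_cong_neutral[where T = UNIV and g = "loss_term \<kappa> q 0 0 n n"]) auto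
    then have "((\<lambda>a. loss_term \<kappa> q 0 0 n n (h a)) has_sum thermal_loss \<kappa> N (matrix_unit m n) 0 0) UNIV"
      using has_sum_reindex[OF inj, of "loss_term \<kappa> q 0 0 n n"] by (simp add: o_def)
    moreover have "loss_term \<kappa> q 0 0 n n (h a) =
        of_real ((1 - q) * (1 - \<kappa>) ^ n * (real ((n + a) choose a) * (\<kappa> * q) ^ a))" for a
    proof -
      have "beam_splitter \<kappa> (0, n + a) (n, a) * cnj (beam_splitter \<kappa> (0, n + a) (n, a)) =
          of_real ((cmod (beam_splitter \<kappa> (0, n + a) (n, a)))\<^sup>2)"
        by (simp only: complex_norm_square)
      also have "(cmod (beam_splitter \<kappa> (0, n + a) (n, a)))\<^sup>2 = (1 - \<kappa>) ^ n * \<kappa> ^ a * real ((n + a) choose a)"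
        using assms unfolding beam_splitter_vacuum_output
        by (simp add: norm_mult norm_power power_mult_distrib flip: power_mult)
          (simp add: mult.commute[of _ 2] power_mult)
      finally show ?thesis
        unfolding loss_term_def h_def by (simp add: power_mult_distrib mult_ac)
    qed
    ultimately have "((\<lambda>a. complex_of_real ((1 - q) * (1 - \<kappa>) ^ n * (real ((n + a) choose a) * (\<kappa> * q) ^ a)))
        has_sum thermal_loss \<kappa> N (matrix_unit m n) 0 0) UNIV"
      by simp
    moreover have "((\<lambda>a. complex_of_real ((1 - q) * (1 - \<kappa>) ^ n * (real ((n + a) choose a) * (\<kappa> * q) ^ a)))
        has_sum of_real ((1 - q) * (1 - \<kappa>) ^ n * (1 / (1 - \<kappa> * q) ^ Suc n))) UNIV"
    proof -
      have "\<kappa> * q < 1"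
        using mult_strict_mono'[of \<kappa> 1 q 1] assms q by simp
      moreover have "0 \<le> \<kappa> * q"
        using assms q by simp
      ultimately have "((\<lambda>a. real ((n + a) choose a) * (\<kappa> * q) ^ a) has_sum (1 / (1 - \<kappa> * q) ^ Suc n)) UNIV"
        by (intro sums_nonneg_imp_has_sum negative_binomial_sums) auto
      then show ?thesis
        by (intro has_sum_of_real has_sum_cmult_right)
    qed
    ultimately have "thermal_loss \<kappa> N (matrix_unit m n) 0 0 =
        of_real ((1 - q) * (1 - \<kappa>) ^ n * (1 / (1 - \<kappa> * q) ^ Suc n))"
      by (rule has_sum_unique)
    also have "(1 - q) * (1 - \<kappa>) ^ n * (1 / (1 - \<kappa> * q) ^ Suc n) = (1 - \<kappa> / G) ^ n / G"
    proof -
      have "1 - \<kappa> * q = G / (N + 1)" "1 - q = 1 / (N + 1)" "1 - \<kappa> / G = (1 - \<kappa>) * ((N + 1) / G)"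
        using assms G by (simp_all add: q_def field_simps) (simp_all add: G_def algebra_simps)
      then show ?thesis
        using G assms by (simp add: power_divide power_mult_distrib)
    qed
    finally show ?thesis
      using True by (simp add: G_def)
  qed
qed

subsection \<open>Loss followed by amplification\<close>

text \<open>
  A Kraus representation of the pure loss channel of transmissivity \<open>h\<close> (losing \<open>e\<close> photons)
  followed by the quantum-limited amplifier of gain \<open>1 / (1 - t)\<close> (adding \<open>b\<close> photons).
\<close>

definition loss_amp_weight :: "real \<Rightarrow> real \<Rightarrow> nat \<Rightarrow> nat \<Rightarrow> nat \<Rightarrow> nat \<Rightarrow> real" where
  "loss_amp_weight h t k m e b = (if e \<le> m \<and> b \<le> k \<and> k + e = m + b
     then (real (m choose e) * h ^ (m - e) * (1 - h) ^ e) * (real (k choose b) * t ^ b * (1 - t) ^ Suc (m - e))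
     else 0)"

definition loss_amp_kraus :: "real \<Rightarrow> real \<Rightarrow> nat \<Rightarrow> nat \<Rightarrow> nat \<Rightarrow> nat \<Rightarrow> real" where
  "loss_amp_kraus h t k m e b = sqrt (loss_amp_weight h t k m e b)"

text \<open>The element <k| . |l> of the image of |m><n| under the channel with these Kraus
  operators; the environment numbers are shared by both factors.\<close>

definition loss_amp :: "real \<Rightarrow> real \<Rightarrow> nat \<Rightarrow> nat \<Rightarrow> nat \<Rightarrow> nat \<Rightarrow> real" where
  "loss_amp h t k l m n = (\<Sum>\<^sub>\<infinity>(e, b). loss_amp_kraus h t k m e b * loss_amp_kraus h t l n e b)"

lemma loss_amp_kraus_support:
  "\<not> (e \<le> m \<and> b \<le> k \<and> k + e = m + b) \<Longrightarrow> loss_amp_kraus h t k m e b = 0"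
  unfolding loss_amp_kraus_def loss_amp_weight_def by auto

lemma has_sum_loss_amp:
  "((\<lambda>(e, b). loss_amp_kraus h t k m e b * loss_amp_kraus h t l n e b) has_sum loss_amp h t k l m n) UNIV"
proof -
  have "(\<lambda>(e, b). loss_amp_kraus h t k m e b * loss_amp_kraus h t l n e b) summable_on UNIV"
  proof (rule finite_nonzero_values_imp_summable_on)
    show "finite {i \<in> UNIV. (case i of (e, b) \<Rightarrow> loss_amp_kraus h t k m e b * loss_amp_kraus h t l n e b) \<noteq> 0}"
      by (rule finite_subset[of _ "{..m} \<times> {..k}"]) (use loss_amp_kraus_support in fastforce)+
  qed
  then show ?thesis
    by (simp add: loss_amp_def)
qed

lemma loss_amp_commute: "loss_amp h t k l m n = loss_amp h t l k n m"
  by (simp add: loss_amp_def mult.commute)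

lemma sqrt_mult_cancel: "0 \<le> (x::real) \<Longrightarrow> sqrt x * (sqrt x * y) = x * y"
  by (simp flip: mult.assoc)

text \<open>For the isometry V with components K_(e,b) this says a V = sqrt(h (1-t)) V a + sqrt(t)
  adj(b) V. With j = m - e surviving photons and k + 1 = j + b, the two terms on the right are the
  fractions j / (k + 1) and b / (k + 1) of the left side.\<close>

lemma kraus_annihilate:
  assumes "0 \<le> h" "h \<le> 1" "0 \<le> t" "t < 1"
  shows "sqrt (real (Suc k)) * loss_amp_kraus h t (Suc k) m e b =
    sqrt (h * (1 - t)) * sqrt (real m) * loss_amp_kraus h t k (m - 1) e b +
    sqrt t * sqrt (real b) * loss_amp_kraus h t k m e (b - 1)"
proof (cases "e \<le> m \<and> b \<le> Suc k \<and> Suc k + e = m + b")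
  case False
  have "loss_amp_kraus h t k (m - 1) e b = 0" if "m \<noteq> 0"
    by (rule loss_amp_kraus_support) (use False that in auto)
  moreover have "loss_amp_kraus h t k m e (b - 1) = 0" if "b \<noteq> 0"
    by (rule loss_amp_kraus_support) (use False that in auto)
  moreover have "loss_amp_kraus h t (Suc k) m e b = 0"
    using False by (rule loss_amp_kraus_support)
  ultimately show ?thesis
    by (cases "m = 0"; cases "b = 0") auto
next
  case True
  define j where "j = m - e"
  have m: "m = e + j" and k: "Suc k = j + b"
    using True by (auto simp: j_def)
  define W where "W = loss_amp_weight h t (Suc k) m e b"
  have W: "W = (real (m choose e) * h ^ j * (1 - h) ^ e) * (real (Suc k choose b) * t ^ b * (1 - t) ^ Suc j)"
    using True by (simp add: W_def loss_amp_weight_def m)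
  have W_nonneg: "0 \<le> W"
    using assms unfolding W by (intro mult_nonneg_nonneg zero_le_power) auto
  have 1: "sqrt (h * (1 - t)) * sqrt (real m) * loss_amp_kraus h t k (m - 1) e b = real j / sqrt (real (Suc k)) * sqrt W"
  proof (cases j)
    case 0
    then show ?thesis
      using m loss_amp_kraus_support[of e "m - 1" b k h t] by (cases "m = 0") auto
  next
    case (Suc i)
    have m': "m - 1 = e + i" "m = Suc (e + i)" and k': "k = i + b"
      using m k Suc by auto
    have ch1: "real m * real ((e + i) choose e) = real j * real (m choose e)"
    proof -
      have "Suc (e + i) * ((e + i) choose i) = (Suc (e + i) choose Suc i) * Suc i"
        by (rule Suc_times_binomial_eq)
      moreover have "(e + i) choose i = (e + i) choose e" "Suc (e + i) choose Suc i = Suc (e + i) choose e"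
        using binomial_symmetric[of i "e + i"] binomial_symmetric[of "Suc i" "Suc (e + i)"] by simp_all
      ultimately show ?thesis
        unfolding m' Suc by (metis mult.commute of_nat_mult)
    qed
    have ch2: "real (Suc k) * real (k choose b) = real j * real (Suc k choose b)"
    proof -
      have "Suc (i + b) * ((i + b) choose i) = (Suc (i + b) choose Suc i) * Suc i"
        by (rule Suc_times_binomial_eq)
      moreover have "(i + b) choose i = (i + b) choose b" "Suc (i + b) choose Suc i = Suc (i + b) choose b"
        using binomial_symmetric[of i "i + b"] binomial_symmetric[of "Suc i" "Suc (i + b)"] by simp_all
      ultimately show ?thesis
        unfolding k' Suc by (metis mult.commute of_nat_mult)
    qed
    define w where "w = loss_amp_weight h t k (m - 1) e b"
    have w: "w = (real ((e + i) choose e) * h ^ i * (1 - h) ^ e) * (real (k choose b) * t ^ b * (1 - t) ^ Suc i)"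
      by (simp add: w_def loss_amp_weight_def m' k')
    have "real (Suc k) * (h * (1 - t) * real m * w) =
        h * (1 - t) * (real m * real ((e + i) choose e)) * (real (Suc k) * real (k choose b)) *
          (h ^ i * (1 - h) ^ e * t ^ b * (1 - t) ^ Suc i)"
      by (simp add: w mult_ac)
    also have "\<dots> = (real j)\<^sup>2 * W"
      unfolding ch1 ch2 W by (simp add: Suc power2_eq_square mult_ac)
    finally have "h * (1 - t) * real m * w = (real j)\<^sup>2 * W / real (Suc k)"
      by (simp add: field_simps del: of_nat_Suc)
    then have "sqrt (h * (1 - t) * real m * w) = real j * sqrt W / sqrt (real (Suc k))"
      by (simp add: real_sqrt_mult real_sqrt_divide del: of_nat_Suc)
    then show ?thesis
      unfolding loss_amp_kraus_def w_def[symmetric] by (simp add: real_sqrt_mult)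
  qed
  have 2: "sqrt t * sqrt (real b) * loss_amp_kraus h t k m e (b - 1) = real b / sqrt (real (Suc k)) * sqrt W"
  proof (cases b)
    case (Suc c)
    have k': "k = j + c"
      using k Suc by simp
    have ch: "real (Suc k) * real (k choose c) = real b * real (Suc k choose b)"
      using Suc_times_binomial_eq[of k c] unfolding Suc by (metis mult.commute of_nat_mult)
    define w where "w = loss_amp_weight h t k m e (b - 1)"
    have w: "w = (real (m choose e) * h ^ j * (1 - h) ^ e) * (real (k choose c) * t ^ c * (1 - t) ^ Suc j)"
      by (simp add: w_def loss_amp_weight_def m k' Suc)
    have "real (Suc k) * (t * real b * w) =
        t * real b * (real (Suc k) * real (k choose c)) *
          ((real (m choose e) * h ^ j * (1 - h) ^ e) * (t ^ c * (1 - t) ^ Suc j))"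
      by (simp add: w mult_ac)
    also have "\<dots> = (real b)\<^sup>2 * W"
      unfolding ch W by (simp add: Suc power2_eq_square mult_ac)
    finally have "t * real b * w = (real b)\<^sup>2 * W / real (Suc k)"
      by (simp add: field_simps del: of_nat_Suc)
    then have "sqrt (t * real b * w) = real b * sqrt W / sqrt (real (Suc k))"
      by (simp add: real_sqrt_mult real_sqrt_divide del: of_nat_Suc)
    then show ?thesis
      unfolding loss_amp_kraus_def w_def[symmetric] by (simp add: real_sqrt_mult)
  qed simp
  have "real j / sqrt (real (Suc k)) * sqrt W + real b / sqrt (real (Suc k)) * sqrt W =
      real (Suc k) / sqrt (real (Suc k)) * sqrt W"
    unfolding k by (simp add: add_divide_distrib distrib_right)
  also have "real (Suc k) / sqrt (real (Suc k)) = sqrt (real (Suc k))"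
    by (rule real_div_sqrt) simp
  finally show ?thesis
    using 1 2 by (simp add: loss_amp_kraus_def W_def)
qed

text \<open>The two-mode squeezing relation b V = sqrt(t) adj(a) V: the amplifier creates its
  photons in pairs.\<close>

lemma kraus_environment_annihilate:
  "sqrt (real (Suc b)) * loss_amp_kraus h t (Suc l) n e (Suc b) =
    sqrt t * sqrt (real (Suc l)) * loss_amp_kraus h t l n e b"
proof -
  have ch: "real (Suc b) * real (Suc l choose Suc b) = real (Suc l) * real (l choose b)"
    using Suc_times_binomial_eq[of l b] by (metis mult.commute of_nat_mult)
  have "real (Suc b) * loss_amp_weight h t (Suc l) n e (Suc b) = t * real (Suc l) * loss_amp_weight h t l n e b"
  proof (cases "e \<le> n \<and> b \<le> l \<and> l + e = n + b")
    case True
    then have "real (Suc b) * loss_amp_weight h t (Suc l) n e (Suc b) =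
        (real (Suc b) * real (Suc l choose Suc b)) *
          ((real (n choose e) * h ^ (n - e) * (1 - h) ^ e) * (t ^ Suc b * (1 - t) ^ Suc (n - e)))"
      by (simp add: loss_amp_weight_def mult_ac del: binomial_Suc_Suc)
    then show ?thesis
      unfolding ch using True by (simp add: loss_amp_weight_def mult_ac)
  qed (auto simp: loss_amp_weight_def)
  then show ?thesis
    unfolding loss_amp_kraus_def by (metis real_sqrt_mult)
qed

text \<open>Lowering the output raises b in the left factor. Shifting the summation index moves this
  to the right factor as a lowering of b, which is sqrt(t) times a creation in the output l; the two
  factors sqrt(t) make the coefficient t.\<close>

lemma loss_amp_recursion:
  assumes "0 \<le> h" "h \<le> 1" "0 \<le> t" "t < 1"
  shows "sqrt (real (Suc k)) * loss_amp h t (Suc k) l m n =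
    t * sqrt (real l) * loss_amp h t k (l - 1) m n + sqrt (h * (1 - t)) * sqrt (real m) * loss_amp h t k l (m - 1) n"
proof -
  define K where "K = loss_amp_kraus h t"
  define S where "S k l m n = (\<lambda>(e, b). K k m e b * K l n e b)" for k l m n
  have S: "(S k l m n has_sum loss_amp h t k l m n) UNIV" for k l m n
    using has_sum_loss_amp[of h t k m l n] by (simp add: S_def K_def)
  define z where "z = (\<lambda>(e, b). sqrt t * sqrt (real b) * (K k m e (b - 1) * K l n e b))"
  have "((\<lambda>i. t * sqrt (real l) * S k (l - 1) m n i) has_sum t * sqrt (real l) * loss_amp h t k (l - 1) m n) UNIV"
    by (intro has_sum_cmult_right S)
  moreover have "t * sqrt (real l) * S k (l - 1) m n i = z (map_prod id Suc i)" for i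
  proof (cases i)
    case (Pair e b)
    have *: "sqrt t * (sqrt (real (Suc b)) * K l n e (Suc b)) = t * sqrt (real l) * K (l - 1) n e b"
    proof (cases l)
      case 0
      then show ?thesis
        by (simp add: K_def loss_amp_kraus_support)
    next
      case (Suc l')
      show ?thesis
        unfolding Suc K_def kraus_environment_annihilate using assms
        by (simp add: sqrt_mult_cancel mult.assoc del: of_nat_Suc)
    qed
    have "z (map_prod id Suc (e, b)) = K k m e b * (sqrt t * (sqrt (real (Suc b)) * K l n e (Suc b)))"
      by (simp add: z_def mult_ac)
    then show ?thesis
      unfolding * by (simp add: Pair S_def)
  qed
  ultimately have "((\<lambda>i. z (map_prod id Suc i)) has_sum t * sqrt (real l) * loss_amp h t k (l - 1) m n) UNIV"
    by simp
  moreover have "inj (map_prod (id :: nat \<Rightarrow> nat) Suc)"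
    by (auto simp: inj_def)
  ultimately have "(z has_sum t * sqrt (real l) * loss_amp h t k (l - 1) m n)
      (range (map_prod (id :: nat \<Rightarrow> nat) Suc))"
    by (simp add: has_sum_reindex o_def)
  moreover have "z i = 0" if "i \<notin> range (map_prod (id :: nat \<Rightarrow> nat) Suc)" for i
  proof (cases i)
    case (Pair e b)
    then have "b = 0"
      using that by (cases b) (auto simp: image_iff)
    then show ?thesis
      by (simp add: Pair z_def)
  qed
  ultimately have z: "(z has_sum t * sqrt (real l) * loss_amp h t k (l - 1) m n) UNIV"
    by (subst has_sum_cong_neutral[where T = "range (map_prod (id :: nat \<Rightarrow> nat) Suc)" and g = z]) auto
  have "sqrt (real (Suc k)) * S (Suc k) l m n i =
      z i + sqrt (h * (1 - t)) * sqrt (real m) * S k l (m - 1) n i" for i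
  proof (cases i)
    case (Pair e b)
    have "sqrt (real (Suc k)) * S (Suc k) l m n (e, b) = K l n e b * (sqrt (real (Suc k)) * K (Suc k) m e b)"
      by (simp add: S_def mult_ac)
    then show ?thesis
      unfolding K_def kraus_annihilate[OF assms]
      by (simp add: Pair S_def z_def K_def algebra_simps)
  qed
  moreover have "((\<lambda>i. sqrt (real (Suc k)) * S (Suc k) l m n i) has_sum
      sqrt (real (Suc k)) * loss_amp h t (Suc k) l m n) UNIV"
    by (intro has_sum_cmult_right S)
  ultimately have sum1: "((\<lambda>i. z i + sqrt (h * (1 - t)) * sqrt (real m) * S k l (m - 1) n i) has_sum
      sqrt (real (Suc k)) * loss_amp h t (Suc k) l m n) UNIV"
    by simp
  have sum2: "((\<lambda>i. z i + sqrt (h * (1 - t)) * sqrt (real m) * S k l (m - 1) n i) has_sum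
      t * sqrt (real l) * loss_amp h t k (l - 1) m n + sqrt (h * (1 - t)) * sqrt (real m) * loss_amp h t k l (m - 1) n) UNIV"
    by (intro has_sum_add has_sum_cmult_right S z)
  show ?thesis
    by (rule has_sum_unique[OF sum1 sum2])
qed

lemma loss_amp_vacuum_output:
  assumes "h \<le> 1" "t < 1"
  shows "loss_amp h t 0 0 m n = (if m = n then (1 - h) ^ m * (1 - t) else 0)"
proof -
  have "((\<lambda>(e, b). loss_amp_kraus h t 0 m e b * loss_amp_kraus h t 0 n e b) has_sum
      (if m = n then (1 - h) ^ m * (1 - t) else 0)) UNIV"
  proof (rule has_sum_finite_neutralI[of "{(m, 0)}"])
    fix i assume "i \<in> UNIV - {(m, 0 :: nat)}"
    then show "(case i of (e, b) \<Rightarrow> loss_amp_kraus h t 0 m e b * loss_amp_kraus h t 0 n e b) = 0"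
      using loss_amp_kraus_support[of "fst i" m "snd i" 0 h t] by (cases i) auto
  next
    show "(if m = n then (1 - h) ^ m * (1 - t) else 0) =
        (\<Sum>i\<in>{(m, 0)}. case i of (e, b) \<Rightarrow> loss_amp_kraus h t 0 m e b * loss_amp_kraus h t 0 n e b)"
      using assms by (auto simp: loss_amp_kraus_def loss_amp_weight_def)
  qed auto
  then show ?thesis
    using has_sum_loss_amp has_sum_unique by blast
qed

text \<open>The parameters are read off by matching the coefficients of the two recursions. For l =
  0 the recursion refers to l = 0 only, so the elements with k = l = 0 fix that column; hermiticity
  carries it to the row k = 0, from which the recursion in k reaches every l.\<close>

lemma thermal_loss_eq_loss_amp:
  assumes "0 \<le> \<kappa>" "\<kappa> < 1" "0 \<le> N"
  shows "thermal_loss \<kappa> N (matrix_unit m n) k l =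
    of_real (loss_amp (\<kappa> / ((1 - \<kappa>) * N + 1)) ((1 - \<kappa>) * N / ((1 - \<kappa>) * N + 1)) k l m n)"
proof -
  define G where "G = (1 - \<kappa>) * N + 1"
  define h where "h = \<kappa> / G"
  define t where "t = (1 - \<kappa>) * N / G"
  have G: "1 \<le> G"
    using assms by (simp add: G_def)
  have t1: "1 - t = 1 / G"
    using G by (simp add: t_def G_def field_simps)
  have h: "0 \<le> h" "h \<le> 1"
    using assms G by (simp_all add: h_def)
  have "0 < 1 - t"
    unfolding t1 using G by simp
  moreover have "0 \<le> t"
    using assms G by (simp add: t_def)
  ultimately have t: "0 \<le> t" "t < 1"
    by simp_all
  have c: "sqrt \<kappa> / G = sqrt (h * (1 - t))"
    using G by (simp add: t1 h_def real_sqrt_divide)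
  define f where "f k l m n = thermal_loss \<kappa> N (matrix_unit m n) k l" for k l m n
  define g where "g k l m n = complex_of_real (loss_amp h t k l m n)" for k l m n
  have f_rec: "of_real (sqrt (real (Suc k))) * f (Suc k) l m n =
      of_real (t * sqrt (real l)) * f k (l - 1) m n + of_real (sqrt (h * (1 - t)) * sqrt (real m)) * f k l (m - 1) n"
    for k l m n
    using thermal_loss_recursion[OF assms, where k = k and l = l and m = m and n = n]
    unfolding G_def[symmetric] c t_def[symmetric] f_def .
  have g_rec: "of_real (sqrt (real (Suc k))) * g (Suc k) l m n =
      of_real (t * sqrt (real l)) * g k (l - 1) m n + of_real (sqrt (h * (1 - t)) * sqrt (real m)) * g k l (m - 1) n"
    for k l m n
    unfolding g_def of_real_mult[symmetric] of_real_add[symmetric] loss_amp_recursion[OF h t] ..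
  have step: "f (Suc k) l m n = g (Suc k) l m n"
    if "l = 0 \<or> f k (l - 1) m n = g k (l - 1) m n" "f k l (m - 1) n = g k l (m - 1) n" for k l m n
  proof -
    have "complex_of_real (sqrt (real (Suc k))) * f (Suc k) l m n = of_real (sqrt (real (Suc k))) * g (Suc k) l m n"
      unfolding f_rec g_rec using that by auto
    moreover have "complex_of_real (sqrt (real (Suc k))) \<noteq> 0"
      by (simp del: of_nat_Suc)
    ultimately show ?thesis
      by simp
  qed
  have f_g0: "f k 0 m n = g k 0 m n" for k m n
  proof (induction k arbitrary: m n)
    case 0
    show ?case
      unfolding f_def g_def loss_amp_vacuum_output[OF h(2) t(2)] thermal_loss_vacuum_output[OF assms]
        G_def[symmetric] h_def[symmetric] t1 by simp
  qed (auto intro: step)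
  have "f k l m n = g k l m n"
  proof (induction k arbitrary: l m n)
    case 0
    have "f 0 l m n = cnj (f l 0 n m)"
      using thermal_loss_hermitian[of \<kappa> N m n 0 l] assms by (simp add: f_def)
    also have "\<dots> = cnj (g l 0 n m)"
      by (simp only: f_g0)
    also have "\<dots> = g 0 l m n"
      by (simp add: g_def loss_amp_commute[of h t l 0])
    finally show ?case .
  qed (auto intro: step)
  then show ?thesis
    by (simp add: f_def g_def h_def t_def G_def)
qed

subsection \<open>Sums over several modes\<close>

text \<open>The product formula for \<open>infsum\<close> yields a value but no convergence.
  Positive factors make that value nonzero, so it is not the default 0 and the family is
  summable.\<close>

lemma has_sum_prod_modes:
  fixes f :: "'m::finite \<Rightarrow> 'b \<Rightarrow> real"
  assumes f: "\<And>r. (f r has_sum s r) UNIV" and nonneg: "\<And>r x. 0 \<le> f r x" and pos: "\<And>r. 0 < s r"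
  shows "((\<lambda>g. \<Prod>r\<in>UNIV. f r (g r)) has_sum (\<Prod>r\<in>UNIV. s r)) UNIV"
proof -
  have "infsum (\<lambda>g. \<Prod>r\<in>UNIV. f r (g r)) (Pi\<^sub>E UNIV (\<lambda>_. UNIV)) = (\<Prod>r\<in>UNIV. infsum (f r) UNIV)"
    using f nonneg by (intro infsum_prod_PiE_abs) (auto intro: has_sum_imp_summable)
  also have "\<dots> = (\<Prod>r\<in>UNIV. s r)"
    by (simp add: infsumI[OF f])
  finally have "(\<Sum>\<^sub>\<infinity>g. \<Prod>r\<in>UNIV. f r (g r)) = (\<Prod>r\<in>UNIV. s r)"
    by (simp add: PiE_UNIV_domain)
  moreover have "(\<Prod>r\<in>UNIV. s r) \<noteq> 0"
    using pos by (simp add: less_imp_neq[symmetric])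
  ultimately show ?thesis
    using infsum_not_exists by (metis has_sum_infsum)
qed

lemma infsum_of_real:
  "(\<Sum>\<^sub>\<infinity>x\<in>A. of_real (f x) :: complex) = of_real (infsum f A)"
proof (cases "f summable_on A")
  case True
  then show ?thesis
    by (intro infsumI has_sum_of_real) simp
next
  case False
  then have "\<not> (\<lambda>x. complex_of_real (f x)) summable_on A"
    using summable_on_Re[of "\<lambda>x. complex_of_real (f x)" A] by auto
  with False show ?thesis
    by (simp add: infsum_not_exists)
qed

lemma
  assumes "((\<lambda>i. (cmod (x i))\<^sup>2) has_sum c\<^sup>2) UNIV" "0 \<le> c"
  shows l2_has_sum: "l2 x" and l2_norm_has_sum: "l2_norm x = c"
  using assms by (auto simp: l2_def l2_norm_def infsumI intro: has_sum_imp_summable)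

text \<open>Products over modes give functions into pairs, while environment configurations are
  pairs of functions.\<close>

lemma bij_split_modes: "bij (\<lambda>g :: 'm \<Rightarrow> 'a \<times> 'b. (fst \<circ> g, snd \<circ> g))"
  by (rule bij_betw_byWitness[where f' = "\<lambda>(a, b) r. (a r, b r)"]) (auto simp: fun_eq_iff)

lemma has_sum_split_modes:
  "(f has_sum s) UNIV \<longleftrightarrow> ((\<lambda>g :: 'm \<Rightarrow> 'a \<times> 'b. f (fst \<circ> g, snd \<circ> g)) has_sum s) UNIV"
  using has_sum_reindex_bij_betw[OF bij_split_modes, of f s] by simp

lemma infsum_split_modes:
  "infsum f UNIV = (\<Sum>\<^sub>\<infinity>g :: 'm \<Rightarrow> 'a \<times> 'b. f (fst \<circ> g, snd \<circ> g))"
  using infsum_reindex_bij_betw[OF bij_split_modes, of f] by simp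

lemma has_sum_inj_support:
  assumes "inj h" "\<And>i. i \<notin> range h \<Longrightarrow> f i = 0" "((\<lambda>j. f (h j)) has_sum s) UNIV"
  shows "(f has_sum s) UNIV"
proof -
  have "(f has_sum s) (range h)"
    using assms(3) has_sum_reindex[OF assms(1), of f s] by (simp add: o_def)
  then show ?thesis
    using assms(2) by (subst has_sum_cong_neutral[where T = "range h" and g = f]) auto
qed

lemma has_sum_inj_supportD:
  assumes "inj h" "\<And>i. i \<notin> range h \<Longrightarrow> f i = 0" "(f has_sum s) UNIV"
  shows "((\<lambda>j. f (h j)) has_sum s) UNIV"
proof -
  have "(f has_sum s) (range h)"
    using assms(2,3) by (subst has_sum_cong_neutral[where T = UNIV and g = f]) auto
  then show ?thesis
    using has_sum_reindex[OF assms(1), of f s] by (simp add: o_def)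
qed

lemma has_sum_product_nonneg:
  fixes f :: "'a \<Rightarrow> real"
  assumes "(f has_sum s) UNIV" "\<And>x. 0 \<le> f x" "\<And>x. (g x has_sum t x) UNIV" "\<And>x y. 0 \<le> g x y"
    and "((\<lambda>x. f x * t x) has_sum u) UNIV"
  shows "((\<lambda>(x, y). f x * g x y) has_sum u) UNIV"
proof -
  have inner: "((\<lambda>y. case (x, y) of (x, y) \<Rightarrow> f x * g x y) has_sum f x * t x) UNIV" for x
    using has_sum_cmult_right[OF assms(3), of "f x" x] by simp
  have "(\<lambda>(x, y). f x * g x y) summable_on UNIV \<times> UNIV"
    by (rule summable_on_SigmaI[OF inner has_sum_imp_summable[OF assms(5)]]) (use assms in auto)
  with has_sum_SigmaI[OF inner assms(5) this] show ?thesis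
    by simp
qed

lemma loss_amp_weight_nonneg:
  assumes "0 \<le> h" "h \<le> 1" "0 \<le> t" "t \<le> 1"
  shows "0 \<le> loss_amp_weight h t k m e b"
  using assms unfolding loss_amp_weight_def by (auto intro!: mult_nonneg_nonneg zero_le_power)

text \<open>Trace preservation for the input |m>: the number e of lost photons is binomial, given e
  the number b is negative binomial with m - e photons entering the amplifier, and k is determined
  by e and b.\<close>

lemma has_sum_loss_amp_weight:
  assumes "0 \<le> h" "h \<le> 1" "0 \<le> t" "t < 1"
  shows "((\<lambda>(k, e, b). loss_amp_weight h t k m e b) has_sum 1) UNIV"
\<comment> \<open>For e > m the triple (0, e, b) is a filler that keeps the map total and injective;
  the weight vanishes there.\<close>
proof (rule has_sum_inj_support[where h = "\<lambda>(e, b). if e \<le> m then (m - e + b, e, b) else (0, e, b)"])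
  show "inj (\<lambda>(e, b). if e \<le> m then (m - e + b, e, b) else (0, e, b))"
    by (auto simp: inj_def split: if_splits)
next
  fix i :: "nat \<times> nat \<times> nat"
  assume i: "i \<notin> range (\<lambda>(e, b). if e \<le> m then (m - e + b, e, b) else (0, e, b))"
  obtain k e b where [simp]: "i = (k, e, b)"
    by (cases i)
  have "i \<noteq> (case (e, b) of (e, b) \<Rightarrow> if e \<le> m then (m - e + b, e, b) else (0, e, b))"
    using i by blast
  then have "\<not> (e \<le> m \<and> b \<le> k \<and> k + e = m + b)"
    by auto
  then show "(case i of (k, e, b) \<Rightarrow> loss_amp_weight h t k m e b) = 0"
    by (auto simp: loss_amp_weight_def)
next
  define A where "A e = (if e \<le> m then real (m choose e) * (1 - h) ^ e * h ^ (m - e) else 0)" for e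
  define g where "g e b = (real ((m - e + b) choose b) * t ^ b) * (1 - t) ^ Suc (m - e)" for e b
  have A: "(A has_sum 1) UNIV"
  proof (rule has_sum_finite_neutralI[of "{..m}"])
    have "1 = ((1 - h) + h) ^ m"
      by simp
    also have "\<dots> = sum A {..m}"
      unfolding binomial_ring by (intro sum.cong) (auto simp: A_def)
    finally show "1 = sum A {..m}" .
  qed (auto simp: A_def)
  have g: "(g e has_sum 1) UNIV" for e
  proof -
    have "((\<lambda>b. real ((m - e + b) choose b) * t ^ b) has_sum (1 / (1 - t) ^ Suc (m - e))) UNIV"
      using assms by (intro sums_nonneg_imp_has_sum negative_binomial_sums) auto
    from has_sum_cmult_left[OF this, of "(1 - t) ^ Suc (m - e)"] show ?thesis
      using assms by (simp add: g_def[abs_def])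
  qed
  have "((\<lambda>(e, b). A e * g e b) has_sum 1) UNIV"
  proof (rule has_sum_product_nonneg[OF A _ g])
    show "((\<lambda>e. A e * 1) has_sum 1) UNIV"
      using A by simp
  qed (use assms in \<open>auto simp: A_def g_def\<close>)
  moreover have "A e * g e b = (case (if e \<le> m then (m - e + b, e, b) else (0, e, b)) of
      (k, e, b) \<Rightarrow> loss_amp_weight h t k m e b)" for e b
    by (auto simp: A_def g_def loss_amp_weight_def)
  ultimately show "((\<lambda>j. case case j of (e, b) \<Rightarrow> if e \<le> m then (m - e + b, e, b) else (0, e, b) of
      (k, e, b) \<Rightarrow> loss_amp_weight h t k m e b) has_sum 1) UNIV"
    by (simp add: case_prod_unfold)
qed

subsection \<open>Purifications of the two hypotheses\<close>

text \<open>The outer pair separates system and environment; the environment holds the lost photons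
  and the photons of the amplifier's idler, mode by mode.\<close>

type_synonym ('i, 'm) purification = "('i \<times> ('m \<Rightarrow> nat)) \<times> ('m \<Rightarrow> nat) \<times> ('m \<Rightarrow> nat) \<Rightarrow> complex"

definition thermal_prob :: "real \<Rightarrow> nat \<Rightarrow> real" where
  "thermal_prob N n = N ^ n / (N + 1) ^ (n + 1)"

text \<open>The signal numbers \<open>e\<close> go to the environment unchanged, and an amplified
  vacuum, a two-mode squeezed state with b = k, supplies the thermal output.\<close>

definition absent_purification :: "real \<Rightarrow> ('i \<times> ('m::finite \<Rightarrow> nat) \<Rightarrow> complex) \<Rightarrow> ('i, 'm) purification" where
  "absent_purification N \<psi> = (\<lambda>((i, k), (e, b)).
     if b = k then \<psi> (i, e) * of_real (\<Prod>r\<in>UNIV. sqrt (thermal_prob N (k r))) else 0)"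

definition multi_kraus :: "real \<Rightarrow> real \<Rightarrow> ('m::finite \<Rightarrow> nat) \<Rightarrow> ('m \<Rightarrow> nat) \<Rightarrow> ('m \<Rightarrow> nat) \<Rightarrow> ('m \<Rightarrow> nat) \<Rightarrow> real" where
  "multi_kraus h t k m e b = (\<Prod>r\<in>UNIV. loss_amp_kraus h t (k r) (m r) (e r) (b r))"

text \<open>The only input compatible with k + e = m + b. If b > k + e the subtraction truncates to
  0, but there the Kraus coefficient vanishes.\<close>

definition input_number :: "('m \<Rightarrow> nat) \<Rightarrow> ('m \<Rightarrow> nat) \<Rightarrow> ('m \<Rightarrow> nat) \<Rightarrow> 'm \<Rightarrow> nat" where
  "input_number k e b = (\<lambda>r. k r + e r - b r)"

definition present_purification ::
    "real \<Rightarrow> real \<Rightarrow> ('i \<times> ('m::finite \<Rightarrow> nat) \<Rightarrow> complex) \<Rightarrow> ('i, 'm) purification" where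
  "present_purification h t \<psi> = (\<lambda>((i, k), (e, b)).
     \<psi> (i, input_number k e b) * of_real (multi_kraus h t k (input_number k e b) e b))"

lemma multi_kraus_support:
  assumes "m \<noteq> input_number k e b"
  shows "multi_kraus h t k m e b = 0"
proof -
  obtain r where "m r \<noteq> k r + e r - b r"
    using assms by (auto simp: input_number_def)
  then have "loss_amp_kraus h t (k r) (m r) (e r) (b r) = 0"
    by (intro loss_amp_kraus_support) auto
  then show ?thesis
    by (auto simp: multi_kraus_def)
qed

lemma thermal_prob_nonneg: "0 \<le> N \<Longrightarrow> 0 \<le> thermal_prob N n"
  by (simp add: thermal_prob_def)

lemma has_sum_thermal_prob:
  assumes "0 \<le> N"
  shows "(thermal_prob N has_sum 1) UNIV"
proof -
  have "(\<lambda>n. (N / (N + 1)) ^ n) sums (1 / (1 - N / (N + 1)))"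
    using assms by (intro geometric_sums) simp
  then have "(\<lambda>n. (1 / (N + 1)) * (N / (N + 1)) ^ n) sums ((1 / (N + 1)) * (1 / (1 - N / (N + 1))))"
    by (rule sums_mult)
  moreover have "(1 / (N + 1)) * (1 / (1 - N / (N + 1))) = 1"
    using assms by (simp add: field_simps)
  moreover have "(1 / (N + 1)) * (N / (N + 1)) ^ n = thermal_prob N n" for n
    by (simp add: thermal_prob_def power_divide)
  ultimately have "thermal_prob N sums 1"
    by simp
  then show ?thesis
    using assms by (intro sums_nonneg_imp_has_sum) (auto simp: thermal_prob_nonneg)
qed

lemma
  fixes \<psi> :: "'i \<times> ('m::finite \<Rightarrow> nat) \<Rightarrow> complex"
  assumes N: "0 \<le> N" and \<psi>: "l2 \<psi>"
  shows l2_absent_purification: "l2 (absent_purification N \<psi>)"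
    and l2_norm_absent_purification: "l2_norm (absent_purification N \<psi>) = l2_norm \<psi>"
proof -
  define th where "th k = (\<Prod>r\<in>UNIV. thermal_prob N (k r))" for k :: "'m \<Rightarrow> nat"
  have th: "(th has_sum 1) UNIV"
    using has_sum_prod_modes[of "\<lambda>_. thermal_prob N" "\<lambda>_. 1"] has_sum_thermal_prob[OF N]
      thermal_prob_nonneg[OF N] by (simp add: th_def[abs_def])
  have th_nonneg: "0 \<le> th k" for k
    unfolding th_def by (intro prod_nonneg) (simp add: thermal_prob_nonneg N)
  define H where "H = (\<lambda>((i :: 'i, e :: 'm \<Rightarrow> nat), k :: 'm \<Rightarrow> nat). ((i, k), (e, k)))"
  have "((\<lambda>j. (cmod (absent_purification N \<psi> j))\<^sup>2) has_sum (l2_norm \<psi>)\<^sup>2) UNIV"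
  proof (rule has_sum_inj_support[where h = H])
    show "inj H"
      by (auto simp: inj_def H_def)
  next
    fix j assume j: "j \<notin> range H"
    obtain i k e b where [simp]: "j = ((i, k), (e, b))"
      by (metis prod.exhaust)
    have "j \<noteq> H ((i, e), k)"
      using j by blast
    then show "(cmod (absent_purification N \<psi> j))\<^sup>2 = 0"
      by (auto simp: absent_purification_def H_def)
  next
    have "((\<lambda>(j, k). (cmod (\<psi> j))\<^sup>2 * th k) has_sum (l2_norm \<psi>)\<^sup>2) UNIV"
      by (rule has_sum_product_nonneg[OF has_sum_l2_norm[OF \<psi>] _ th])
        (use th_nonneg has_sum_l2_norm[OF \<psi>] in auto)
    moreover have "(cmod (\<psi> (i, e)))\<^sup>2 * th k = (cmod (absent_purification N \<psi> ((i, k), (e, k))))\<^sup>2" for i e k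
      unfolding absent_purification_def th_def
      by (simp add: norm_mult power_mult_distrib thermal_prob_nonneg N prod_power_distrib del: of_real_prod)
    then have "(\<lambda>j. (cmod (absent_purification N \<psi> (H j)))\<^sup>2) = (\<lambda>(j, k). (cmod (\<psi> j))\<^sup>2 * th k)"
      by (auto simp: H_def)
    ultimately show "((\<lambda>j. (cmod (absent_purification N \<psi> (H j)))\<^sup>2) has_sum (l2_norm \<psi>)\<^sup>2) UNIV"
      by simp
  qed
  then show "l2 (absent_purification N \<psi>)" "l2_norm (absent_purification N \<psi>) = l2_norm \<psi>"
    by (auto intro: l2_has_sum l2_norm_has_sum)
qed

text \<open>Each input has total Kraus weight 1, a product over modes. Output and environment
  together fix the input, so different inputs do not interfere and the weights simply add
  up.\<close>

lemma
  fixes \<psi> :: "'i \<times> ('m::finite \<Rightarrow> nat) \<Rightarrow> complex"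
  assumes ht: "0 \<le> h" "h \<le> 1" "0 \<le> t" "t < 1" and \<psi>: "l2 \<psi>"
  shows l2_present_purification: "l2 (present_purification h t \<psi>)"
    and l2_norm_present_purification: "l2_norm (present_purification h t \<psi>) = l2_norm \<psi>"
proof -
  define w where "w m = (\<lambda>(k, e, b). (multi_kraus h t k m e b)\<^sup>2)" for m :: "'m \<Rightarrow> nat"
  have w: "(w m has_sum 1) UNIV" for m
  proof -
    have "((\<lambda>g. \<Prod>r\<in>UNIV. case g r of (k, e, b) \<Rightarrow> loss_amp_weight h t k (m r) e b) has_sum (\<Prod>r\<in>UNIV. 1)) UNIV"
      using has_sum_prod_modes[of "\<lambda>r (k, e, b). loss_amp_weight h t k (m r) e b" "\<lambda>_. 1",
          OF has_sum_loss_amp_weight[OF ht]] ht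
      by (auto simp: loss_amp_weight_nonneg)
    then have "((\<lambda>g. (\<lambda>(k, e, b). \<Prod>r\<in>UNIV. loss_amp_weight h t (k r) (m r) (e r) (b r))
        (fst \<circ> g, fst \<circ> snd \<circ> g, snd \<circ> snd \<circ> g)) has_sum 1) UNIV"
      by (simp add: case_prod_unfold)
    moreover have "w m = (\<lambda>(k, e, b). \<Prod>r\<in>UNIV. loss_amp_weight h t (k r) (m r) (e r) (b r))"
      using ht by (auto simp: w_def multi_kraus_def loss_amp_kraus_def loss_amp_weight_nonneg
          prod_power_distrib)
    ultimately have g: "((\<lambda>g. w m (fst \<circ> g, fst \<circ> snd \<circ> g, snd \<circ> snd \<circ> g)) has_sum 1) UNIV"
      by simp
    have "bij (map_prod id (\<lambda>g :: 'm \<Rightarrow> nat \<times> nat. (fst \<circ> g, snd \<circ> g)) :: ('m \<Rightarrow> nat) \<times> _ \<Rightarrow> _)"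
      using bij_betw_map_prod[OF bij_id bij_split_modes] by simp
    from has_sum_reindex_bij_betw[OF this, of "w m" 1]
    show ?thesis
      using g by (subst (asm) has_sum_split_modes[of "\<lambda>i. w m (map_prod id (\<lambda>g. (fst \<circ> g, snd \<circ> g)) i)", simplified])
        (simp add: comp_assoc)
  qed
  have "((\<lambda>j. (cmod (present_purification h t \<psi> j))\<^sup>2) has_sum (l2_norm \<psi>)\<^sup>2) UNIV"
  proof -
    define W where "W = (\<lambda>((i, m), j). (cmod (\<psi> (i, m)))\<^sup>2 * w m j)"
    define H where "H = (\<lambda>((i :: 'i, k), (e, b)). ((i, input_number k e b :: 'm \<Rightarrow> nat), (k, e, b)))"
    have "inj H"
      by (auto simp: inj_def H_def)
    moreover have "W j = 0" if "j \<notin> range H" for j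
    proof -
      obtain i m k e b where j: "j = ((i, m), (k, e, b))"
        by (metis prod.exhaust)
      have "j \<noteq> H ((i, k), (e, b))"
        using that by blast
      then have "m \<noteq> input_number k e b"
        by (auto simp: j H_def)
      then show ?thesis
        by (simp add: j W_def w_def multi_kraus_support)
    qed
    moreover have "(W has_sum (l2_norm \<psi>)\<^sup>2) UNIV"
      using has_sum_product_nonneg[OF has_sum_l2_norm[OF \<psi>] _ w, of snd "(l2_norm \<psi>)\<^sup>2"]
        has_sum_l2_norm[OF \<psi>] by (simp add: W_def w_def case_prod_unfold)
    ultimately have "((\<lambda>j. W (H j)) has_sum (l2_norm \<psi>)\<^sup>2) UNIV"
      by (rule has_sum_inj_supportD)
    moreover have "W (H j) = (cmod (present_purification h t \<psi> j))\<^sup>2" for j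
      by (cases j)
        (auto simp: W_def H_def w_def present_purification_def norm_mult power_mult_distrib split: prod.splits)
    ultimately show ?thesis
      by simp
  qed
  then show "l2 (present_purification h t \<psi>)" "l2_norm (present_purification h t \<psi>) = l2_norm \<psi>"
    by (auto intro: l2_has_sum l2_norm_has_sum)
qed

text \<open>Tracing over b with b = k in one factor and b = l in the other makes the thermal part
  diagonal; tracing over e is the partial trace over the signal.\<close>

lemma target_absent_purification:
  fixes \<psi> :: "'i \<times> ('m::finite \<Rightarrow> nat) \<Rightarrow> complex"
  assumes N: "0 \<le> N"
  shows "target_absent N (pure_op \<psi>) x y =
    (\<Sum>\<^sub>\<infinity>j. absent_purification N \<psi> (x, j) * cnj (absent_purification N \<psi> (y, j)))"
proof (cases x; cases y)
  fix i k j l assume [simp]: "x = (i, k)" "y = (j, l)"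
  define c where "c k = complex_of_real (\<Prod>r\<in>UNIV. sqrt (thermal_prob N (k r)))" for k :: "'m \<Rightarrow> nat"
  show ?thesis
  proof (cases "k = l")
    case False
    then obtain r where "k r \<noteq> l r"
      by auto
    then have "op_tensor_power (thermal_state N) k l = 0"
      by (auto simp: op_tensor_power_def thermal_state_def)
    moreover have "(\<Sum>\<^sub>\<infinity>j. absent_purification N \<psi> (x, j) * cnj (absent_purification N \<psi> (y, j))) = 0"
      using False by (intro infsum_0) (auto simp: absent_purification_def)
    ultimately show ?thesis
      by (simp add: target_absent_def op_tensor_def)
  next
    case True
    have "op_tensor_power (thermal_state N) k k = c k * cnj (c k)"
      using N by (simp add: op_tensor_power_def thermal_state_def c_def thermal_prob_nonneg
          flip: prod.distrib of_real_mult) (simp add: thermal_prob_def)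
    moreover have "(\<Sum>\<^sub>\<infinity>j. absent_purification N \<psi> (x, j) * cnj (absent_purification N \<psi> (y, j))) =
        (\<Sum>\<^sub>\<infinity>j\<in>range (\<lambda>e. (e, k)). absent_purification N \<psi> (x, j) * cnj (absent_purification N \<psi> (y, j)))"
      using True by (intro infsum_cong_neutral) (auto simp: absent_purification_def)
    moreover have "\<dots> = (\<Sum>\<^sub>\<infinity>e. (\<psi> (i, e) * cnj (\<psi> (j, e))) * (c k * cnj (c k)))"
      using True by (subst infsum_reindex)
        (auto simp: inj_def o_def absent_purification_def c_def mult_ac intro!: infsum_cong)
    ultimately show ?thesis
      using True by (simp add: target_absent_def op_tensor_def trace_snd_def pure_op_def infsum_cmult_left')
  qed
qed

lemma prod_loss_amp:
  "(\<Prod>r\<in>UNIV. loss_amp h t (k r) (l r) (m r) (n r)) =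
    (\<Sum>\<^sub>\<infinity>(e, b). multi_kraus h t k m e b * multi_kraus h t l n e b)"
proof -
  define f where "f r = (\<lambda>(e, b). loss_amp_kraus h t (k r) (m r) e b * loss_amp_kraus h t (l r) (n r) e b)" for r
  have "finite {x. f r x \<noteq> 0}" for r
    by (rule finite_subset[of _ "{..m r} \<times> {..k r}"]) (use loss_amp_kraus_support in \<open>fastforce simp: f_def\<close>)+
  then have "infsum (\<lambda>g. \<Prod>r\<in>UNIV. f r (g r)) (Pi\<^sub>E UNIV (\<lambda>_. UNIV)) = (\<Prod>r\<in>UNIV. infsum (f r) UNIV)"
    by (intro infsum_prod_PiE_abs finite_nonzero_values_imp_summable_on) auto
  then show ?thesis
    by (subst infsum_split_modes)
      (simp add: f_def loss_amp_def multi_kraus_def PiE_UNIV_domain case_prod_unfold prod.distrib)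
qed

text \<open>The definition sums over input pairs (m, n) outside and, within the channel's matrix
  elements, over the environment; the purification has the environment outside. Each environment
  configuration admits a single pair (m, n), and what remains converges absolutely by
  Cauchy-Schwarz, so the sums may be exchanged.\<close>

lemma target_present_purification:
  fixes \<psi> :: "'i \<times> ('m::finite \<Rightarrow> nat) \<Rightarrow> complex"
  assumes "0 \<le> \<kappa>" "\<kappa> < 1" "0 \<le> N" and \<psi>: "l2 \<psi>"
  defines "h \<equiv> \<kappa> / ((1 - \<kappa>) * N + 1)" and "t \<equiv> (1 - \<kappa>) * N / ((1 - \<kappa>) * N + 1)"
  assumes ht: "0 \<le> h" "h \<le> 1" "0 \<le> t" "t < 1"
  shows "target_present \<kappa> N (pure_op \<psi>) x y =
    (\<Sum>\<^sub>\<infinity>j. present_purification h t \<psi> (x, j) * cnj (present_purification h t \<psi> (y, j)))"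
proof (cases x; cases y)
  fix i k j l assume [simp]: "x = (i, k)" "y = (j, l)"
  define P where "P = present_purification h t \<psi>"
  have P: "l2 P"
    unfolding P_def by (rule l2_present_purification[OF ht \<psi>])
  define T where "T = (\<lambda>(e, b) (m, n). \<psi> (i, m) * cnj (\<psi> (j, n)) *
    of_real (multi_kraus h t k m e b * multi_kraus h t l n e b))"
  have T: "((\<lambda>q. T q' q) has_sum P (x, q') * cnj (P (y, q'))) UNIV"
    and T_norm: "((\<lambda>q. norm (T q' q)) has_sum norm (P (x, q') * cnj (P (y, q')))) UNIV" for q'
  proof -
    obtain e b where q': "q' = (e, b)"
      by (cases q')
    define s where "s = (input_number k e b, input_number l e b)"
    have 0: "T q' q = 0" if "q \<noteq> s" for q
      using that multi_kraus_support[of "fst q" k e b h t] multi_kraus_support[of "snd q" l e b h t]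
      by (cases q) (auto simp: s_def q' T_def)
    have 1: "T q' s = P (x, q') * cnj (P (y, q'))"
      by (simp add: T_def q' s_def P_def present_purification_def mult_ac)
    show "((\<lambda>q. T q' q) has_sum P (x, q') * cnj (P (y, q'))) UNIV"
      "((\<lambda>q. norm (T q' q)) has_sum norm (P (x, q') * cnj (P (y, q')))) UNIV"
      by (rule has_sum_finite_neutralI[of "{s}"]; simp add: 0 1)+
  qed
  have "(\<lambda>q'. norm (P (x, q') * cnj (P (y, q')))) summable_on UNIV"
    using l2_row[OF P, of x] l2_row[OF P, of y] by (intro abs_summable_l2_mult) simp_all
  then have "(\<lambda>(q', q). norm (T q' q)) summable_on UNIV \<times> UNIV"
    using T_norm by (intro summable_on_SigmaI) auto
  then have summ: "(\<lambda>(q', q). T q' q) summable_on UNIV \<times> UNIV"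
    by (rule abs_summable_summable[OF summable_on_cong[THEN iffD1, rotated]]) auto
  have "(\<Sum>\<^sub>\<infinity>q'. P (x, q') * cnj (P (y, q'))) = (\<Sum>\<^sub>\<infinity>q'. \<Sum>\<^sub>\<infinity>q. T q' q)"
    by (simp add: infsumI[OF T])
  also have "\<dots> = (\<Sum>\<^sub>\<infinity>q. \<Sum>\<^sub>\<infinity>q'. T q' q)"
    by (rule infsum_swap_banach[OF summ])
  also have "\<dots> = target_present \<kappa> N (pure_op \<psi>) x y"
  proof -
    have "(\<Sum>\<^sub>\<infinity>q'. T q' (m, n)) = pure_op \<psi> (i, m) (j, n) *
        (\<Prod>r\<in>UNIV. thermal_loss \<kappa> N (matrix_unit (m r) (n r)) (k r) (l r))" for m n
    proof -
      have "(\<Prod>r\<in>UNIV. thermal_loss \<kappa> N (matrix_unit (m r) (n r)) (k r) (l r)) =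
          of_real (\<Prod>r\<in>UNIV. loss_amp h t (k r) (l r) (m r) (n r))"
        by (simp add: thermal_loss_eq_loss_amp[OF assms(1-3)] h_def t_def)
      also have "\<dots> = (\<Sum>\<^sub>\<infinity>(e, b). of_real (multi_kraus h t k m e b * multi_kraus h t l n e b))"
        unfolding prod_loss_amp infsum_of_real[symmetric] by (simp add: case_prod_unfold)
      finally show ?thesis
        by (simp add: T_def pure_op_def case_prod_unfold infsum_cmult_right')
    qed
    then have "(\<Sum>\<^sub>\<infinity>q'. T q' q) = pure_op \<psi> (i, fst q) (j, snd q) *
        (\<Prod>r\<in>UNIV. thermal_loss \<kappa> N (matrix_unit (fst q r) (snd q r)) (k r) (l r))" for q
      by (metis prod.collapse)
    then show ?thesis
      unfolding target_present_def id_tensor_channel_power_def by (simp add: case_prod_unfold)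
  qed
  finally show ?thesis
    by (simp add: P_def)
qed

subsection \<open>The overlap of the purifications\<close>

lemma has_sum_overlap_mode:
  assumes "0 \<le> \<kappa>" "\<kappa> < 1" "0 \<le> N"
  defines "h \<equiv> \<kappa> / ((1 - \<kappa>) * N + 1)" and "t \<equiv> (1 - \<kappa>) * N / ((1 - \<kappa>) * N + 1)"
  shows "((\<lambda>b. sqrt (thermal_prob N b) * loss_amp_kraus h t b m m b) has_sum nu \<kappa> N * sqrt (1 - h) ^ m) UNIV"
    and "0 < nu \<kappa> N"
proof -
  define G where "G = (1 - \<kappa>) * N + 1"
  have G: "1 \<le> G"
    using assms by (simp add: G_def)
  have h1: "0 < 1 - h"
  proof -
    have "1 - h = (1 - \<kappa>) * (N + 1) / G"
    proof -
      have "1 - h = (G - \<kappa>) / G"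
        using G unfolding h_def G_def[symmetric] by (simp add: diff_divide_distrib)
      also have "G - \<kappa> = (1 - \<kappa>) * (N + 1)"
        by (simp add: G_def algebra_simps)
      finally show ?thesis .
    qed
    then show ?thesis
      using assms(1-3) G by simp
  qed
  have t1: "1 - t = 1 / G"
    using G by (simp add: t_def G_def field_simps)
  have t_G: "t = (1 - \<kappa>) * N / G"
    by (simp only: t_def G_def)
  \<comment> \<open>(u / v)^2 = N / (N + 1) t is the product of the ratios of the two thermal
    distributions of b, so u / v is the ratio of the amplitude series, and 1 / v its
    prefactor.\<close>
  define u where "u = N * sqrt (1 - \<kappa>)"
  define v where "v = sqrt ((N + 1) * G)"
  have u: "0 \<le> u" and v: "0 < v"
    using assms(1-3) G by (simp_all add: u_def v_def)
  have uv: "u < v"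
  proof -
    have "N * N * (1 - \<kappa>) < (N + 1) * G"
      using assms(1-3) mult_left_mono[of \<kappa> 1 N] by (simp add: G_def algebra_simps)
    then have "u\<^sup>2 < v\<^sup>2"
      using assms(1-3) G by (simp add: u_def v_def power_mult_distrib) (simp add: power2_eq_square)
    then show ?thesis
      using v by (simp add: power_less_imp_less_base)
  qed
  have nu: "nu \<kappa> N = 1 / (v - u)"
    by (simp add: nu_def u_def v_def G_def inverse_eq_divide)
  show "0 < nu \<kappa> N"
    using uv by (simp add: nu)
  have "((\<lambda>b. (sqrt (1 - h) ^ m / v) * (u / v) ^ b) has_sum (sqrt (1 - h) ^ m / v) * (1 / (1 - u / v))) UNIV"
    using u v uv by (intro has_sum_cmult_right sums_nonneg_imp_has_sum geometric_sums) auto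
  moreover have "(sqrt (1 - h) ^ m / v) * (1 / (1 - u / v)) = nu \<kappa> N * sqrt (1 - h) ^ m"
    using v uv by (simp add: nu field_simps)
  moreover have "sqrt (thermal_prob N b) * loss_amp_kraus h t b m m b = (sqrt (1 - h) ^ m / v) * (u / v) ^ b" for b
  proof -
    have "thermal_prob N b * loss_amp_weight h t b m m b =
        (1 - h) ^ m * (1 / ((N + 1) * G)) * (N * N * (1 - \<kappa>) / ((N + 1) * G)) ^ b"
      by (simp add: thermal_prob_def loss_amp_weight_def t1)
        (simp add: t_G power_mult_distrib power_divide mult_ac)
    then have "sqrt (thermal_prob N b * loss_amp_weight h t b m m b) =
        sqrt (1 - h) ^ m * (1 / v) * sqrt ((u / v)\<^sup>2) ^ b"
    proof -
      have "N * N * (1 - \<kappa>) / ((N + 1) * G) = (u / v)\<^sup>2"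
        using assms(1-3) G by (simp add: u_def v_def power_mult_distrib power_divide power2_eq_square)
      with \<open>thermal_prob N b * loss_amp_weight h t b m m b = _\<close> show ?thesis
        by (simp only: real_sqrt_mult real_sqrt_power real_sqrt_divide real_sqrt_one v_def)
    qed
    then show ?thesis
      using u v by (simp add: loss_amp_kraus_def real_sqrt_mult)
  qed
  ultimately show "((\<lambda>b. sqrt (thermal_prob N b) * loss_amp_kraus h t b m m b) has_sum nu \<kappa> N * sqrt (1 - h) ^ m) UNIV"
    by simp
qed

text \<open>The absent purification lives on b = k, where the input number of the present one is k +
  e - k = e: every photon is lost. Summing over k gives one factor per mode, and the remaining sum
  over the signal is s.\<close>

lemma l2_inner_purifications:
  fixes \<psi> :: "'i \<times> ('m::finite \<Rightarrow> nat) \<Rightarrow> complex"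
  assumes \<kappa>: "0 \<le> \<kappa>" "\<kappa> < 1" "0 \<le> N"
  defines "h \<equiv> \<kappa> / ((1 - \<kappa>) * N + 1)" and "t \<equiv> (1 - \<kappa>) * N / ((1 - \<kappa>) * N + 1)"
  assumes ht: "0 \<le> h" "h < 1" "0 \<le> t" "t < 1"
    and \<psi>: "l2 \<psi>" and s: "((\<lambda>(i, m). (cmod (\<psi> (i, m)))\<^sup>2 * sqrt (1 - h) ^ (\<Sum>r\<in>UNIV. m r)) has_sum s) UNIV"
  shows "l2_inner (absent_purification N \<psi>) (present_purification h t \<psi>) = of_real (nu \<kappa> N ^ CARD('m) * s)"
proof -
  define g where "g m k = (\<Prod>r\<in>UNIV. sqrt (thermal_prob N (k r)) * loss_amp_kraus h t (k r) (m r) (m r) (k r))"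
    for m k :: "'m \<Rightarrow> nat"
  have g: "(g m has_sum nu \<kappa> N ^ CARD('m) * sqrt (1 - h) ^ (\<Sum>r\<in>UNIV. m r)) UNIV" for m
  proof -
    have "(g m has_sum (\<Prod>r\<in>UNIV. nu \<kappa> N * sqrt (1 - h) ^ m r)) UNIV"
      unfolding g_def
    proof (rule has_sum_prod_modes)
      show "((\<lambda>b. sqrt (thermal_prob N b) * loss_amp_kraus h t b (m r) (m r) b) has_sum
          nu \<kappa> N * sqrt (1 - h) ^ m r) UNIV" for r
        unfolding h_def t_def by (rule has_sum_overlap_mode[OF \<kappa>])
      show "0 \<le> sqrt (thermal_prob N b) * loss_amp_kraus h t b (m r) (m r) b" for r b
        using \<kappa> ht by (simp add: thermal_prob_nonneg loss_amp_kraus_def loss_amp_weight_nonneg)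
      show "0 < nu \<kappa> N * sqrt (1 - h) ^ m r" for r
        using has_sum_overlap_mode(2)[OF \<kappa>] ht by simp
    qed
    then show ?thesis
      by (simp add: prod.distrib power_sum)
  qed
  have g_nonneg: "0 \<le> g m k" for m k
    unfolding g_def using \<kappa> ht
    by (intro prod_nonneg) (simp add: thermal_prob_nonneg loss_amp_kraus_def loss_amp_weight_nonneg)
  define H where "H = (\<lambda>((i :: 'i, e :: 'm \<Rightarrow> nat), k :: 'm \<Rightarrow> nat). ((i, k), (e, k)))"
  define c where "c = (\<lambda>j. cnj (absent_purification N \<psi> j) * present_purification h t \<psi> j)"
  have "(c has_sum of_real (nu \<kappa> N ^ CARD('m) * s)) UNIV"
  proof (rule has_sum_inj_support[where h = H])
    show "inj H"
      by (auto simp: inj_def H_def)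
  next
    fix j assume j: "j \<notin> range H"
    obtain i k e b where [simp]: "j = ((i, k), (e, b))"
      by (metis prod.exhaust)
    have "j \<noteq> H ((i, e), k)"
      using j by blast
    then show "c j = 0"
      by (auto simp: c_def absent_purification_def H_def)
  next
    have "((\<lambda>(j, k). (cmod (\<psi> j))\<^sup>2 * g (snd j) k) has_sum nu \<kappa> N ^ CARD('m) * s) UNIV"
    proof (rule has_sum_product_nonneg[OF has_sum_l2_norm[OF \<psi>] _ g])
      have "((\<lambda>j. nu \<kappa> N ^ CARD('m) * (case j of (i, m) \<Rightarrow> (cmod (\<psi> (i, m)))\<^sup>2 * sqrt (1 - h) ^ (\<Sum>r\<in>UNIV. m r)))
          has_sum nu \<kappa> N ^ CARD('m) * s) UNIV"
        by (rule has_sum_cmult_right[OF s])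
      then show "((\<lambda>j. (cmod (\<psi> j))\<^sup>2 * (nu \<kappa> N ^ CARD('m) * sqrt (1 - h) ^ (\<Sum>r\<in>UNIV. snd j r)))
          has_sum nu \<kappa> N ^ CARD('m) * s) UNIV"
        by (simp add: case_prod_unfold mult_ac)
    qed (auto simp: g_nonneg)
    then have "((\<lambda>j. complex_of_real (case j of (j, k) \<Rightarrow> (cmod (\<psi> j))\<^sup>2 * g (snd j) k)) has_sum
        of_real (nu \<kappa> N ^ CARD('m) * s)) UNIV"
      by (rule has_sum_of_real)
    moreover have "complex_of_real (case j of (j, k) \<Rightarrow> (cmod (\<psi> j))\<^sup>2 * g (snd j) k) = c (H j)" for j
    proof -
      obtain i e k where [simp]: "j = ((i, e), k)"
        by (metis prod.exhaust)
      have "input_number k e k = e"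
        by (simp add: input_number_def fun_eq_iff)
      then have "c (H j) = (cnj (\<psi> (i, e)) * \<psi> (i, e)) *
          of_real ((\<Prod>r\<in>UNIV. sqrt (thermal_prob N (k r))) * multi_kraus h t k e e k)"
        by (simp add: c_def H_def absent_purification_def present_purification_def mult_ac)
      also have "(\<Prod>r\<in>UNIV. sqrt (thermal_prob N (k r))) * multi_kraus h t k e e k = g e k"
        by (simp add: multi_kraus_def g_def prod.distrib)
      finally show ?thesis
        by (simp add: cnj_mult_self)
    qed
    ultimately show "((\<lambda>j. c (H j)) has_sum of_real (nu \<kappa> N ^ CARD('m) * s)) UNIV"
      by simp
  qed
  then show ?thesis
    unfolding l2_inner_def c_def by (rule infsumI)
qed

subsection \<open>The transmitter\<close>

lemma has_sum_total_photon_dist: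
  fixes p :: "('m::finite \<Rightarrow> nat) \<Rightarrow> real"
  assumes "((\<lambda>k. p k * f (\<Sum>r\<in>UNIV. k r)) has_sum s) UNIV"
  shows "((\<lambda>n. total_photon_dist p n * f n) has_sum s) UNIV"
proof -
  define B where "B n = {k :: 'm \<Rightarrow> nat. (\<Sum>r\<in>UNIV. k r) = n}" for n
  have "bij_betw snd (Sigma UNIV B) UNIV"
    by (rule bij_betw_byWitness[where f' = "\<lambda>k. (\<Sum>r\<in>UNIV. k r, k)"]) (auto simp: B_def)
  then have "((\<lambda>j. p (snd j) * f (\<Sum>r\<in>UNIV. snd j r)) has_sum s) (Sigma UNIV B)"
    using has_sum_reindex_bij_betw[of snd "Sigma UNIV B" UNIV "\<lambda>k. p k * f (\<Sum>r\<in>UNIV. k r)" s] assms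
    by simp
  then show ?thesis
  proof (rule has_sum_SigmaD)
    fix n
    have "((\<lambda>k. p k * f n) has_sum (\<Sum>k\<in>B n. p k * f n)) (B n)"
      by (rule has_sum_finite) (simp add: B_def finite_total_photon)
    moreover have "(\<Sum>k\<in>B n. p k * f n) = total_photon_dist p n * f n"
      by (simp add: total_photon_dist_def B_def sum_distrib_right)
    moreover have "((\<lambda>k. p (snd (n, k)) * f (\<Sum>r\<in>UNIV. snd (n, k) r)) has_sum
        total_photon_dist p n * f n) (B n) \<longleftrightarrow>
        ((\<lambda>k. p k * f n) has_sum total_photon_dist p n * f n) (B n)"
      by (rule has_sum_cong) (simp add: B_def)
    ultimately show "((\<lambda>k. p (snd (n, k)) * f (\<Sum>r\<in>UNIV. snd (n, k) r)) has_sum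
        total_photon_dist p n * f n) (B n)"
      by (simp only:)
  qed
qed

lemma has_sum_transmitter_state:
  assumes p: "\<And>n. 0 \<le> p n" and chi: "\<And>n. ((\<lambda>i. (cmod (chi n i))\<^sup>2) has_sum 1) UNIV"
    and f: "\<And>n. 0 \<le> f n" "((\<lambda>n. p n * f n) has_sum s) UNIV"
  shows "((\<lambda>(i, n). (cmod (transmitter_state p chi (i, n)))\<^sup>2 * f n) has_sum s) UNIV"
proof -
  have "((\<lambda>(n, i). (p n * f n) * (cmod (chi n i))\<^sup>2) has_sum s) UNIV"
    using f p by (intro has_sum_product_nonneg[OF f(2) _ chi]) auto
  then have "((\<lambda>(n, i). (cmod (transmitter_state p chi (i, n)))\<^sup>2 * f n) has_sum s) (UNIV \<times> UNIV)"
    using p by (simp add: transmitter_state_def norm_mult power_mult_distrib mult_ac)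
  then show ?thesis
    by (subst (asm) has_sum_swap) simp
qed

text \<open>The tangent line of the convex function n -> x^(n/2) at n = \<mu> lies below it;
  averaged against P its linear term vanishes and x^(\<mu>/2) is left.\<close>

lemma powr_mean_le:
  assumes x: "0 < x" and P: "\<And>n. 0 \<le> P n" "(\<lambda>n. P n) sums 1"
    and mean: "(\<lambda>n. real n * P n) sums \<mu>" and S: "(\<lambda>n. P n * x powr (real n / 2)) sums S"
  shows "x powr (\<mu> / 2) \<le> S"
proof -
  define c where "c = x powr (\<mu> / 2)"
  have le: "c * (1 + (real n - \<mu>) / 2 * ln x) \<le> x powr (real n / 2)" for n
  proof -
    have "1 + (real n - \<mu>) / 2 * ln x \<le> exp ((real n - \<mu>) / 2 * ln x)"
      by (rule exp_ge_add_one_self)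
    then have "c * (1 + (real n - \<mu>) / 2 * ln x) \<le> c * exp ((real n - \<mu>) / 2 * ln x)"
      by (intro mult_left_mono) (simp_all add: c_def)
    also have "\<dots> = x powr (real n / 2)"
      using x by (simp add: c_def powr_def flip: exp_add) (simp add: field_simps)
    finally show ?thesis .
  qed
  have "(\<lambda>n. c * (1 - \<mu> / 2 * ln x) * P n + c * ln x / 2 * (real n * P n)) sums
      (c * (1 - \<mu> / 2 * ln x) * 1 + c * ln x / 2 * \<mu>)"
    by (intro sums_add sums_mult P mean)
  from sums_le[OF _ this S]
  have "c * (1 - \<mu> / 2 * ln x) * 1 + c * ln x / 2 * \<mu> \<le> S"
    using mult_left_mono[OF le P(1)] by (simp add: algebra_simps diff_divide_distrib)
  then show ?thesis
    by (simp add: c_def algebra_simps)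
qed

theorem mainTheorem2:
  fixes \<eta> N_B :: real
    and p :: "('m::finite \<Rightarrow> nat) \<Rightarrow> real"
    and chi :: "('m \<Rightarrow> nat) \<Rightarrow> 'i \<Rightarrow> complex"
  assumes "0 \<le> \<eta>" and "\<eta> < 1" and "0 \<le> N_B"
    and "\<And>n. 0 \<le> p n" and "(p has_sum 1) UNIV"
    and "\<And>n. ((\<lambda>i. (cmod (chi n i))\<^sup>2) has_sum 1) UNIV"
    and "summable (\<lambda>n. real n * total_photon_dist p n)"
  shows
    "let \<Psi> = pure_op (transmitter_state p chi);
         P_e = helstrom_error (target_absent N_B \<Psi>) (target_present \<eta> N_B \<Psi>);
         M = CARD('m);
         N_S = (\<Sum>n. real n * total_photon_dist p n);
         \<nu> = nu \<eta> N_B;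
         x = 1 - \<eta> / ((1 - \<eta>) * N_B + 1);
         B1 = 1/2 * (1 - sqrt (1 - \<nu> ^ (2 * M) *
                (\<Sum>n. total_photon_dist p n * x powr (real n / 2))\<^sup>2));
         B2 = 1/2 * (1 - sqrt (1 - \<nu> ^ (2 * M) * x powr N_S))
     in P_e \<ge> B1 \<and> B1 \<ge> B2"
proof -
  define G where "G = (1 - \<eta>) * N_B + 1"
  define h where "h = \<eta> / ((1 - \<eta>) * N_B + 1)"
  define t where "t = (1 - \<eta>) * N_B / ((1 - \<eta>) * N_B + 1)"
  define \<psi> where "\<psi> = transmitter_state p chi"
  define \<nu> where "\<nu> = nu \<eta> N_B"
  define P where "P = total_photon_dist p"
  define \<mu> where "\<mu> = (\<Sum>n. real n * P n)"
  define S where "S = (\<Sum>n. P n * (1 - h) powr (real n / 2))"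
  have G: "1 \<le> G"
    using assms(1-3) by (simp add: G_def)
  \<comment> \<open>Writing 1 - h as (1 - \<eta>) (N_B + 1) / G shows that it is strictly positive,
    so that its real powers and its logarithm in Jensen's inequality are the usual ones.\<close>
  have "G - \<eta> = (1 - \<eta>) * (N_B + 1)" "G - (1 - \<eta>) * N_B = 1"
    by (simp_all add: G_def algebra_simps)
  moreover have "1 - h = (G - \<eta>) / G" "1 - t = (G - (1 - \<eta>) * N_B) / G"
    using G unfolding h_def t_def G_def[symmetric] by (simp_all add: diff_divide_distrib)
  ultimately have "1 - h = (1 - \<eta>) * (N_B + 1) / G" "1 - t = 1 / G"
    by (simp_all only:)
  moreover have "0 < (1 - \<eta>) * (N_B + 1) / G" "0 < 1 / G"
    using assms(1-3) G by simp_all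
  ultimately have "0 < 1 - h" "0 < 1 - t"
    by (simp_all only:)
  moreover have "0 \<le> h" "0 \<le> t"
    using assms(1-3) G by (simp_all add: h_def t_def G_def[symmetric])
  ultimately have ht: "0 \<le> h" "h < 1" "0 \<le> t" "t < 1"
    by simp_all
  have \<nu>: "0 < \<nu>"
    unfolding \<nu>_def by (rule has_sum_overlap_mode(2)[OF assms(1-3)])
  have norm: "((\<lambda>j. (cmod (\<psi> j))\<^sup>2) has_sum 1\<^sup>2) UNIV"
    using has_sum_transmitter_state[OF assms(4,6), where f = "\<lambda>_. 1" and s = 1] assms(5)
    by (simp add: \<psi>_def case_prod_unfold)
  have \<psi>: "l2 \<psi>" "l2_norm \<psi> = 1"
    using l2_has_sum[OF norm] l2_norm_has_sum[OF norm] by simp_all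
  have P_nonneg: "0 \<le> P n" for n
    unfolding P_def total_photon_dist_def by (intro sum_nonneg assms(4))
  have P1: "P sums 1"
    using has_sum_total_photon_dist[where p = p and f = "\<lambda>_. 1" and s = 1] assms(5) by (simp add: P_def has_sum_imp_sums)
  have mean: "(\<lambda>n. real n * P n) sums \<mu>"
    unfolding \<mu>_def using assms(7) by (intro summable_sums) (simp add: P_def)
  \<comment> \<open>Integer powers of sqrt(1 - h) multiply over the modes, so the overlap is
    computed with them; the bounds are stated with real exponents.\<close>
  have pow: "sqrt (1 - h) ^ n = (1 - h) powr (real n / 2)" for n
    using ht by (simp add: powr_half_sqrt[symmetric] powr_power)
  have "(\<lambda>m. p m * sqrt (1 - h) ^ (\<Sum>r\<in>UNIV. m r)) summable_on UNIV"
  proof (rule summable_on_comparison_test[of p])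
    show "p summable_on UNIV"
      using assms(5) by (rule has_sum_imp_summable)
    show "p m * sqrt (1 - h) ^ (\<Sum>r\<in>UNIV. m r) \<le> p m" for m
      using assms(4)[of m] ht by (intro mult_left_le power_le_one) auto
  qed (use assms(4) ht in auto)
  then obtain s where s: "((\<lambda>m. p m * sqrt (1 - h) ^ (\<Sum>r\<in>UNIV. m r)) has_sum s) UNIV"
    by (auto simp: summable_on_def)
  have S_sums: "(\<lambda>n. P n * (1 - h) powr (real n / 2)) sums s"
    using has_sum_imp_sums[OF has_sum_total_photon_dist[where p = p and f = "\<lambda>n. sqrt (1 - h) ^ n", OF s]]
    by (simp add: P_def pow)
  then have sS: "s = S"
    by (simp add: S_def sums_iff)
  have "((\<lambda>(i, m). (cmod (\<psi> (i, m)))\<^sup>2 * sqrt (1 - h) ^ (\<Sum>r\<in>UNIV. m r)) has_sum s) UNIV"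
    unfolding \<psi>_def by (rule has_sum_transmitter_state[OF assms(4,6) _ s]) (use ht in auto)
  from l2_inner_purifications[OF assms(1-3) ht[unfolded h_def t_def] \<psi>(1) this[unfolded h_def]]
  have overlap: "l2_inner (absent_purification N_B \<psi>) (present_purification h t \<psi>) =
      of_real (\<nu> ^ CARD('m) * S)"
    by (simp add: h_def t_def \<nu>_def sS)
  define X where "X = target_absent N_B (pure_op \<psi>) - target_present \<eta> N_B (pure_op \<psi>)"
  have "X = (\<lambda>a b.
      (\<Sum>\<^sub>\<infinity>j. absent_purification N_B \<psi> (a, j) * cnj (absent_purification N_B \<psi> (b, j))) -
      (\<Sum>\<^sub>\<infinity>j. present_purification h t \<psi> (a, j) * cnj (present_purification h t \<psi> (b, j))))"
    using target_absent_purification[OF assms(3), of \<psi>] ht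
      target_present_purification[OF assms(1-3) \<psi>(1), folded h_def t_def]
    by (simp add: X_def fun_eq_iff)
  then have "trace_norm X \<le> 2 * sqrt (1 - (\<nu> ^ CARD('m) * S)\<^sup>2)"
    using trace_norm_purifications[OF l2_absent_purification[OF assms(3) \<psi>(1)]
        l2_present_purification[OF ht(1) _ ht(3,4) \<psi>(1)]]
      l2_norm_absent_purification[OF assms(3) \<psi>(1)] l2_norm_present_purification[OF ht(1) _ ht(3,4) \<psi>(1)]
      \<psi>(2) ht(2) overlap by simp
  also have "(\<nu> ^ CARD('m) * S)\<^sup>2 = \<nu> ^ (2 * CARD('m)) * S\<^sup>2"
    by (simp add: power_mult_distrib power_mult[symmetric] mult.commute)
  finally have 1: "helstrom_error (target_absent N_B (pure_op \<psi>)) (target_present \<eta> N_B (pure_op \<psi>)) \<ge>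
      1/2 * (1 - sqrt (1 - \<nu> ^ (2 * CARD('m)) * S\<^sup>2))"
    by (simp add: helstrom_error_def X_def fun_diff_def)
  have "(1 - h) powr (\<mu> / 2) \<le> S"
    using ht P_nonneg P1 mean S_sums sS by (intro powr_mean_le[of "1 - h" P \<mu> S]) auto
  then have "((1 - h) powr (\<mu> / 2))\<^sup>2 \<le> S\<^sup>2"
    by (intro power_mono) auto
  then have "(1 - h) powr \<mu> \<le> S\<^sup>2"
    using ht by (simp add: power2_eq_square flip: powr_add)
  then have "\<nu> ^ (2 * CARD('m)) * (1 - h) powr \<mu> \<le> \<nu> ^ (2 * CARD('m)) * S\<^sup>2"
    using \<nu> by (intro mult_left_mono) auto
  then have 2: "1/2 * (1 - sqrt (1 - \<nu> ^ (2 * CARD('m)) * (1 - h) powr \<mu>)) \<le>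
      1/2 * (1 - sqrt (1 - \<nu> ^ (2 * CARD('m)) * S\<^sup>2))"
    by simp
  show ?thesis
    using 1 2 unfolding Let_def \<psi>_def \<nu>_def S_def P_def \<mu>_def h_def by blast
qed

end
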